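(* Let $n\ge 1$ and let $a,f:[0,1]\times\mathbb{R}\times\mathbb{R}^n\times\mathbb{R}^n\to\mathbb{R}^n$, written $a(x,y,u,u')$ and $f(x,y,u,u')$, satisfy: (A1) $a(x,y+1,u,u')=a(x,y,u,u')$ and $f(x,y+1,u,u')=f(x,y,u,u')$ for all $x\in[0,1]$, $y\in\mathbb{R}$, $u,u'\in\mathbb{R}^n$; (A2) $a,\partial_u a,\partial_{u'}a,f,\partial_u f,\partial_{u'}f$ exist and are continuous on $[0,1]\times\mathbb{R}\times\mathbb{R}^n\times\mathbb{R}^n$; (A3) there exist constants $M\ge m>0$ such that for all $x\in[0,1]$, $y\in\mathbb{R}$ and $u,u_1',u_2'\in\mathbb{R}^n$ with $\|u\|\le 1$ we have $$\big(a(x,y,u,u_1')-a(x,y,u,u_2')\big)\cdot(u_1'-u_2')\ge m\|u_1'-u_2'\|^2,\qquad \|a(x,y,u,u_1')-a(x,y,u,u_2')\|\le M\|u_1'-u_2'\|.$$ Let $a_0,f_0$ be the homogenized maps defined in the context. Let $u=u_0$ be a weak solution to the homogenized boundary value problem $$a_0(x,u(x),u'(x))'=f_0(x,u(x),u'(x))\ \text{ for } x\in[0,1],\qquad u(0)=a_0(1,u(1),u'(1))=0$$ such that $\|u_0\|_\infty<1$ and such that the linearized homogenized boundary value problem $$\Big(\partial_u a_0(x,u_0(x),u_0'(x))u(x)+\partial_{u'}a_0(x,u_0(x),u_0'(x))u'(x)\Big)'=\partial_u f_0(x,u_0(x),u_0'(x))u(x)+\partial_{u'}f_0(x,u_0(x),u_0'(x))u'(x)$$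 for $x\in[0,1]$, with $$u(0)=\partial_u a_0(1,u_0(1),u_0'(1))u(1)+\partial_{u'}a_0(1,u_0(1),u_0'(1))u'(1)=0,$$ does not have weak solutions $u\neq 0$. For $\varepsilon>0$ consider the boundary value problem $$(P_\varepsilon)\qquad a(x,x/\varepsilon,u(x),u'(x))'=f(x,x/\varepsilon,u(x),u'(x))\ \text{ for } x\in[0,1],\qquad u(0)=a(1,1/\varepsilon,u(1),u'(1))=0.$$ Then the following is true: (i) There exist $\varepsilon_0>0$ and $\delta>0$ such that for all $\varepsilon\in(0,\varepsilon_0]$ there exists exactly one weak solution $u=u_\varepsilon$ to $(P_\varepsilon)$ with $$\|u(x)-u_0(x)\|+\|a(x,x/\varepsilon,u(x),u'(x))-a_0(x,u_0(x),u_0'(x))\|\le\delta\quad\text{for all } x\in[0,1].$$ Moreover, $$\|u_\varepsilon(x)-u_0(x)\|+\|a(x,x/\varepsilon,u_\varepsilon(x),u_\varepsilon'(x))-a_0(x,u_0(x),u_0'(x))\|\to 0\quad\text{for }\varepsilon\to 0$$ uniformly with respect to $x\in[0,1]$. (ii) For $\varepsilon\in(0,\varepsilon_0]$ and $x\in[0,1]$ denote $v_\varepsilon(x):=a(x,x/\varepsilon,u_\varepsilon(x),u_\varepsilon'(x))$ and $v_0(x):=a_0(x,u_0(x),u_0'(x))$. Suppose further that $\partial_x a$ and $\partial_x f$ exist and are continuous on $[0,1]\times\mathbb{R}\times\mathbb{R}^n\times\mathbb{R}^n$. Then $$\|u_\varepsilon-u_0\|_\infty+\|v_\varepsilon-v_0\|_\infty=O(\varepsilon)\quad\text{for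 }\varepsilon\to 0.$$
   Context: Notation. $v\cdot w$ is the Euclidean scalar product and $\|v\|=\sqrt{v\cdot v}$ the Euclidean norm in $\mathbb{R}^n$; $\|u\|_\infty:=\max\{\|u(x)\|: x\in[0,1]\}$ for $u\in C([0,1];\mathbb{R}^n)$. The symbols $\partial_x,\partial_u,\partial_{u'}$ denote partial derivatives with respect to the first, third and fourth arguments of $a$ and $f$ (and to the corresponding arguments $x,u,u'$ of $a_0,f_0$). Homogenized maps. By (A3), for $x\in[0,1]$, $y\in\mathbb{R}$, $\|u\|\le1$ the map $a(x,y,u,\cdot)$ is a bijection of $\mathbb{R}^n$ onto $\mathbb{R}^n$. Define, for $x\in[0,1]$, $y\in\mathbb{R}$ and $u,u'\in\mathbb{R}^n$ with $\|u\|\le 1$, $$b(x,y,u,\cdot):=a(x,y,u,\cdot)^{-1},\qquad b_0(x,u,u'):=\int_0^1 b(x,y,u,u')\,dy.$$ The maps $b_0(x,u,\cdot)$ are also strongly monotone and Lipschitz continuous, hence bijective from $\mathbb{R}^n$ onto $\mathbb{R}^n$, and one defines $$a_0(x,u,\cdot):=b_0(x,u,\cdot)^{-1},\qquad f_0(x,u,u'):=\int_0^1 f\big(x,y,u,b(x,y,u,a_0(x,u,u'))\big)\,dy.$$ Weak solutions. A function $u\in C^1([0,1];\mathbb{R}^n)$ is called a weak solution to $(P_\varepsilon)$ if $u(0)=0$ and $$\int_0^1\Big(a(x,x/\varepsilon,u(x),u'(x))\cdot\varphi'(x)+f(x,x/\varepsilon,u(x),u'(x))\cdot\varphi(x)\Big)dx=0$$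 for all $\varphi\in C^1([0,1];\mathbb{R}^n)$ with $\varphi(0)=0$. Weak solutions (again in $C^1([0,1];\mathbb{R}^n)$ with $u(0)=0$) to the homogenized problem and to its linearization are defined in the same way, with $a(x,x/\varepsilon,u(x),u'(x))$ and $f(x,x/\varepsilon,u(x),u'(x))$ replaced by $a_0(x,u(x),u'(x))$ and $f_0(x,u(x),u'(x))$, respectively by $\partial_u a_0(x,u_0(x),u_0'(x))u(x)+\partial_{u'}a_0(x,u_0(x),u_0'(x))u'(x)$ and $\partial_u f_0(x,u_0(x),u_0'(x))u(x)+\partial_{u'}f_0(x,u_0(x),u_0'(x))u'(x)$. *)

theory Defs
  imports "HOL-Analysis.Analysis" "HOL-Library.Landau_Symbols"
begin

text \<open>
  Functions on the interval \<open>[0,1]\<close> are total functions on the reals of which only the values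
  on \<open>{0..1}\<close> matter. Derivatives in this variable are taken within \<open>{0..1}\<close>, hence are
  one-sided at the end points, and two functions are identified if they agree on \<open>{0..1}\<close>.
  Likewise, coefficients \<open>a x y u p\<close> and \<open>f x y u p\<close> are constrained only for \<open>x \<in> {0..1}\<close>;
  the variable \<open>p\<close> stands for the derivative slot \<open>u'\<close>.
\<close>

definition deriv01 :: "(real \<Rightarrow> real^'n) \<Rightarrow> real \<Rightarrow> real^'n" where
  "deriv01 u x = vector_derivative u (at x within {0..1})"

definition C1_01 :: "(real \<Rightarrow> real^'n) \<Rightarrow> bool" where
  "C1_01 u \<longleftrightarrow> u differentiable_on {0..1} \<and> continuous_on {0..1} (deriv01 u)"

text \<open>For continuous \<open>u\<close> the supremum is attained, so this is the maximum norm.\<close>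

definition norm_inf :: "(real \<Rightarrow> real^'n) \<Rightarrow> real" where
  "norm_inf u = (SUP x\<in>{0..1}. norm (u x))"

text \<open>Partial derivatives with respect to the state and the derivative slot, as \<open>n \<times> n\<close> matrices.\<close>

definition partial_u ::
  "(real^'n \<Rightarrow> real^'n \<Rightarrow> real^'n) \<Rightarrow> real^'n \<Rightarrow> real^'n \<Rightarrow> real^'n^'n" where
  "partial_u h u p = jacobian (\<lambda>w. h w p) (at u)"

definition partial_p ::
  "(real^'n \<Rightarrow> real^'n \<Rightarrow> real^'n) \<Rightarrow> real^'n \<Rightarrow> real^'n \<Rightarrow> real^'n^'n" where
  "partial_p h u p = jacobian (h u) (at p)"

type_synonym 'n coeff = "real \<Rightarrow> real \<Rightarrow> real^'n \<Rightarrow> real^'n \<Rightarrow> real^'n"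

definition coeff_domain :: "(real \<times> real \<times> (real^'n) \<times> (real^'n)) set" where
  "coeff_domain = {0..1} \<times> UNIV \<times> UNIV \<times> UNIV"

definition periodic_coeff :: "'n::finite coeff \<Rightarrow> bool" where
  "periodic_coeff g \<longleftrightarrow> (\<forall>x\<in>{0..1}. \<forall>y u p. g x (y + 1) u p = g x y u p)"

definition smooth_coeff :: "'n::finite coeff \<Rightarrow> bool" where
  "smooth_coeff g \<longleftrightarrow>
     (\<forall>x\<in>{0..1}. \<forall>y u p. (\<lambda>w. g x y w p) differentiable (at u) \<and> g x y u differentiable (at p)) \<and>
     continuous_on coeff_domain (\<lambda>(x, y, u, p). g x y u p) \<and>
     continuous_on coeff_domain (\<lambda>(x, y, u, p). partial_u (g x y) u p) \<and>
     continuous_on coeff_domain (\<lambda>(x, y, u, p). partial_p (g x y) u p)"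

definition smooth_coeff_x :: "'n::finite coeff \<Rightarrow> bool" where
  "smooth_coeff_x g \<longleftrightarrow>
     (\<forall>x\<in>{0..1}. \<forall>y u p. (\<lambda>s. g s y u p) differentiable (at x within {0..1})) \<and>
     continuous_on coeff_domain (\<lambda>(x, y, u, p). deriv01 (\<lambda>s. g s y u p) x)"

definition monotone_lipschitz_coeff :: "real \<Rightarrow> real \<Rightarrow> 'n::finite coeff \<Rightarrow> bool" where
  "monotone_lipschitz_coeff m M a \<longleftrightarrow>
     (\<forall>x\<in>{0..1}. \<forall>y u p\<^sub>1 p\<^sub>2. norm u \<le> 1 \<longrightarrow>
        (a x y u p\<^sub>1 - a x y u p\<^sub>2) \<bullet> (p\<^sub>1 - p\<^sub>2) \<ge> m * (norm (p\<^sub>1 - p\<^sub>2))\<^sup>2 \<and>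
        norm (a x y u p\<^sub>1 - a x y u p\<^sub>2) \<le> M * norm (p\<^sub>1 - p\<^sub>2))"

text \<open>
  The homogenized maps. They are meaningful only for \<open>x \<in> {0..1}\<close> and \<open>norm u \<le> 1\<close>,
  where the functions being inverted are bijections of \<open>\<real>\<^sup>n\<close>.
\<close>

definition hom_b :: "'n::finite coeff \<Rightarrow> 'n coeff" where
  "hom_b a x y u = inv (a x y u)"

definition hom_b0 :: "'n::finite coeff \<Rightarrow> real \<Rightarrow> real^'n \<Rightarrow> real^'n \<Rightarrow> real^'n" where
  "hom_b0 a x u p = integral {0..1} (\<lambda>y. hom_b a x y u p)"

definition hom_a0 :: "'n::finite coeff \<Rightarrow> real \<Rightarrow> real^'n \<Rightarrow> real^'n \<Rightarrow> real^'n" where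
  "hom_a0 a x u = inv (hom_b0 a x u)"

definition hom_f0 :: "'n::finite coeff \<Rightarrow> 'n coeff \<Rightarrow> real \<Rightarrow> real^'n \<Rightarrow> real^'n \<Rightarrow> real^'n" where
  "hom_f0 a f x u p = integral {0..1} (\<lambda>y. f x y u (hom_b a x y u (hom_a0 a x u p)))"

text \<open>
  Weak solutions of \<open>A(x,u,u')' = F(x,u,u')\<close> with \<open>u(0) = A(1,u(1),u'(1)) = 0\<close>; the condition
  at \<open>1\<close> is encoded by not requiring the test functions to vanish there.
\<close>

definition weak_solution ::
  "(real \<Rightarrow> real^'n \<Rightarrow> real^'n \<Rightarrow> real^'n) \<Rightarrow> (real \<Rightarrow> real^'n \<Rightarrow> real^'n \<Rightarrow> real^'n) \<Rightarrow>
   (real \<Rightarrow> real^'n) \<Rightarrow> bool" where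
  "weak_solution A F u \<longleftrightarrow> C1_01 u \<and> u 0 = 0 \<and>
     (\<forall>\<phi>. C1_01 \<phi> \<and> \<phi> 0 = 0 \<longrightarrow>
        ((\<lambda>x. A x (u x) (deriv01 u x) \<bullet> deriv01 \<phi> x + F x (u x) (deriv01 u x) \<bullet> \<phi> x)
           has_integral 0) {0..1})"

definition weak_solution_eps ::
  "'n::finite coeff \<Rightarrow> 'n coeff \<Rightarrow> real \<Rightarrow> (real \<Rightarrow> real^'n) \<Rightarrow> bool" where
  "weak_solution_eps a f \<epsilon> = weak_solution (\<lambda>x. a x (x / \<epsilon>)) (\<lambda>x. f x (x / \<epsilon>))"

definition weak_solution_hom ::
  "'n::finite coeff \<Rightarrow> 'n coeff \<Rightarrow> (real \<Rightarrow> real^'n) \<Rightarrow> bool" where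
  "weak_solution_hom a f = weak_solution (hom_a0 a) (hom_f0 a f)"

definition linearize ::
  "(real \<Rightarrow> real^'n \<Rightarrow> real^'n \<Rightarrow> real^'n) \<Rightarrow> (real \<Rightarrow> real^'n) \<Rightarrow>
   real \<Rightarrow> real^'n \<Rightarrow> real^'n \<Rightarrow> real^'n" where
  "linearize H u\<^sub>0 x u p =
     partial_u (H x) (u\<^sub>0 x) (deriv01 u\<^sub>0 x) *v u + partial_p (H x) (u\<^sub>0 x) (deriv01 u\<^sub>0 x) *v p"

definition weak_solution_lin ::
  "'n::finite coeff \<Rightarrow> 'n coeff \<Rightarrow> (real \<Rightarrow> real^'n) \<Rightarrow> (real \<Rightarrow> real^'n) \<Rightarrow> bool" where
  "weak_solution_lin a f u\<^sub>0 =
     weak_solution (linearize (hom_a0 a) u\<^sub>0) (linearize (hom_f0 a f) u\<^sub>0)"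

definition flux_eps :: "'n::finite coeff \<Rightarrow> real \<Rightarrow> (real \<Rightarrow> real^'n) \<Rightarrow> real \<Rightarrow> real^'n" where
  "flux_eps a \<epsilon> u x = a x (x / \<epsilon>) (u x) (deriv01 u x)"

definition flux_hom :: "'n::finite coeff \<Rightarrow> (real \<Rightarrow> real^'n) \<Rightarrow> real \<Rightarrow> real^'n" where
  "flux_hom a u x = hom_a0 a x (u x) (deriv01 u x)"

definition local_solution ::
  "'n::finite coeff \<Rightarrow> 'n coeff \<Rightarrow> (real \<Rightarrow> real^'n) \<Rightarrow> real \<Rightarrow> real \<Rightarrow> (real \<Rightarrow> real^'n) \<Rightarrow> bool" where
  "local_solution a f u\<^sub>0 \<delta> \<epsilon> u \<longleftrightarrow> weak_solution_eps a f \<epsilon> u \<and>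
     (\<forall>x\<in>{0..1}. norm (u x - u\<^sub>0 x) + norm (flux_eps a \<epsilon> u x - flux_hom a u\<^sub>0 x) \<le> \<delta>)"

end

theory Submission
  imports Defs
begin

text \<open>
  A weak solution is turned into a solution of a first-order system. Writing \<open>v\<close> for the flux and
  \<open>b\<close> for the inverse of \<open>a\<close> in its last argument, the pair \<open>z = (u, v)\<close> solves
  \<open>z' = F(x, x/\<epsilon>, z)\<close> with \<open>F(x, y, u, v) = (b, f(x, y, u, b))\<close>, \<open>b = b(x, y, u, v)\<close>, and the boundary
  conditions \<open>u(0) = 0\<close>, \<open>v(1) = 0\<close>. In these variables homogenization is plain averaging: since
  \<open>b\<^sub>0\<close> is the mean of \<open>b\<close> and \<open>f\<^sub>0(x, u, b\<^sub>0(x, u, v))\<close> is the mean of \<open>f(x, y, u, b(x, y, u, v))\<close>, the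
  homogenized problem is \<open>z' = F\<^sub>0(x, z)\<close> with \<open>F\<^sub>0\<close> the mean of \<open>F\<close> over one period of \<open>y\<close>.

  Put \<open>z = z\<^sub>0 + h\<close>. Then \<open>h' = r\<^sub>\<epsilon> + N\<^sub>\<epsilon> h + R\<^sub>\<epsilon>(h)\<close>, where \<open>r\<^sub>\<epsilon> = F(x, x/\<epsilon>, z\<^sub>0) - F\<^sub>0(x, z\<^sub>0)\<close> has a
  uniformly small primitive, \<open>N\<^sub>\<epsilon> = \<partial>F(x, x/\<epsilon>, z\<^sub>0)\<close> and the remainder \<open>R\<^sub>\<epsilon>\<close> has a small Lipschitz constant
  near \<open>0\<close>. The operators \<open>N\<^sub>\<epsilon>\<close> do not converge to their mean \<open>N\<^sub>0\<close> in norm, but only their action on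
  the fundamental matrix \<open>X\<close> of the limit equation \<open>k' = N\<^sub>0 k\<close> matters: a solution with initial
  value \<open>(0, e)\<close> stays close to \<open>X e\<close> as soon as the primitive of \<open>(N\<^sub>\<epsilon> - N\<^sub>0) X\<close> is small, which is
  averaging applied to one fixed function of \<open>x\<close> and \<open>x/\<epsilon>\<close>. Shooting therefore reduces the boundary value
  problem to a finite-dimensional equation whose linear part is close to \<open>e \<mapsto> (X(1) e)\<^sub>2\<close>; this map
  is invertible because the linearized homogenized problem has no nontrivial solution. A contraction
  in the unknown \<open>e\<close> gives existence, and the same estimate gives uniqueness and
  \<open>\<parallel>z - z\<^sub>0\<parallel> \<le> C sup\<^sub>x |\<integral>\<^sub>0\<^sup>x r\<^sub>\<epsilon>|\<close> (\<open>perturbed_bvp\<close>, \<open>periodic_averaging_bvp\<close>).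

  The primitive of \<open>r\<^sub>\<epsilon>\<close> is estimated cell by cell (\<open>averaging_estimate\<close>): it tends to \<open>0\<close> by uniform
  continuity, and it is of order \<open>\<epsilon>\<close> if \<open>x \<mapsto> F(x, y, z\<^sub>0(x))\<close> is Lipschitz continuous uniformly in \<open>y\<close>,
  which is what the differentiability in \<open>x\<close> provides.

  Strong monotonicity enters through the inverses: a strongly monotone map has a Lipschitz inverse, its
  derivative is again strongly monotone, and averages of the inverses are strongly monotone. So \<open>F\<close> and
  \<open>F\<^sub>0\<close> are continuously differentiable in \<open>z\<close>, and \<open>a\<^sub>0\<close> has the derivative that matches the linearized
  problem with \<open>k' = N\<^sub>0 k\<close>.
\<close>

section \<open>Integral equations on the unit interval\<close>

lemma continuous_on_superposition:
  assumes "continuous_on (S \<times> T) (\<lambda>(s, z). G s z)" "continuous_on S z" "z ` S \<subseteq> T"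
  shows "continuous_on S (\<lambda>s. G s (z s))"
proof -
  have "continuous_on S (\<lambda>s. (\<lambda>(s, z). G s z) (s, z s))"
    by (rule continuous_on_compose2[OF assms(1)]) (use assms in \<open>auto intro!: continuous_intros\<close>)
  then show ?thesis by simp
qed

lemma exp_integral:
  fixes K :: real
  assumes "0 \<le> x"
  shows "((\<lambda>s. K * exp (K * s)) has_integral exp (K * x) - 1) {0..x}"
proof -
  have "((\<lambda>s. K * exp (K * s)) has_integral exp (K * x) - exp (K * 0)) {0..x}"
    by (rule fundamental_theorem_of_calculus[OF assms])
      (auto intro!: derivative_eq_intros simp: has_real_derivative_iff_has_vector_derivative[symmetric])
  then show ?thesis by simp
qed

text \<open>
  At a maximum point of \<open>exp (-2 L x) \<phi>(x)\<close> the integral term contributes at most half of the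
  maximum, so the maximum is at most \<open>2 A\<close>. The constant is not the sharp one.
\<close>

lemma gronwall_bound:
  fixes \<phi> :: "real \<Rightarrow> real"
  assumes cont: "continuous_on {0..1} \<phi>" and "0 \<le> A" "0 \<le> L"
    and le: "\<And>x. x \<in> {0..1} \<Longrightarrow> \<phi> x \<le> A + L * integral {0..x} \<phi>"
    and x: "x \<in> {0..1}"
  shows "\<phi> x \<le> 2 * A * exp (2 * L)"
proof -
  have "continuous_on {0..1} (\<lambda>x. exp (- (2 * L * x)) * \<phi> x)"
    by (intro continuous_intros cont)
  then obtain t where t: "t \<in> {0..1}"
    and max: "\<And>s. s \<in> {0..1} \<Longrightarrow> exp (- (2 * L * s)) * \<phi> s \<le> exp (- (2 * L * t)) * \<phi> t"
    using continuous_attains_sup[of "{0..1::real}"] by force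
  define m where "m = exp (- (2 * L * t)) * \<phi> t"
  have le_m: "\<phi> s \<le> m * exp (2 * L * s)" if "s \<in> {0..1}" for s
    using max[OF that] by (simp add: m_def exp_minus field_simps)
  have phi_int: "\<phi> integrable_on {0..t}"
    by (rule integrable_continuous_real) (use cont t in \<open>auto intro: continuous_on_subset\<close>)
  have "L * integral {0..t} \<phi> = integral {0..t} (\<lambda>s. L * \<phi> s)" by simp
  also have "\<dots> \<le> integral {0..t} (\<lambda>s. m / 2 * (2 * L * exp (2 * L * s)))"
  proof (rule integral_le)
    show "(\<lambda>s. m / 2 * (2 * L * exp (2 * L * s))) integrable_on {0..t}"
      by (intro integrable_continuous_real continuous_intros)
    show "(\<lambda>s. L * \<phi> s) integrable_on {0..t}"
      using integrable_cmul[OF phi_int, of L] by simp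
    show "L * \<phi> s \<le> m / 2 * (2 * L * exp (2 * L * s))" if "s \<in> {0..t}" for s
      using mult_left_mono[OF le_m \<open>0 \<le> L\<close>, of s] that t by (simp add: mult_ac)
  qed
  also have "\<dots> = m / 2 * (exp (2 * L * t) - 1)"
    using has_integral_mult_right[OF exp_integral, of t "m / 2" "2 * L"] t
    by (intro integral_unique) auto
  finally have "\<phi> t \<le> A + m / 2 * (exp (2 * L * t) - 1)" using le[OF t] by simp
  then have "m \<le> exp (- (2 * L * t)) * (A + m / 2 * (exp (2 * L * t) - 1))"
    by (simp add: m_def)
  also have "\<dots> = exp (- (2 * L * t)) * A + m / 2 * (1 - exp (- (2 * L * t)))"
    by (simp add: algebra_simps exp_minus)
  finally have mle: "m \<le> exp (- (2 * L * t)) * A + m / 2 * (1 - exp (- (2 * L * t)))" .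
  have "m \<le> 2 * A"
  proof (cases "m \<le> 0")
    case False
    have "exp (- (2 * L * t)) * A \<le> A"
      using \<open>0 \<le> A\<close> \<open>0 \<le> L\<close> t by (intro mult_left_le_one_le) auto
    moreover have "m / 2 * (1 - exp (- (2 * L * t))) \<le> m / 2"
      using False by (intro mult_right_le_one_le) (use \<open>0 \<le> L\<close> t in auto)
    ultimately show ?thesis using mle by linarith
  qed (use \<open>0 \<le> A\<close> in simp)
  have "\<phi> x \<le> m * exp (2 * L * x)" by (rule le_m[OF x])
  also have "\<dots> \<le> 2 * A * exp (2 * L * x)" using \<open>m \<le> 2 * A\<close> by simp
  also have "\<dots> \<le> 2 * A * exp (2 * L)"
    using \<open>0 \<le> A\<close> \<open>0 \<le> L\<close> x by (intro mult_left_mono) (auto simp: mult_left_le)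
  finally show ?thesis .
qed

text \<open>
  In the unknown \<open>\<zeta>(x) = exp (-K x) z(x)\<close> with \<open>K > 2 L\<close> the integral operator halves distances in the
  maximum norm, so the solution exists on the whole interval. Allowing values in a Banach space covers
  operator-valued equations, hence fundamental matrices.
\<close>

lemma volterra_solution:
  fixes G :: "real \<Rightarrow> 'a::banach \<Rightarrow> 'a"
  assumes cont: "continuous_on ({0..1} \<times> UNIV) (\<lambda>(s, z). G s z)"
    and "0 \<le> L"
    and lip: "\<And>s z w. s \<in> {0..1} \<Longrightarrow> norm (G s z - G s w) \<le> L * norm (z - w)"
  shows "\<exists>z. continuous_on {0..1} z \<and> (\<forall>x\<in>{0..1}. z x = c + integral {0..x} (\<lambda>s. G s (z s)))"
proof -
  define K where "K = 2 * L + 1"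
  have "K > 0" using \<open>0 \<le> L\<close> by (simp add: K_def)
  (* Functions on the interval are extended constantly to the real line, so that they live in the
     Banach space of bounded continuous functions. *)
  define cl where "cl x = max 0 (min 1 x)" for x :: real
  have cl: "cl x \<in> {0..1}" for x by (simp add: cl_def)
  have cl_id: "x \<in> {0..1} \<Longrightarrow> cl x = x" for x by (simp add: cl_def)
  have cl_cont: "continuous_on UNIV cl" unfolding cl_def by (intro continuous_intros)
  define I where "I \<zeta> t = exp (- (K * t)) *\<^sub>R (c + integral {0..t} (\<lambda>s. G s (exp (K * s) *\<^sub>R \<zeta> s)))"
    for \<zeta> :: "real \<Rightarrow> 'a" and t
  have Gcont: "continuous_on {0..1} (\<lambda>s. G s (exp (K * s) *\<^sub>R \<zeta> s))"
    if "continuous_on {0..1} \<zeta>" for \<zeta>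
    by (rule continuous_on_superposition[OF cont]) (auto intro!: continuous_intros that)
  have Icont: "continuous_on {0..1} (I \<zeta>)" if "continuous_on {0..1} \<zeta>" for \<zeta>
    unfolding I_def
    by (intro continuous_intros indefinite_integral_continuous_1 integrable_continuous_real Gcont that)
  have Ibc: "(\<lambda>x. I \<zeta> (cl x)) \<in> bcontfun" if "continuous_on {0..1} \<zeta>" for \<zeta>
  proof -
    have "continuous_on UNIV (\<lambda>x. I \<zeta> (cl x))"
      by (rule continuous_on_compose2[OF Icont[OF that] cl_cont]) (use cl in auto)
    moreover have "bounded (range (\<lambda>x. I \<zeta> (cl x)))"
      by (rule bounded_subset[OF compact_imp_bounded[OF compact_continuous_image[OF Icont[OF that] compact_Icc]]])
        (use cl in auto)
    ultimately show ?thesis by (simp add: bcontfun_def)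
  qed
  define T :: "(real \<Rightarrow>\<^sub>C 'a) \<Rightarrow> (real \<Rightarrow>\<^sub>C 'a)"
    where "T \<zeta> = Bcontfun (\<lambda>x. I (apply_bcontfun \<zeta>) (cl x))" for \<zeta>
  have ac: "continuous_on {0..1} (apply_bcontfun \<zeta>)" for \<zeta> :: "real \<Rightarrow>\<^sub>C 'a"
    using continuous_on_apply_bcontfun continuous_on_subset by blast
  have T: "T \<zeta> x = I \<zeta> (cl x)" for \<zeta> x
    unfolding T_def by (subst Bcontfun_inverse) (auto intro!: Ibc ac)
  have contr: "dist (T \<zeta>) (T \<xi>) \<le> 1 / 2 * dist \<zeta> \<xi>" for \<zeta> \<xi>
  proof (rule dist_bound)
    fix x
    define t where "t = cl x"
    have t: "t \<in> {0..1}" unfolding t_def by (rule cl)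
    have sub: "{0..t} \<subseteq> {0..1}" using t by auto
    have int: "(\<lambda>s. G s (exp (K * s) *\<^sub>R apply_bcontfun \<eta> s)) integrable_on {0..t}" for \<eta>
      by (intro integrable_continuous_real continuous_on_subset[OF Gcont[OF ac] sub])
    have hi: "((\<lambda>s. dist \<zeta> \<xi> / 2 * (K * exp (K * s))) has_integral
        dist \<zeta> \<xi> / 2 * (exp (K * t) - 1)) {0..t}"
      using has_integral_mult_right[OF exp_integral, of t "dist \<zeta> \<xi> / 2" K] t by auto
    have "norm (integral {0..t} (\<lambda>s. G s (exp (K * s) *\<^sub>R \<zeta> s)) - integral {0..t} (\<lambda>s. G s (exp (K * s) *\<^sub>R \<xi> s)))
      = norm (integral {0..t} (\<lambda>s. G s (exp (K * s) *\<^sub>R \<zeta> s) - G s (exp (K * s) *\<^sub>R \<xi> s)))"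
      by (simp add: integral_diff[OF int int])
    also have "\<dots> \<le> integral {0..t} (\<lambda>s. dist \<zeta> \<xi> / 2 * (K * exp (K * s)))"
    proof (rule integral_norm_bound_integral)
      show "(\<lambda>s. G s (exp (K * s) *\<^sub>R \<zeta> s) - G s (exp (K * s) *\<^sub>R \<xi> s)) integrable_on {0..t}"
        by (rule integrable_diff[OF int int])
      show "(\<lambda>s. dist \<zeta> \<xi> / 2 * (K * exp (K * s))) integrable_on {0..t}" using hi by blast
      fix s assume "s \<in> {0..t}"
      then have "norm (G s (exp (K * s) *\<^sub>R \<zeta> s) - G s (exp (K * s) *\<^sub>R \<xi> s))
        \<le> L * norm (exp (K * s) *\<^sub>R \<zeta> s - exp (K * s) *\<^sub>R \<xi> s)"
        using t by (intro lip) auto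
      also have "\<dots> = L * (exp (K * s) * dist (\<zeta> s) (\<xi> s))"
        by (simp add: dist_norm flip: scaleR_diff_right)
      also have "\<dots> \<le> K / 2 * (exp (K * s) * dist \<zeta> \<xi>)"
      proof (rule mult_mono)
        show "exp (K * s) * dist (\<zeta> s) (\<xi> s) \<le> exp (K * s) * dist \<zeta> \<xi>"
          by (intro mult_left_mono dist_bounded) auto
      qed (use \<open>0 \<le> L\<close> in \<open>auto simp: K_def\<close>)
      finally show "norm (G s (exp (K * s) *\<^sub>R \<zeta> s) - G s (exp (K * s) *\<^sub>R \<xi> s))
        \<le> dist \<zeta> \<xi> / 2 * (K * exp (K * s))" by (simp add: mult_ac)
    qed
    also have "\<dots> = dist \<zeta> \<xi> / 2 * (exp (K * t) - 1)" using hi by (rule integral_unique)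
    also have "\<dots> \<le> dist \<zeta> \<xi> / 2 * exp (K * t)" by (intro mult_left_mono) auto
    finally have le: "norm (integral {0..t} (\<lambda>s. G s (exp (K * s) *\<^sub>R \<zeta> s)) - integral {0..t} (\<lambda>s. G s (exp (K * s) *\<^sub>R \<xi> s)))
      \<le> dist \<zeta> \<xi> / 2 * exp (K * t)" .
    have "dist (T \<zeta> x) (T \<xi> x) = exp (- (K * t)) *
      norm (integral {0..t} (\<lambda>s. G s (exp (K * s) *\<^sub>R \<zeta> s)) - integral {0..t} (\<lambda>s. G s (exp (K * s) *\<^sub>R \<xi> s)))"
      by (simp add: T I_def dist_norm t_def flip: scaleR_diff_right)
    also have "\<dots> \<le> exp (- (K * t)) * (dist \<zeta> \<xi> / 2 * exp (K * t))"
      by (intro mult_left_mono le) auto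
    also have "\<dots> = 1 / 2 * dist \<zeta> \<xi>" by (simp add: exp_minus)
    finally show "dist (T \<zeta> x) (T \<xi> x) \<le> 1 / 2 * dist \<zeta> \<xi>" .
  qed
  obtain \<zeta> where \<zeta>: "T \<zeta> = \<zeta>"
    using banach_fix_type[of "1 / 2" T] contr by auto
  show ?thesis
  proof (intro exI conjI ballI)
    show "continuous_on {0..1} (\<lambda>x. exp (K * x) *\<^sub>R \<zeta> x)" by (intro continuous_intros ac)
    fix x :: real assume x: "x \<in> {0..1}"
    have "\<zeta> x = I \<zeta> x" using T[of \<zeta> x] \<zeta> cl_id[OF x] by simp
    then have "exp (K * x) *\<^sub>R \<zeta> x = exp (K * x) *\<^sub>R I \<zeta> x" by (simp only:)
    then show "exp (K * x) *\<^sub>R \<zeta> x = c + integral {0..x} (\<lambda>s. G s (exp (K * s) *\<^sub>R \<zeta> s))"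
      by (simp add: I_def exp_minus)
  qed
qed

section \<open>Averaging of rapidly oscillating functions\<close>

lemma continuous_on_section:
  assumes "continuous_on (S \<times> T) (\<lambda>(s, y). N s y)" "s \<in> S"
  shows "continuous_on T (N s)"
proof -
  have "continuous_on T (\<lambda>y. (\<lambda>(s, y). N s y) (s, y))"
    by (rule continuous_on_compose2[OF assms(1)])
      (use assms(2) in \<open>auto intro: continuous_on_Pair continuous_on_const continuous_on_id\<close>)
  then show ?thesis by simp
qed

lemma periodic_shift:
  fixes g :: "real \<Rightarrow> 'a"
  assumes "\<And>y. g (y + 1) = g y"
  shows "g (y + of_int k) = g y"
proof (induction k rule: int_induct[where k = 0])
  case (step1 i)
  then show ?case using assms[of "y + of_int i"] by (simp add: add.assoc)
next
  case (step2 i)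
  then show ?case using assms[of "y + of_int (i - 1)"] by (simp add: algebra_simps)
qed simp

text \<open>
  One cell of length \<open>\<epsilon>\<close> sees exactly one period of \<open>s \<mapsto> g (s / \<epsilon>)\<close>.
\<close>

lemma integral_rescaled_period:
  fixes g :: "real \<Rightarrow> 'a::banach"
  assumes cont: "continuous_on UNIV g" and per: "\<And>y. g (y + 1) = g y" and "0 < \<epsilon>"
  shows "((\<lambda>s. g (s / \<epsilon>)) has_integral \<epsilon> *\<^sub>R integral {0..1} g) {real k * \<epsilon>..real (Suc k) * \<epsilon>}"
proof -
  have "(g has_integral integral {0..1} g) (cbox 0 1)"
    by (simp add: integrable_integral integrable_continuous_real continuous_on_subset[OF cont])
  from has_integral_affinity[OF this, of "1 / \<epsilon>" "- real k"] \<open>0 < \<epsilon>\<close>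
  have "((\<lambda>s. g (s / \<epsilon> - real k)) has_integral \<epsilon> *\<^sub>R integral {0..1} g)
      ((\<lambda>x. \<epsilon> * x + \<epsilon> * real k) ` {0..1})"
    by simp
  moreover have "(\<lambda>x. \<epsilon> * x + \<epsilon> * real k) ` {0..1} = {real k * \<epsilon>..real (Suc k) * \<epsilon>}"
    using \<open>0 < \<epsilon>\<close> by (subst image_affinity_atLeastAtMost) (auto simp: algebra_simps)
  moreover have "g (s / \<epsilon> - real k) = g (s / \<epsilon>)" for s
    using periodic_shift[of g "s / \<epsilon>" "- int k", OF per] by simp
  ultimately show ?thesis by simp
qed

text \<open>
  On a cell \<open>[k \<epsilon>, (k + 1) \<epsilon>]\<close> the slow argument may be frozen at the left end point: this costs
  \<open>\<eta> \<epsilon>\<close> for \<open>N\<close> and \<open>\<eta> \<epsilon>\<close> for its mean, and the frozen difference integrates to \<open>0\<close>. At most \<open>1 / \<epsilon>\<close> full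
  cells fit below \<open>x\<close>, and the last, incomplete cell contributes at most \<open>2 B \<epsilon>\<close>. The estimate serves both
  for convergence (\<open>\<eta>\<close> a modulus of continuity) and for the rate (\<open>\<eta>\<close> proportional to \<open>\<epsilon>\<close>).
\<close>

lemma averaging_estimate:
  fixes N :: "real \<Rightarrow> real \<Rightarrow> 'a::banach"
  assumes cont: "continuous_on ({0..1} \<times> UNIV) (\<lambda>(s, y). N s y)"
    and per: "\<And>s y. s \<in> {0..1} \<Longrightarrow> N s (y + 1) = N s y"
    and bound: "\<And>s y. s \<in> {0..1} \<Longrightarrow> norm (N s y) \<le> B"
    and osc: "\<And>s t y. s \<in> {0..1} \<Longrightarrow> t \<in> {0..1} \<Longrightarrow> \<bar>s - t\<bar> \<le> \<epsilon> \<Longrightarrow> norm (N s y - N t y) \<le> \<eta>"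
    and "0 < \<epsilon>" and x: "x \<in> {0..1}"
  shows "norm (integral {0..x} (\<lambda>s. N s (s / \<epsilon>) - integral {0..1} (N s))) \<le> 2 * \<eta> + 2 * B * \<epsilon>"
proof -
  define Nb where "Nb s = integral {0..1} (N s)" for s
  define g where "g s = N s (s / \<epsilon>) - Nb s" for s
  have "0 \<le> \<eta>" using osc[of 0 0] \<open>0 < \<epsilon>\<close> by simp
  have "0 \<le> B" using bound[of 0] order_trans[OF norm_ge_zero] by fastforce
  have Ncont: "continuous_on UNIV (N s)" if "s \<in> {0..1}" for s
    by (rule continuous_on_section[OF cont that])
  have Nint: "N s integrable_on {0..1}" if "s \<in> {0..1}" for s
    by (intro integrable_continuous_real continuous_on_subset[OF Ncont[OF that]]) auto
  have Nb_le: "norm (Nb s) \<le> B" if "s \<in> {0..1}" for s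
    using integral_bound[of 0 1 "N s" B] continuous_on_subset[OF Ncont[OF that]] bound[OF that]
    by (auto simp: Nb_def)
  have Nb_osc: "norm (Nb s - Nb t) \<le> \<eta>" if "s \<in> {0..1}" "t \<in> {0..1}" "\<bar>s - t\<bar> \<le> \<epsilon>" for s t
  proof -
    have "continuous_on {0..1} (\<lambda>y. N s y - N t y)"
      using that by (intro continuous_intros continuous_on_subset[OF Ncont]) auto
    then have "norm (integral {0..1} (\<lambda>y. N s y - N t y)) \<le> \<eta> * (1 - 0)"
      by (intro integral_bound) (use osc that in auto)
    then show ?thesis using Nint that by (simp add: Nb_def integral_diff)
  qed
  have Nb_cont: "continuous_on {0..1} Nb"
    using integral_continuous_on_param[of "{0..1}" 0 1 N] continuous_on_subset[OF cont, of "{0..1} \<times> {0..1}"]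
    by (auto simp: Nb_def[abs_def])
  have Ncont': "continuous_on {0..1} (\<lambda>s. N s (s / \<epsilon>))"
    by (rule continuous_on_superposition[OF cont]) (use \<open>0 < \<epsilon>\<close> in \<open>auto intro!: continuous_intros\<close>)
  have gcont: "continuous_on {0..1} g"
    unfolding g_def by (intro continuous_intros Ncont' Nb_cont)
  have gint: "g integrable_on {c..d}" if "0 \<le> c" "d \<le> 1" for c d
    by (rule integrable_continuous_real) (use that in \<open>auto intro: continuous_on_subset[OF gcont]\<close>)
  have cell: "norm (integral {real k * \<epsilon>..real (Suc k) * \<epsilon>} g) \<le> 2 * \<eta> * \<epsilon>"
    if k: "real (Suc k) * \<epsilon> \<le> 1" for k
  proof -
    let ?t = "real k * \<epsilon>" and ?I = "{real k * \<epsilon>..real (Suc k) * \<epsilon>}"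
    have t: "?t \<in> {0..1}" using k \<open>0 < \<epsilon>\<close> by (auto simp: algebra_simps)
    have I: "?I \<subseteq> {0..1}"
      using k t by (auto simp only: atLeastAtMost_iff subset_iff intro: order_trans)
    have 1: "((\<lambda>s. N ?t (s / \<epsilon>) - Nb ?t) has_integral 0) ?I"
      using has_integral_diff[OF integral_rescaled_period[OF Ncont[OF t] per[OF t] \<open>0 < \<epsilon>\<close>, of k]
          has_integral_const_real[of "Nb ?t" ?t "real (Suc k) * \<epsilon>"]] \<open>0 < \<epsilon>\<close>
      by (simp add: Nb_def algebra_simps)
    define q where "q s = (N s (s / \<epsilon>) - N ?t (s / \<epsilon>)) - (Nb s - Nb ?t)" for s
    have "continuous_on ?I (\<lambda>s. N ?t (s / \<epsilon>))"
      by (rule continuous_on_compose2[OF Ncont[OF t]]) (use \<open>0 < \<epsilon>\<close> in \<open>auto intro!: continuous_intros\<close>)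
    then have qcont: "continuous_on ?I q"
      unfolding q_def using I
      by (intro continuous_intros continuous_on_subset[OF Ncont'] continuous_on_subset[OF Nb_cont])
    have "g = (\<lambda>s. q s + (N ?t (s / \<epsilon>) - Nb ?t))" by (auto simp: g_def q_def)
    then have "integral ?I g = integral ?I q"
      using integral_add[OF integrable_continuous_real[OF qcont] has_integral_integrable[OF 1]]
        integral_unique[OF 1] by simp
    also have "norm \<dots> \<le> 2 * \<eta> * (real (Suc k) * \<epsilon> - ?t)"
    proof (rule integral_bound[OF _ qcont])
      show "norm (q s) \<le> 2 * \<eta>" if "s \<in> ?I" for s
      proof -
        have "s \<in> {0..1}" using that I by blast
        moreover have "\<bar>s - ?t\<bar> \<le> \<epsilon>" using that by (auto simp: algebra_simps)
        ultimately
        have "norm (N s (s / \<epsilon>) - N ?t (s / \<epsilon>)) \<le> \<eta>" "norm (Nb s - Nb ?t) \<le> \<eta>"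
          using osc Nb_osc t by auto
        from norm_triangle_le_diff[OF add_mono[OF this]] show ?thesis unfolding q_def by simp
      qed
    qed (use \<open>0 < \<epsilon>\<close> in simp)
    finally show ?thesis by (simp add: algebra_simps)
  qed
  have cells: "norm (integral {0..real k * \<epsilon>} g) \<le> 2 * \<eta> * (real k * \<epsilon>)" if "real k * \<epsilon> \<le> 1" for k
    using that
  proof (induction k)
    case (Suc k)
    have k: "real k * \<epsilon> \<le> 1" using Suc.prems \<open>0 < \<epsilon>\<close> by (simp add: algebra_simps)
    have "integral {0..real k * \<epsilon>} g + integral {real k * \<epsilon>..real (Suc k) * \<epsilon>} g
        = integral {0..real (Suc k) * \<epsilon>} g"
      by (rule Henstock_Kurzweil_Integration.integral_combine)
        (use \<open>0 < \<epsilon>\<close> Suc.prems in \<open>auto intro!: gint simp: algebra_simps\<close>)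
    then have "norm (integral {0..real (Suc k) * \<epsilon>} g) \<le> 2 * \<eta> * (real k * \<epsilon>) + 2 * \<eta> * \<epsilon>"
      using norm_triangle_mono[OF Suc.IH[OF k] cell[OF Suc.prems]] by (simp only:)
    then show ?case by (simp add: algebra_simps)
  qed simp
  define k where "k = nat \<lfloor>x / \<epsilon>\<rfloor>"
  have "real k \<le> x / \<epsilon>" "x / \<epsilon> < real k + 1"
    using x \<open>0 < \<epsilon>\<close> by (auto simp: k_def)
  then have k: "real k * \<epsilon> \<le> x" "x - real k * \<epsilon> \<le> \<epsilon>"
    using \<open>0 < \<epsilon>\<close> by (auto simp: field_simps)
  have split: "integral {0..x} g = integral {0..real k * \<epsilon>} g + integral {real k * \<epsilon>..x} g"
    by (rule Henstock_Kurzweil_Integration.integral_combine[symmetric])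
      (use \<open>0 < \<epsilon>\<close> x k in \<open>auto intro!: gint\<close>)
  have "norm (integral {0..real k * \<epsilon>} g) \<le> 2 * \<eta> * (real k * \<epsilon>)"
    using cells k x by auto
  moreover have "2 * \<eta> * (real k * \<epsilon>) \<le> 2 * \<eta>"
    using k x \<open>0 \<le> \<eta>\<close> by (auto intro!: mult_left_le)
  moreover have "norm (integral {real k * \<epsilon>..x} g) \<le> 2 * B * (x - real k * \<epsilon>)"
  proof (rule integral_bound)
    have sub: "{real k * \<epsilon>..x} \<subseteq> {0..1}" using x \<open>0 < \<epsilon>\<close> by (auto intro: order_trans[rotated])
    show "continuous_on {real k * \<epsilon>..x} g" by (rule continuous_on_subset[OF gcont sub])
    show "norm (g s) \<le> 2 * B" if "s \<in> {real k * \<epsilon>..x}" for s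
    proof -
      have "s \<in> {0..1}" using that sub by auto
      then show ?thesis
        unfolding g_def using norm_triangle_le_diff[OF add_mono[OF bound[of s "s / \<epsilon>"] Nb_le[of s]]] by simp
    qed
  qed (use k in simp)
  moreover have "2 * B * (x - real k * \<epsilon>) \<le> 2 * B * \<epsilon>"
    using k \<open>0 \<le> B\<close> by (intro mult_left_mono) auto
  ultimately have "norm (integral {0..x} g) \<le> 2 * \<eta> + 2 * B * \<epsilon>"
 unfolding split
    using norm_triangle_ineq[of "integral {0..real k * \<epsilon>} g" "integral {real k * \<epsilon>..x} g"] by linarith
  then show ?thesis by (simp only: g_def[abs_def] Nb_def)
qed

lemma periodic_frac:
  fixes g :: "real \<Rightarrow> 'a"
  assumes "\<And>y. g (y + 1) = g y"
  shows "g y = g (frac y)"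
  using periodic_shift[of g "frac y" "\<lfloor>y\<rfloor>", OF assms] by (simp add: frac_def)

lemma frac_in_unit: "frac y \<in> {0..1::real}"
  using frac_lt_1[of y] by (auto intro: less_imp_le)

lemma periodic_continuous_bounded:
  fixes N :: "real \<Rightarrow> real \<Rightarrow> 'a::real_normed_vector"
  assumes cont: "continuous_on ({0..1} \<times> UNIV) (\<lambda>(s, y). N s y)"
    and per: "\<And>s y. s \<in> {0..1} \<Longrightarrow> N s (y + 1) = N s y"
  shows "\<exists>B\<ge>0. \<forall>s\<in>{0..1}. \<forall>y. norm (N s y) \<le> B"
proof -
  have "continuous_on ({0..1} \<times> {0..1}) (\<lambda>(s, y). N s y)" by (rule continuous_on_subset[OF cont]) auto
  then have "bounded ((\<lambda>(s, y). N s y) ` ({0..1} \<times> {0..1}))"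
    by (intro compact_imp_bounded compact_continuous_image compact_Times) auto
  then obtain B where B: "B > 0" "\<And>p. p \<in> (\<lambda>(s, y). N s y) ` ({0..1} \<times> {0..1}) \<Longrightarrow> norm p \<le> B"
    unfolding bounded_pos by blast
  have "norm (N s y) \<le> B" if s: "s \<in> {0..1}" for s y
  proof -
    have "N s (frac y) \<in> (\<lambda>(s, y). N s y) ` ({0..1} \<times> {0..1})"
      by (rule image_eqI[of _ _ "(s, frac y)"]) (use s frac_in_unit[of y] in auto)
    then show ?thesis using B(2) periodic_frac[of "N s" y, OF per[OF s]] by simp
  qed
  then show ?thesis using \<open>B > 0\<close> by (intro exI[of _ B]) auto
qed

lemma periodic_continuous_equicontinuous:
  fixes N :: "real \<Rightarrow> real \<Rightarrow> 'a::real_normed_vector"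
  assumes cont: "continuous_on ({0..1} \<times> UNIV) (\<lambda>(s, y). N s y)"
    and per: "\<And>s y. s \<in> {0..1} \<Longrightarrow> N s (y + 1) = N s y"
    and "0 < \<eta>"
  shows "\<exists>d>0. \<forall>s\<in>{0..1}. \<forall>t\<in>{0..1}. \<forall>y. \<bar>s - t\<bar> \<le> d \<longrightarrow> norm (N s y - N t y) \<le> \<eta>"
proof -
  have "uniformly_continuous_on ({0..1} \<times> {0..1}) (\<lambda>(s, y). N s y)"
    by (intro compact_uniformly_continuous compact_Times continuous_on_subset[OF cont]) auto
  from this[unfolded uniformly_continuous_on_def, rule_format, OF \<open>0 < \<eta>\<close>]
  obtain d where d: "d > 0" "\<And>p q. p \<in> {0..1} \<times> {0..1} \<Longrightarrow> q \<in> {0..1} \<times> {0..1} \<Longrightarrow> dist q p < d \<Longrightarrow>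
      dist (case q of (s, y) \<Rightarrow> N s y) (case p of (s, y) \<Rightarrow> N s y) < \<eta>"
    by blast
  show ?thesis
  proof (intro exI[of _ "d / 2"] conjI ballI allI impI)
    fix s t y assume st: "s \<in> {0..1::real}" "t \<in> {0..1}" "\<bar>s - t\<bar> \<le> d / 2"
    have "dist (N s (frac y)) (N t (frac y)) < \<eta>"
      using d(2)[of "(t, frac y)" "(s, frac y)"] st frac_in_unit[of y] \<open>d > 0\<close>
      by (simp add: dist_Pair_Pair dist_real_def)
    then show "norm (N s y - N t y) \<le> \<eta>"
      using periodic_frac[of "N s" y, OF per] periodic_frac[of "N t" y, OF per] st by (simp add: dist_norm)
  qed (use d in simp)
qed

lemma averaging_limit:
  fixes N :: "real \<Rightarrow> real \<Rightarrow> 'a::banach"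
  assumes cont: "continuous_on ({0..1} \<times> UNIV) (\<lambda>(s, y). N s y)"
    and per: "\<And>s y. s \<in> {0..1} \<Longrightarrow> N s (y + 1) = N s y"
    and "0 < \<eta>"
  shows "\<exists>\<epsilon>\<^sub>0>0. \<forall>\<epsilon>\<in>{0<..\<epsilon>\<^sub>0}. \<forall>x\<in>{0..1}.
    norm (integral {0..x} (\<lambda>s. N s (s / \<epsilon>) - integral {0..1} (N s))) \<le> \<eta>"
proof -
  obtain B where B: "0 \<le> B" "\<And>s y. s \<in> {0..1} \<Longrightarrow> norm (N s y) \<le> B"
    using periodic_continuous_bounded[of N, OF cont per] by auto
  have "\<exists>d>0. \<forall>s\<in>{0..1}. \<forall>t\<in>{0..1}. \<forall>y. \<bar>s - t\<bar> \<le> d \<longrightarrow> norm (N s y - N t y) \<le> \<eta> / 4"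
    by (rule periodic_continuous_equicontinuous[OF cont per]) (use \<open>0 < \<eta>\<close> in auto)
  then obtain d where d: "d > 0" "\<And>s t y. s \<in> {0..1} \<Longrightarrow> t \<in> {0..1} \<Longrightarrow> \<bar>s - t\<bar> \<le> d \<Longrightarrow> norm (N s y - N t y) \<le> \<eta> / 4"
    by blast
  show ?thesis
  proof (intro exI[of _ "min d (\<eta> / (4 * (B + 1)))"] conjI ballI)
    fix \<epsilon> x assume e: "\<epsilon> \<in> {0<..min d (\<eta> / (4 * (B + 1)))}" and x: "x \<in> {0..1::real}"
    have "norm (integral {0..x} (\<lambda>s. N s (s / \<epsilon>) - integral {0..1} (N s))) \<le> 2 * (\<eta> / 4) + 2 * B * \<epsilon>"
      by (rule averaging_estimate[OF cont per B(2)]) (use d e x in auto)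
    moreover have "2 * B * \<epsilon> \<le> \<eta> / 2"
    proof -
      have "B * \<epsilon> \<le> (B + 1) * \<epsilon>" using e by (simp add: mult_right_mono)
      also have "\<dots> \<le> \<eta> / 4" using e B(1) by (simp add: field_simps)
      finally show ?thesis by simp
    qed
    ultimately show "norm (integral {0..x} (\<lambda>s. N s (s / \<epsilon>) - integral {0..1} (N s))) \<le> \<eta>" by simp
  qed (use d \<open>0 < \<eta>\<close> B in auto)
qed

section \<open>Perturbations of a linear boundary value problem\<close>

text \<open>
  The difference \<open>q = d - X e\<close> satisfies \<open>q = \<rho> + \<integral> N q + \<integral> (N - Nb) X e + \<integral> S\<close>. The oscillation of \<open>N\<close> thus acts on
  the fixed function \<open>X\<close> only, where averaging makes it small, and the Gronwall inequality bounds \<open>q\<close> without any smallness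
  of \<open>N - Nb\<close> itself. The term with \<open>S\<close> involves \<open>d = q + X e\<close> and is absorbed by the condition on \<open>\<kappa>\<close>.
\<close>

lemma integral_linear_estimate:
  fixes Nb N :: "real \<Rightarrow> 'e::banach \<Rightarrow>\<^sub>L 'e" and X :: "real \<Rightarrow> 'b::real_normed_vector \<Rightarrow>\<^sub>L 'e"
  assumes "0 \<le> L" "0 \<le> K" "0 \<le> \<kappa>" "0 \<le> \<omega>" "4 * exp (2 * L) * \<kappa> \<le> 1"
    and Nb_cont: "continuous_on {0..1} Nb" and X_cont: "continuous_on {0..1} X"
    and X: "\<And>x. x \<in> {0..1} \<Longrightarrow> X x = J + integral {0..x} (\<lambda>s. Nb s o\<^sub>L X s)"
    and X_le: "\<And>x. x \<in> {0..1} \<Longrightarrow> norm (X x) \<le> K"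
    and N_cont: "continuous_on {0..1} N" and N_le: "\<And>x. x \<in> {0..1} \<Longrightarrow> norm (N x) \<le> L"
    and N_avg: "\<And>x. x \<in> {0..1} \<Longrightarrow> norm (integral {0..x} (\<lambda>s. (N s - Nb s) o\<^sub>L X s)) \<le> \<kappa>"
    and d_cont: "continuous_on {0..1} d" and S_cont: "continuous_on {0..1} S"
    and S_le: "\<And>x. x \<in> {0..1} \<Longrightarrow> norm (S x) \<le> \<kappa> * norm (d x)"
    and \<rho>_le: "\<And>x. x \<in> {0..1} \<Longrightarrow> norm (\<rho> x) \<le> \<omega>"
    and d: "\<And>x. x \<in> {0..1} \<Longrightarrow> d x = J e + \<rho> x + integral {0..x} (\<lambda>s. N s (d s) + S s)"
    and x: "x \<in> {0..1}"
  shows "norm (d x - X x e) \<le> 4 * exp (2 * L) * (\<omega> + \<kappa> * (1 + K) * norm e)"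
proof -
  define q where "q s = d s - X s e" for s
  have q_cont: "continuous_on {0..1} q"
    unfolding q_def by (intro continuous_intros d_cont X_cont)
  have "continuous_on {0..1} (\<lambda>s. norm (q s))" by (intro continuous_intros q_cont)
  then obtain t where t: "t \<in> {0..1}" and max: "\<And>s. s \<in> {0..1} \<Longrightarrow> norm (q s) \<le> norm (q t)"
    using continuous_attains_sup[of "{0..1::real}" "\<lambda>s. norm (q s)"] by force
  define m where "m = norm (q t)"
  define A where "A = \<omega> + \<kappa> * norm e + \<kappa> * (m + K * norm e)"
  have "0 \<le> A" using assms(1-4) by (simp add: A_def m_def)
  have q_le: "norm (q y) \<le> A + L * integral {0..y} (\<lambda>s. norm (q s))" if y: "y \<in> {0..1}" for y
  proof -
    have sub: "{0..y} \<subseteq> {0..1}" using y by auto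
    note cs = d_cont[THEN continuous_on_subset, OF sub] X_cont[THEN continuous_on_subset, OF sub]
      Nb_cont[THEN continuous_on_subset, OF sub] N_cont[THEN continuous_on_subset, OF sub]
      S_cont[THEN continuous_on_subset, OF sub] q_cont[THEN continuous_on_subset, OF sub]
    have int: "(\<lambda>s. N s (d s) + S s) integrable_on {0..y}" "(\<lambda>s. Nb s o\<^sub>L X s) integrable_on {0..y}"
       "(\<lambda>s. (N s - Nb s) o\<^sub>L X s) integrable_on {0..y}" "(\<lambda>s. Nb s (X s e)) integrable_on {0..y}"
       "(\<lambda>s. N s (q s)) integrable_on {0..y}" "S integrable_on {0..y}" "(\<lambda>s. (N s - Nb s) (X s e)) integrable_on {0..y}"
       "(\<lambda>s. L * norm (q s)) integrable_on {0..y}" "(\<lambda>s. norm (q s)) integrable_on {0..y}"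
      by (intro integrable_continuous_real continuous_intros cs)+
    have Xe: "X y e = J e + integral {0..y} (\<lambda>s. Nb s (X s e))"
      using blinfun_apply_integral[OF int(2), of e] X[OF y] by (simp add: plus_blinfun.rep_eq)
    have Ne: "integral {0..y} (\<lambda>s. (N s - Nb s) (X s e)) = integral {0..y} (\<lambda>s. (N s - Nb s) o\<^sub>L X s) e"
      using blinfun_apply_integral[OF int(3), of e] by simp
    have "q y = \<rho> y + (integral {0..y} (\<lambda>s. N s (d s) + S s) - integral {0..y} (\<lambda>s. Nb s (X s e)))"
      unfolding q_def d[OF y] Xe by simp
    also have "\<dots> = \<rho> y + integral {0..y} (\<lambda>s. (N s (d s) + S s) - Nb s (X s e))"
      by (simp add: integral_diff[OF int(1) int(4)])
    also have "(\<lambda>s. (N s (d s) + S s) - Nb s (X s e)) = (\<lambda>s. N s (q s) + (S s + (N s - Nb s) (X s e)))"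
      by (auto simp: q_def blinfun.diff_right blinfun.diff_left)
    also have "integral {0..y} \<dots> = integral {0..y} (\<lambda>s. N s (q s)) + (integral {0..y} S + integral {0..y} (\<lambda>s. (N s - Nb s) (X s e)))"
      by (simp only: integral_add[OF int(5) integrable_add[OF int(6) int(7)]] integral_add[OF int(6) int(7)])
    finally have "norm (q y) \<le> norm (\<rho> y) + norm (integral {0..y} (\<lambda>s. N s (q s)))
       + norm (integral {0..y} S) + norm (integral {0..y} (\<lambda>s. (N s - Nb s) (X s e)))"
      by (smt (verit) norm_triangle_ineq)
    moreover have "norm (integral {0..y} (\<lambda>s. (N s - Nb s) (X s e))) \<le> \<kappa> * norm e"
      unfolding Ne by (rule order_trans[OF norm_blinfun]) (intro mult_right_mono N_avg y, simp)
    moreover have "norm (integral {0..y} (\<lambda>s. N s (q s))) \<le> integral {0..y} (\<lambda>s. L * norm (q s))"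
    proof (rule integral_norm_bound_integral[OF int(5) int(8)])
      fix s assume "s \<in> {0..y}"
      then show "norm (N s (q s)) \<le> L * norm (q s)"
        using sub by (intro order_trans[OF norm_blinfun] mult_right_mono N_le) auto
    qed
    moreover have "norm (integral {0..y} S) \<le> \<kappa> * (m + K * norm e) * (y - 0)"
    proof (rule integral_bound)
      fix s assume "s \<in> {0..y}"
      then have s: "s \<in> {0..1}" using sub by auto
      have "norm (d s) \<le> norm (q s) + norm (X s e)" using norm_triangle_ineq[of "q s" "X s e"] by (simp add: q_def)
      also have "norm (X s e) \<le> K * norm e"
        using s by (intro order_trans[OF norm_blinfun] mult_right_mono X_le) auto
      finally have "norm (d s) \<le> m + K * norm e" using max[OF s] by (simp add: m_def)
      then show "norm (S s) \<le> \<kappa> * (m + K * norm e)"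
        using S_le[OF s] \<open>0 \<le> \<kappa>\<close> by (meson mult_left_mono order_trans)
    qed (use y cs in auto)
    moreover have "\<kappa> * (m + K * norm e) * (y - 0) \<le> \<kappa> * (m + K * norm e)"
      using y assms(1-4) by (intro mult_left_le) (auto simp: m_def)
    ultimately show ?thesis using \<rho>_le[OF y] by (simp add: A_def)
  qed
  have bound: "norm (q y) \<le> 2 * A * exp (2 * L)" if "y \<in> {0..1}" for y
    by (rule gronwall_bound[of "\<lambda>s. norm (q s)", OF _ \<open>0 \<le> A\<close> \<open>0 \<le> L\<close> q_le that])
      (intro continuous_intros q_cont)
  have "m \<le> 2 * exp (2 * L) * (\<omega> + \<kappa> * (1 + K) * norm e) + (4 * exp (2 * L) * \<kappa>) / 2 * m"
    using bound[OF t] by (simp add: m_def A_def algebra_simps)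
  also have "(4 * exp (2 * L) * \<kappa>) / 2 * m \<le> 1 / 2 * m"
  proof -
    have "0 \<le> m / 2" by (simp add: m_def)
    from mult_right_mono[OF assms(5) this] show ?thesis by (simp add: mult_ac)
  qed
  finally have "m \<le> 4 * exp (2 * L) * (\<omega> + \<kappa> * (1 + K) * norm e)" by simp
  then show ?thesis using max[OF x] by (simp add: m_def q_def)
qed

text \<open>
  Closeness of \<open>N\<close> to its average \<open>Nb\<close> in the weak sense that averaging provides: no smallness of
  \<open>N - Nb\<close> in norm, only of the primitive of its product with \<open>X\<close>.
\<close>

definition near_average ::
  "real \<Rightarrow> real \<Rightarrow> (real \<Rightarrow> 'e::banach \<Rightarrow>\<^sub>L 'e) \<Rightarrow> (real \<Rightarrow> 'b::real_normed_vector \<Rightarrow>\<^sub>L 'e) \<Rightarrow>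
    (real \<Rightarrow> 'e \<Rightarrow>\<^sub>L 'e) \<Rightarrow> bool"
  where "near_average L \<kappa> Nb X N \<longleftrightarrow> continuous_on {0..1} N \<and>
    (\<forall>x\<in>{0..1}. norm (N x) \<le> L \<and> norm (integral {0..x} (\<lambda>s. (N s - Nb s) o\<^sub>L X s)) \<le> \<kappa>)"

definition bvp_solution ::
  "(real \<Rightarrow> 'a::banach \<times> 'b::banach \<Rightarrow> 'a \<times> 'b) \<Rightarrow> (real \<Rightarrow> 'a \<times> 'b) \<Rightarrow> bool"
  where "bvp_solution G z \<longleftrightarrow> continuous_on {0..1} z \<and> fst (z 0) = 0 \<and> snd (z 1) = 0 \<and>
    (\<forall>x\<in>{0..1}. z x = z 0 + integral {0..x} (\<lambda>s. G s (z s)))"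

lemma bvp_solutionD:
  assumes "bvp_solution G z"
  shows "continuous_on {0..1} z" "fst (z 0) = 0" "snd (z 1) = 0"
    and "\<And>x. x \<in> {0..1} \<Longrightarrow> z x = z 0 + integral {0..x} (\<lambda>s. G s (z s))"
  using assms unfolding bvp_solution_def by blast+

text \<open>
  Shooting. The initial value is \<open>(0, e)\<close> with unknown \<open>e\<close>, and the solution is compared with \<open>X e\<close>, where
  \<open>X\<close> is the fundamental matrix of the limit equation with \<open>X(0) e = (0, e)\<close>. The linear map \<open>P e = (X(1) e)\<^sub>2\<close> is
  injective by the nondegeneracy assumption, hence invertible, the dimension being finite. With inverse
  \<open>Q\<close>, the map \<open>c \<mapsto> c - Q (h\<^sub>c(1))\<^sub>2\<close> halves distances for small \<open>\<kappa>\<close>, and its fixed point satisfies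
  the condition at \<open>1\<close>. The second part of the conclusion is the a priori estimate behind uniqueness and
  the error bound; it is stated for an arbitrary inhomogeneity \<open>\<rho>\<close> and an arbitrary \<open>S\<close> dominated by \<open>d\<close>
  so that it applies to a solution as well as to a difference of two solutions.
\<close>

lemma perturbed_bvp:
  fixes Nb :: "real \<Rightarrow> ('a::euclidean_space \<times> 'b::euclidean_space) \<Rightarrow>\<^sub>L ('a \<times> 'b)"
  assumes Nb_cont: "continuous_on {0..1} Nb" and "0 \<le> L"
    and nondegenerate: "\<And>k. bvp_solution (\<lambda>s. blinfun_apply (Nb s)) k \<Longrightarrow> k 0 = 0"
  shows "\<exists>(X :: real \<Rightarrow> 'b \<Rightarrow>\<^sub>L ('a \<times> 'b)) \<kappa> C. continuous_on {0..1} X \<and> 0 < \<kappa> \<and> 0 \<le> C \<and>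
    (\<forall>N R r. near_average L \<kappa> Nb X N \<longrightarrow> continuous_on ({0..1} \<times> UNIV) (\<lambda>(s, h). R s h) \<longrightarrow>
      (\<forall>s\<in>{0..1}. \<forall>h k. norm (R s h - R s k) \<le> \<kappa> * norm (h - k)) \<longrightarrow> continuous_on {0..1} r \<longrightarrow>
      (\<exists>h. bvp_solution (\<lambda>s h. r s + N s h + R s h) h)) \<and>
    (\<forall>N S \<rho> \<omega> d. near_average L \<kappa> Nb X N \<longrightarrow> continuous_on {0..1} d \<longrightarrow> continuous_on {0..1} S \<longrightarrow>
      (\<forall>x\<in>{0..1}. norm (S x) \<le> \<kappa> * norm (d x)) \<longrightarrow> (\<forall>x\<in>{0..1}. norm (\<rho> x) \<le> \<omega>) \<longrightarrow>
      fst (d 0) = 0 \<longrightarrow> snd (d 1) = 0 \<longrightarrow>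
      (\<forall>x\<in>{0..1}. d x = d 0 + \<rho> x + integral {0..x} (\<lambda>s. N s (d s) + S s)) \<longrightarrow>
      (\<forall>x\<in>{0..1}. norm (d x) \<le> C * \<omega>))"
proof -
  have snd_le: "norm (snd z) \<le> norm z" for z :: "'a \<times> 'b"
    using norm_snd_le[of "snd z" "fst z"] by simp
  define J :: "'b \<Rightarrow>\<^sub>L ('a \<times> 'b)" where "J = Blinfun (Pair 0)"
  have "bounded_linear (Pair 0 :: 'b \<Rightarrow> 'a \<times> 'b)"
    by (intro bounded_linear_Pair bounded_linear_zero bounded_linear_ident)
  then have J: "J c = (0, c)" for c by (simp add: J_def bounded_linear_Blinfun_apply)
  have "bounded (Nb ` {0..1})" by (intro compact_imp_bounded compact_continuous_image Nb_cont) auto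
  then obtain B where B: "0 < B" "\<And>s. s \<in> {0..1} \<Longrightarrow> norm (Nb s) \<le> B"
    by (auto simp: bounded_pos)
  have "\<exists>X. continuous_on {0..1} X \<and> (\<forall>x\<in>{0..1}. X x = J + integral {0..x} (\<lambda>s. Nb s o\<^sub>L X s))"
  proof (rule volterra_solution[of "\<lambda>s Z. Nb s o\<^sub>L Z" B J])
    show "continuous_on ({0..1} \<times> UNIV) (\<lambda>(s, Z::'b \<Rightarrow>\<^sub>L ('a \<times> 'b)). Nb s o\<^sub>L Z)"
      unfolding split_beta
      by (intro continuous_intros continuous_on_compose2[OF Nb_cont]) auto
    fix s :: real and Z W :: "'b \<Rightarrow>\<^sub>L ('a \<times> 'b)" assume "s \<in> {0..1}"
    have "(Nb s o\<^sub>L Z) - (Nb s o\<^sub>L W) = Nb s o\<^sub>L (Z - W)"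
      by (rule blinfun_eqI) (simp add: blinfun.diff_left blinfun.diff_right)
    then show "norm ((Nb s o\<^sub>L Z) - (Nb s o\<^sub>L W)) \<le> B * norm (Z - W)"
      by (simp only:) (intro order_trans[OF norm_blinfun_compose] mult_right_mono B(2) \<open>s \<in> {0..1}\<close> norm_ge_zero)
  qed (use B in auto)
  then obtain X where X_cont: "continuous_on {0..1} X"
    and X: "\<And>x. x \<in> {0..1} \<Longrightarrow> X x = J + integral {0..x} (\<lambda>s. Nb s o\<^sub>L X s)"
    by blast
  have "bounded (X ` {0..1})" by (intro compact_imp_bounded compact_continuous_image X_cont) auto
  then obtain K where K: "0 < K" "\<And>s. s \<in> {0..1} \<Longrightarrow> norm (X s) \<le> K"
    by (auto simp: bounded_pos)
  define P where "P c = snd (X 1 c)" for c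
  have linP: "linear P"
    by (rule linearI) (simp_all add: P_def blinfun.add_right blinfun.scaleR_right)
  have "c = 0" if "P c = 0" for c
  proof -
    have X0: "X 0 = J" using X[of 0] by simp
    have "(0, c) = X 0 c" by (simp add: X0 J)
    also have "X 0 c = 0"
    proof (rule nondegenerate[of "\<lambda>x. X x c"], unfold bvp_solution_def, intro conjI ballI)
      show "continuous_on {0..1} (\<lambda>x. X x c)" by (intro continuous_intros X_cont)
      fix x :: real assume x: "x \<in> {0..1}"
      have "(\<lambda>s. Nb s o\<^sub>L X s) integrable_on {0..x}"
        by (intro integrable_continuous_real continuous_intros continuous_on_subset[OF Nb_cont]
            continuous_on_subset[OF X_cont]) (use x in auto)
      from blinfun_apply_integral[OF this, of c] X[OF x]
      show "X x c = X 0 c + integral {0..x} (\<lambda>s. Nb s (X s c))"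
        by (simp add: X0 plus_blinfun.rep_eq)
    qed (use that in \<open>simp_all add: X0 J P_def\<close>)
    finally show "c = 0" by (simp add: zero_prod_def)
  qed
  then have "inj P" using linP by (simp add: linear_injective_0)
  then obtain Q where Q: "linear Q" "\<And>c. Q (P c) = c" "\<And>c. P (Q c) = c"
    using linear_injective_isomorphism[OF linP] by auto
  obtain D where D: "0 < D" "\<And>c. norm (Q c) \<le> D * norm c"
    using linear_bounded_pos[OF Q(1)] by auto
  define G where "G = 4 * exp (2 * L)"
  have "G > 0" by (simp add: G_def)
  (* This choice makes the smallness condition of integral_linear_estimate hold and keeps the deviation
     of a solution from X e below half of what the inverse Q, bounded by D, can tolerate. *)
  define \<kappa> where "\<kappa> = 1 / (G * (1 + K) * (1 + 2 * D))"
  have "\<kappa> > 0" using \<open>G > 0\<close> K D by (simp add: \<kappa>_def)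
  have \<kappa>1: "G * \<kappa> * (1 + K) = 1 / (1 + 2 * D)"
    using \<open>G > 0\<close> K D by (simp add: \<kappa>_def)
  have "G * \<kappa> \<le> G * \<kappa> * (1 + K)" using \<open>G > 0\<close> \<open>\<kappa> > 0\<close> K by (simp add: algebra_simps)
  also have "\<dots> \<le> 1" unfolding \<kappa>1 using D by simp
  finally have \<kappa>2: "4 * exp (2 * L) * \<kappa> \<le> 1" by (simp add: G_def)
  have \<kappa>3: "G * \<kappa> * (1 + K) \<le> 1 / (2 * D)" unfolding \<kappa>1 using D by (simp add: field_simps)
  have est: "norm (d x - X x e) \<le> G * \<omega> + 1 / (2 * D) * norm e"
    if "near_average L \<kappa> Nb X N" "continuous_on {0..1} d" "continuous_on {0..1} S"
      "\<And>x. x \<in> {0..1} \<Longrightarrow> norm (S x) \<le> \<kappa> * norm (d x)" "\<And>x. x \<in> {0..1} \<Longrightarrow> norm (\<rho> x) \<le> \<omega>"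
      "\<And>x. x \<in> {0..1} \<Longrightarrow> d x = J e + \<rho> x + integral {0..x} (\<lambda>s. N s (d s) + S s)" "x \<in> {0..1}"
    for N d S \<rho> \<omega> e x
  proof -
    have "0 \<le> \<omega>" using that(5)[OF that(7)] norm_ge_zero order_trans by blast
    have "norm (d x - X x e) \<le> G * (\<omega> + \<kappa> * (1 + K) * norm e)"
      unfolding G_def
      by (rule integral_linear_estimate[where J = J and L = L and \<kappa> = \<kappa> and N = N and Nb = Nb and S = S and \<rho> = \<rho>])
        (use that \<open>0 \<le> L\<close> K \<open>\<kappa> > 0\<close> \<open>0 \<le> \<omega>\<close> \<kappa>2 Nb_cont X_cont X in \<open>auto simp: near_average_def\<close>)
    also have "\<dots> = G * \<omega> + G * \<kappa> * (1 + K) * norm e" by (simp add: algebra_simps)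
    also have "\<dots> \<le> G * \<omega> + 1 / (2 * D) * norm e" using mult_right_mono[OF \<kappa>3, of "norm e"] by simp
    finally show ?thesis .
  qed
  show ?thesis
  proof (rule exI[of _ X], rule exI[of _ \<kappa>], rule exI[of _ "2 * K * D * G + 2 * G"],
      intro conjI X_cont \<open>\<kappa> > 0\<close> allI impI, goal_cases)
    case 1
    show ?case using K D \<open>G > 0\<close> by simp
  next
    case (3 N S \<rho> \<omega> d)
    note * = 3(1-5)
      and bc = \<open>fst (d 0) = 0\<close> \<open>snd (d 1) = 0\<close>
    have d: "\<And>x. x \<in> {0..1} \<Longrightarrow> d x = d 0 + \<rho> x + integral {0..x} (\<lambda>s. N s (d s) + S s)"
      using 3(8) by blast
    define e where "e = snd (d 0)"
    have J0: "d 0 = J e" by (simp add: J e_def bc prod_eq_iff)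
    have est': "norm (d y - X y e) \<le> G * \<omega> + 1 / (2 * D) * norm e" if y: "y \<in> {0..1}" for y
    proof (rule est[OF *(1-3)])
      show "d x = J e + \<rho> x + integral {0..x} (\<lambda>s. N s (d s) + S s)" if "x \<in> {0..1}" for x
        using d[OF that] by (simp add: J0)
    qed (use *(4,5) y in auto)
    have "P e = - snd (d 1 - X 1 e)" by (simp add: P_def bc)
    then have "norm (P e) \<le> norm (d 1 - X 1 e)" using snd_le[of "d 1 - X 1 e"] by (simp only: norm_minus_cancel)
    also have "\<dots> \<le> G * \<omega> + 1 / (2 * D) * norm e" by (rule est') auto
    finally have "D * norm (P e) \<le> D * (G * \<omega> + 1 / (2 * D) * norm e)"
      using D by (intro mult_left_mono) auto
    then have "norm e \<le> D * (G * \<omega> + 1 / (2 * D) * norm e)" using D(2)[of "P e"] by (simp add: Q)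
    also have "\<dots> = D * G * \<omega> + norm e / 2" using D(1) by (simp add: field_simps)
    finally have e: "norm e \<le> 2 * D * G * \<omega>" by simp
    show ?case
    proof
    fix x :: real assume x: "x \<in> {0..1}"
    have "norm (d x) \<le> norm (d x - X x e) + norm (X x e)"
      using norm_triangle_ineq[of "d x - X x e" "X x e"] by simp
    also have "\<dots> \<le> (G * \<omega> + 1 / (2 * D) * norm e) + K * norm e"
      by (intro add_mono est' x order_trans[OF norm_blinfun] mult_right_mono K) auto
    also have "\<dots> \<le> (G * \<omega> + 1 / (2 * D) * (2 * D * G * \<omega>)) + K * (2 * D * G * \<omega>)"
      using D K \<open>G > 0\<close> by (intro add_mono mult_left_mono e) auto
    also have "\<dots> = (2 * K * D * G + 2 * G) * \<omega>" using D(1) by (simp add: field_simps)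
    finally show "norm (d x) \<le> (2 * K * D * G + 2 * G) * \<omega>" .
    qed
  next
    case (2 N R r)
    note N = 2(1) and R_cont = 2(2) and r_cont = 2(4)
    have R_lip: "\<And>s h k. s \<in> {0..1} \<Longrightarrow> norm (R s h - R s k) \<le> \<kappa> * norm (h - k)"
      using 2(3) by blast
    have N_cont: "continuous_on {0..1} N" and N_le: "\<And>x. x \<in> {0..1} \<Longrightarrow> norm (N x) \<le> L"
      using N by (auto simp: near_average_def)
    have ex: "\<forall>c. \<exists>h. continuous_on {0..1} h \<and> (\<forall>x\<in>{0..1}. h x = J c + integral {0..x} (\<lambda>s. r s + N s (h s) + R s (h s)))"
    proof (rule allI, rule volterra_solution[of "\<lambda>s h. r s + N s h + R s h" "L + \<kappa>"])
      show "continuous_on ({0..1} \<times> UNIV) (\<lambda>(s, h). r s + N s h + R s h)"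
        using R_cont unfolding split_beta
        by (intro continuous_intros continuous_on_compose2[OF N_cont] continuous_on_compose2[OF r_cont]) auto
      fix s :: real and z w assume s: "s \<in> {0..1}"
      have "norm (r s + N s z + R s z - (r s + N s w + R s w)) \<le> norm (N s (z - w)) + norm (R s z - R s w)"
        using norm_triangle_ineq[of "N s (z - w)" "R s z - R s w"] by (simp add: blinfun.diff_right algebra_simps)
      also have "\<dots> \<le> L * norm (z - w) + \<kappa> * norm (z - w)"
        by (intro add_mono order_trans[OF norm_blinfun] mult_right_mono N_le R_lip s) auto
      finally show "norm (r s + N s z + R s z - (r s + N s w + R s w)) \<le> (L + \<kappa>) * norm (z - w)"
        by (simp add: algebra_simps)
    qed (use \<open>0 \<le> L\<close> \<open>\<kappa> > 0\<close> in auto)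
    obtain h where h_cont: "\<And>c. continuous_on {0..1} (h c)"
      and h: "\<And>c x. x \<in> {0..1} \<Longrightarrow> h c x = J c + integral {0..x} (\<lambda>s. r s + N s (h c s) + R s (h c s))"
      using choice[OF ex] by blast
    have Rh: "continuous_on {0..1} (\<lambda>s. R s (h c s))" for c
      by (rule continuous_on_superposition[OF R_cont h_cont]) auto
    have diff: "norm ((h c 1 - h c' 1) - X 1 (c - c')) \<le> 1 / (2 * D) * norm (c - c')" for c c'
    proof -
      have "norm ((h c 1 - h c' 1) - X 1 (c - c')) \<le> G * 0 + 1 / (2 * D) * norm (c - c')"
      proof (rule est[OF N, where S = "\<lambda>s. R s (h c s) - R s (h c' s)" and \<rho> = "\<lambda>_. 0"])
        fix x :: real assume x: "x \<in> {0..1}"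
        have "{0..x} \<subseteq> {0..1}" using x by auto
        note sub = continuous_on_subset[OF _ this]
        have int: "(\<lambda>s. r s + N s (h c s) + R s (h c s)) integrable_on {0..x}" for c
          by (intro integrable_continuous_real continuous_intros sub[OF Rh] sub[OF r_cont] sub[OF N_cont] sub[OF h_cont])
        have "(\<lambda>s. (r s + N s (h c s) + R s (h c s)) - (r s + N s (h c' s) + R s (h c' s)))
            = (\<lambda>s. N s (h c s - h c' s) + (R s (h c s) - R s (h c' s)))"
          by (auto simp: blinfun.diff_right)
        with integral_diff[OF int int, of c c']
        show "h c x - h c' x = J (c - c') + 0 + integral {0..x} (\<lambda>s. N s (h c s - h c' s) + (R s (h c s) - R s (h c' s)))"
          using h[OF x, of c] h[OF x, of c'] by (simp add: blinfun.diff_right)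
      qed (use R_lip in \<open>auto intro!: continuous_intros h_cont Rh\<close>)
      then show ?thesis by simp
    qed
    define T where "T c = c - Q (snd (h c 1))" for c
    have "dist (T c) (T c') \<le> 1 / 2 * dist c c'" for c c'
    proof -
      have "T c - T c' = Q (P (c - c')) - Q (snd (h c 1 - h c' 1))"
        by (simp add: T_def Q(2) linear_diff[OF Q(1)])
      also have "\<dots> = Q (- snd ((h c 1 - h c' 1) - X 1 (c - c')))"
        by (simp add: P_def flip: linear_diff[OF Q(1)])
      finally have "norm (T c - T c') \<le> D * norm (- snd ((h c 1 - h c' 1) - X 1 (c - c')))"
        by (simp only: D(2))
      also have "\<dots> \<le> D * (1 / (2 * D) * norm (c - c'))"
        unfolding norm_minus_cancel
        using D by (intro mult_left_mono order_trans[OF snd_le diff]) auto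
      finally show ?thesis using D(1) by (simp add: dist_norm)
    qed
    then obtain c where "T c = c" using banach_fix_type[of "1 / 2" T] by auto
    then have "Q (snd (h c 1)) = 0" by (simp add: T_def)
    then have "snd (h c 1) = 0" using Q(3)[of "snd (h c 1)"] linear_0[OF linP] by simp
    moreover have "h c 0 = J c" using h[of 0 c] by simp
    ultimately show ?case
      using h_cont h[of _ c] unfolding bvp_solution_def by (intro exI[of _ "h c"]) (auto simp: J)
  qed
qed

section \<open>Boundary value problems with rapidly oscillating right-hand side\<close>

text \<open>
  The mean of \<open>N X\<close> over the fast variable is the mean of \<open>N\<close> times \<open>X\<close>, so averaging applies to the
  single function \<open>N X\<close>.
\<close>

lemma near_average_eventually:
  fixes N :: "real \<Rightarrow> real \<Rightarrow> 'e::banach \<Rightarrow>\<^sub>L 'e"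
  assumes cont: "continuous_on ({0..1} \<times> UNIV) (\<lambda>(s, y). N s y)"
    and per: "\<And>s y. s \<in> {0..1} \<Longrightarrow> N s (y + 1) = N s y"
    and bound: "\<And>s y. s \<in> {0..1} \<Longrightarrow> norm (N s y) \<le> L"
    and X_cont: "continuous_on {0..1} X" and "0 < \<kappa>"
  shows "\<exists>\<epsilon>\<^sub>0>0. \<forall>\<epsilon>\<in>{0<..\<epsilon>\<^sub>0}. near_average L \<kappa> (\<lambda>s. integral {0..1} (N s)) X (\<lambda>s. N s (s / \<epsilon>))"
proof -
  have NX_cont: "continuous_on ({0..1} \<times> UNIV) (\<lambda>(s, y). N s y o\<^sub>L X s)"
    using cont unfolding split_beta
    by (intro continuous_intros continuous_on_compose2[OF X_cont]) auto
  have "\<exists>\<epsilon>\<^sub>0>0. \<forall>\<epsilon>\<in>{0<..\<epsilon>\<^sub>0}. \<forall>x\<in>{0..1}.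
    norm (integral {0..x} (\<lambda>s. (N s (s / \<epsilon>) o\<^sub>L X s) - integral {0..1} (\<lambda>y. N s y o\<^sub>L X s))) \<le> \<kappa>"
    by (rule averaging_limit[OF NX_cont]) (use per \<open>0 < \<kappa>\<close> in auto)
  then obtain \<epsilon>\<^sub>0 where e0: "\<epsilon>\<^sub>0 > 0" and avg: "\<And>\<epsilon> x. \<epsilon> \<in> {0<..\<epsilon>\<^sub>0} \<Longrightarrow> x \<in> {0..1} \<Longrightarrow>
    norm (integral {0..x} (\<lambda>s. (N s (s / \<epsilon>) o\<^sub>L X s) - integral {0..1} (\<lambda>y. N s y o\<^sub>L X s))) \<le> \<kappa>"
    by blast
  have mean: "(N s (s / \<epsilon>) o\<^sub>L X s) - integral {0..1} (\<lambda>y. N s y o\<^sub>L X s)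
      = (N s (s / \<epsilon>) - integral {0..1} (N s)) o\<^sub>L X s" if "s \<in> {0..1}" for s \<epsilon>
  proof -
    have "N s integrable_on {0..1}"
      by (rule integrable_continuous_real, rule continuous_on_subset[OF continuous_on_section[OF cont that]]) simp
    from integral_linear[OF this, of "\<lambda>A. A o\<^sub>L X s"]
    have "integral {0..1} (\<lambda>y. N s y o\<^sub>L X s) = integral {0..1} (N s) o\<^sub>L X s"
      by (simp add: comp_def bounded_linear_intros)
    then show ?thesis by (simp add: blinfun_eqI blinfun.diff_left)
  qed
  have Ne_cont: "continuous_on {0..1} (\<lambda>s. N s (s / \<epsilon>))" if "\<epsilon> > 0" for \<epsilon>
    by (rule continuous_on_superposition[OF cont]) (use that in \<open>auto intro!: continuous_intros\<close>)
  show ?thesis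
  proof (intro exI[of _ \<epsilon>\<^sub>0] conjI e0 ballI)
    fix \<epsilon> assume e: "\<epsilon> \<in> {0<..\<epsilon>\<^sub>0}"
    have "norm (integral {0..x} (\<lambda>s. (N s (s / \<epsilon>) - integral {0..1} (N s)) o\<^sub>L X s)) \<le> \<kappa>" if x: "x \<in> {0..1}" for x
    proof -
      have "integral {0..x} (\<lambda>s. (N s (s / \<epsilon>) - integral {0..1} (N s)) o\<^sub>L X s)
          = integral {0..x} (\<lambda>s. (N s (s / \<epsilon>) o\<^sub>L X s) - integral {0..1} (\<lambda>y. N s y o\<^sub>L X s))"
        by (rule integral_cong) (use x in \<open>auto simp: mean\<close>)
      then show ?thesis using avg[OF e x] by simp
    qed
    then show "near_average L \<kappa> (\<lambda>s. integral {0..1} (N s)) X (\<lambda>s. N s (s / \<epsilon>))"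
      using e bound Ne_cont unfolding near_average_def by auto
  qed
qed

text \<open>
  By periodicity the fast variable ranges over a compact set, so \<open>DF\<close> is uniformly continuous on a
  tube around \<open>z\<^sub>0\<close>. The linearization error therefore has a Lipschitz constant that is small uniformly in the
  fast variable.
\<close>

lemma uniform_linearization:
  fixes F :: "real \<Rightarrow> real \<Rightarrow> 'e::euclidean_space \<Rightarrow> 'e" and DF :: "real \<Rightarrow> real \<Rightarrow> 'e \<Rightarrow> 'e \<Rightarrow>\<^sub>L 'e"
  assumes "open U"
    and per: "\<And>x y z. x \<in> {0..1} \<Longrightarrow> z \<in> U \<Longrightarrow> DF x (y + 1) z = DF x y z"
    and DF_cont: "continuous_on ({0..1} \<times> UNIV \<times> U) (\<lambda>(x, y, z). DF x y z)"
    and deriv: "\<And>x y z. x \<in> {0..1} \<Longrightarrow> z \<in> U \<Longrightarrow> (F x y has_derivative DF x y z) (at z)"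
    and z0_cont: "continuous_on {0..1} z\<^sub>0" and z0_U: "\<And>x. x \<in> {0..1} \<Longrightarrow> z\<^sub>0 x \<in> U" and "0 < \<kappa>"
  shows "\<exists>\<delta>>0. \<forall>s\<in>{0..1}. cball (z\<^sub>0 s) \<delta> \<subseteq> U \<and> (\<forall>y. \<forall>h\<in>cball 0 \<delta>. \<forall>k\<in>cball 0 \<delta>.
    norm ((F s y (z\<^sub>0 s + h) - DF s y (z\<^sub>0 s) h) - (F s y (z\<^sub>0 s + k) - DF s y (z\<^sub>0 s) k)) \<le> \<kappa> * norm (h - k))"
proof -
  have "compact (z\<^sub>0 ` {0..1})" by (intro compact_continuous_image z0_cont) auto
  then obtain r where r: "r > 0" "(\<Union>x\<in>z\<^sub>0 ` {0..1}. cball x r) \<subseteq> U"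
    by (rule compact_subset_open_imp_cball_epsilon_subset[OF _ \<open>open U\<close>]) (use z0_U in auto)
  have inU: "z\<^sub>0 s + h \<in> U" if "s \<in> {0..1}" "h \<in> cball 0 r" for s h
    using r(2) that by (force simp: dist_norm)
  have "continuous_on ({0..1} \<times> {0..1} \<times> cball 0 r) (\<lambda>p. (\<lambda>(x, y, z). DF x y z) (fst p, fst (snd p), z\<^sub>0 (fst p) + snd (snd p)))"
    by (rule continuous_on_compose2[OF DF_cont])
      (use inU in \<open>auto intro!: continuous_intros continuous_on_compose2[OF z0_cont]\<close>)
  then have "uniformly_continuous_on ({0..1} \<times> {0..1} \<times> cball 0 r) (\<lambda>(s, y, h). DF s y (z\<^sub>0 s + h))"
    by (intro compact_uniformly_continuous compact_Times) (auto simp: split_beta)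
  from this[unfolded uniformly_continuous_on_def, rule_format, OF \<open>0 < \<kappa>\<close>]
  obtain d where d: "d > 0" "\<And>p q. p \<in> {0..1} \<times> {0..1} \<times> cball 0 r \<Longrightarrow> q \<in> {0..1} \<times> {0..1} \<times> cball 0 r \<Longrightarrow> dist q p < d \<Longrightarrow>
      dist (case q of (s, y, h) \<Rightarrow> DF s y (z\<^sub>0 s + h)) (case p of (s, y, h) \<Rightarrow> DF s y (z\<^sub>0 s + h)) < \<kappa>"
    by blast
  define \<delta> where "\<delta> = min r (d / 2)"
  have "\<delta> > 0" "\<delta> \<le> r" "\<delta> < d" using r d by (auto simp: \<delta>_def)
  have close: "norm (DF s y (z\<^sub>0 s + h) - DF s y (z\<^sub>0 s)) \<le> \<kappa>" if s: "s \<in> {0..1}" and h: "h \<in> cball 0 \<delta>" for s y h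
  proof -
    have "dist (DF s (frac y) (z\<^sub>0 s + h)) (DF s (frac y) (z\<^sub>0 s + 0)) < \<kappa>"
      using d(2)[of "(s, frac y, 0)" "(s, frac y, h)"] s h \<open>\<delta> \<le> r\<close> \<open>\<delta> < d\<close> r frac_in_unit[of y]
      by (auto simp: dist_Pair_Pair)
    moreover have "DF s y (z\<^sub>0 s + k) = DF s (frac y) (z\<^sub>0 s + k)" if "k \<in> cball 0 r" for k
      by (rule periodic_frac) (rule per[OF s inU[OF s that]])
    from this[of h] this[of 0] have "DF s y (z\<^sub>0 s + h) = DF s (frac y) (z\<^sub>0 s + h)"
      "DF s y (z\<^sub>0 s) = DF s (frac y) (z\<^sub>0 s + 0)"
      using h \<open>\<delta> \<le> r\<close> r(1) by auto
    ultimately show ?thesis unfolding dist_norm by (metis less_imp_le)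
  qed
  show ?thesis
  proof (intro exI[of _ \<delta>] conjI \<open>\<delta> > 0\<close> ballI allI)
    fix s :: real assume s: "s \<in> {0..1}"
    show "cball (z\<^sub>0 s) \<delta> \<subseteq> U"
      by (rule order_trans[OF subset_cball[OF \<open>\<delta> \<le> r\<close>] order_trans[OF _ r(2)]]) (intro UN_upper imageI s)
    fix y :: real and h k :: 'e assume hk: "h \<in> cball 0 \<delta>" "k \<in> cball 0 \<delta>"
    show "norm ((F s y (z\<^sub>0 s + h) - DF s y (z\<^sub>0 s) h) - (F s y (z\<^sub>0 s + k) - DF s y (z\<^sub>0 s) k)) \<le> \<kappa> * norm (h - k)"
    proof (rule differentiable_bound[OF convex_cball[of 0 \<delta>],
        where f = "\<lambda>h. F s y (z\<^sub>0 s + h) - DF s y (z\<^sub>0 s) h" and x = h and y = k and f' = "\<lambda>h. blinfun_apply (DF s y (z\<^sub>0 s + h) - DF s y (z\<^sub>0 s))"])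
      fix h :: 'e assume h: "h \<in> cball 0 \<delta>"
      have "((\<lambda>h. F s y (z\<^sub>0 s + h)) has_derivative DF s y (z\<^sub>0 s + h)) (at h)"
      proof (rule has_derivative_compose[where g = "F s y" and f = "\<lambda>h. z\<^sub>0 s + h" and f' = "\<lambda>h. h", simplified])
        show "((+) (z\<^sub>0 s) has_derivative (\<lambda>h. h)) (at h)" by (auto intro!: derivative_eq_intros)
        show "(F s y has_derivative DF s y (z\<^sub>0 s + h)) (at (z\<^sub>0 s + h))"
          using h \<open>\<delta> \<le> r\<close> by (intro deriv s inU) auto
      qed
      then show "((\<lambda>h. F s y (z\<^sub>0 s + h) - DF s y (z\<^sub>0 s) h) has_derivative blinfun_apply (DF s y (z\<^sub>0 s + h) - DF s y (z\<^sub>0 s))) (at h within cball 0 \<delta>)"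
        by (auto intro!: derivative_eq_intros intro: has_derivative_at_withinI simp: blinfun.diff_left)
      show "onorm (blinfun_apply (DF s y (z\<^sub>0 s + h) - DF s y (z\<^sub>0 s))) \<le> \<kappa>"
        using close[OF s h, of y] by (simp add: norm_blinfun.rep_eq)
    qed (use hk in auto)
  qed
qed

text \<open>
  The equation for the deviation \<open>h\<close> from \<open>z\<^sub>0\<close> is split as \<open>h' = r + N h + \<rho>(h)\<close>, and \<open>\<rho>\<close> is composed with the
  metric projection onto the ball of radius \<open>\<delta>\<close>. The projection is nonexpansive, so the modified remainder has a small Lipschitz
  constant on the whole space and \<open>perturbed_bvp\<close> yields a solution; the a priori estimate puts it inside
  the ball of radius \<open>\<delta> / 2\<close>, where nothing has been modified. Conversely every solution within distance
  \<open>\<delta>\<close> of \<open>z\<^sub>0\<close> solves the modified problem, which gives uniqueness.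
\<close>

theorem periodic_averaging_bvp:
  fixes F :: "real \<Rightarrow> real \<Rightarrow> 'a::euclidean_space \<times> 'b::euclidean_space \<Rightarrow> 'a \<times> 'b"
    and DF :: "real \<Rightarrow> real \<Rightarrow> 'a \<times> 'b \<Rightarrow> ('a \<times> 'b) \<Rightarrow>\<^sub>L ('a \<times> 'b)"
  assumes "open U"
    and F_per: "\<And>x y z. x \<in> {0..1} \<Longrightarrow> z \<in> U \<Longrightarrow> F x (y + 1) z = F x y z"
    and DF_per: "\<And>x y z. x \<in> {0..1} \<Longrightarrow> z \<in> U \<Longrightarrow> DF x (y + 1) z = DF x y z"
    and F_cont: "continuous_on ({0..1} \<times> UNIV \<times> U) (\<lambda>(x, y, z). F x y z)"
    and DF_cont: "continuous_on ({0..1} \<times> UNIV \<times> U) (\<lambda>(x, y, z). DF x y z)"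
    and deriv: "\<And>x y z. x \<in> {0..1} \<Longrightarrow> z \<in> U \<Longrightarrow> (F x y has_derivative DF x y z) (at z)"
    and z0: "bvp_solution (\<lambda>s z. integral {0..1} (\<lambda>y. F s y z)) z\<^sub>0"
    and z0_U: "\<And>x. x \<in> {0..1} \<Longrightarrow> z\<^sub>0 x \<in> U"
    and nondegenerate: "\<And>k. bvp_solution (\<lambda>s. blinfun_apply (integral {0..1} (\<lambda>y. DF s y (z\<^sub>0 s)))) k \<Longrightarrow> k 0 = 0"
  shows "\<exists>\<delta>>0. \<exists>\<epsilon>\<^sub>0>0. \<exists>C\<ge>0. (\<forall>x\<in>{0..1}. cball (z\<^sub>0 x) \<delta> \<subseteq> U) \<and> (\<forall>\<epsilon>\<in>{0<..\<epsilon>\<^sub>0}.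
    (\<exists>z. bvp_solution (\<lambda>s. F s (s / \<epsilon>)) z \<and> (\<forall>x\<in>{0..1}. norm (z x - z\<^sub>0 x) \<le> \<delta> / 2)) \<and>
    (\<forall>z w. bvp_solution (\<lambda>s. F s (s / \<epsilon>)) z \<longrightarrow> bvp_solution (\<lambda>s. F s (s / \<epsilon>)) w \<longrightarrow>
      (\<forall>x\<in>{0..1}. norm (z x - z\<^sub>0 x) \<le> \<delta> \<and> norm (w x - z\<^sub>0 x) \<le> \<delta>) \<longrightarrow> (\<forall>x\<in>{0..1}. z x = w x)) \<and>
    (\<forall>z \<omega>. bvp_solution (\<lambda>s. F s (s / \<epsilon>)) z \<longrightarrow> (\<forall>x\<in>{0..1}. norm (z x - z\<^sub>0 x) \<le> \<delta>) \<longrightarrow>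
      (\<forall>x\<in>{0..1}. norm (integral {0..x} (\<lambda>s. F s (s / \<epsilon>) (z\<^sub>0 s) - integral {0..1} (\<lambda>y. F s y (z\<^sub>0 s)))) \<le> \<omega>) \<longrightarrow>
      (\<forall>x\<in>{0..1}. norm (z x - z\<^sub>0 x) \<le> C * \<omega>)))"
proof -
  have z0_cont: "continuous_on {0..1} z\<^sub>0" and z0_bc: "fst (z\<^sub>0 0) = 0" "snd (z\<^sub>0 1) = 0"
    and z0_eq: "\<And>x. x \<in> {0..1} \<Longrightarrow> z\<^sub>0 x = z\<^sub>0 0 + integral {0..x} (\<lambda>s. integral {0..1} (\<lambda>y. F s y (z\<^sub>0 s)))"
    by (fact bvp_solutionD[OF z0])+
  define N where "N s y = DF s y (z\<^sub>0 s)" for s y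
  define Nb where "Nb s = integral {0..1} (N s)" for s
  have N_cont: "continuous_on ({0..1} \<times> UNIV) (\<lambda>(s, y). N s y)"
  proof -
    have "continuous_on ({0..1} \<times> UNIV) (\<lambda>p. (\<lambda>(x, y, z). DF x y z) (fst p, snd p, z\<^sub>0 (fst p)))"
      by (rule continuous_on_compose2[OF DF_cont])
        (use z0_U in \<open>auto intro!: continuous_intros continuous_on_compose2[OF z0_cont]\<close>)
    then show ?thesis by (simp add: N_def split_beta)
  qed
  have N_per: "N s (y + 1) = N s y" if "s \<in> {0..1}" for s y
    using DF_per[OF that z0_U[OF that]] by (simp add: N_def)
  obtain L where L: "0 \<le> L" "\<And>s y. s \<in> {0..1} \<Longrightarrow> norm (N s y) \<le> L"
    using periodic_continuous_bounded[of N, OF N_cont N_per] by auto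
  have Nb_cont: "continuous_on {0..1} Nb"
    using integral_continuous_on_param[of "{0..1}" 0 1 N] continuous_on_subset[OF N_cont, of "{0..1} \<times> {0..1}"]
    by (auto simp: Nb_def[abs_def])
  define q where "q s y = F s y (z\<^sub>0 s)" for s y
  have q_cont: "continuous_on ({0..1} \<times> UNIV) (\<lambda>(s, y). q s y)"
  proof -
    have "continuous_on ({0..1} \<times> UNIV) (\<lambda>p. (\<lambda>(x, y, z). F x y z) (fst p, snd p, z\<^sub>0 (fst p)))"
      by (rule continuous_on_compose2[OF F_cont])
        (use z0_U in \<open>auto intro!: continuous_intros continuous_on_compose2[OF z0_cont]\<close>)
    then show ?thesis by (simp add: q_def split_beta)
  qed
  have q_per: "q s (y + 1) = q s y" if "s \<in> {0..1}" for s y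
    using F_per[OF that z0_U[OF that]] by (simp add: q_def)
  define qb where "qb s = integral {0..1} (q s)" for s
  have qb_cont: "continuous_on {0..1} qb"
    using integral_continuous_on_param[of "{0..1}" 0 1 q] continuous_on_subset[OF q_cont, of "{0..1} \<times> {0..1}"]
    by (auto simp: qb_def[abs_def])
  have nondeg: "k 0 = 0" if "bvp_solution (\<lambda>s. blinfun_apply (Nb s)) k" for k
    using nondegenerate[of k] that by (simp add: Nb_def N_def[abs_def])
  obtain X :: "real \<Rightarrow> 'b \<Rightarrow>\<^sub>L ('a \<times> 'b)" and \<kappa> C where X_cont: "continuous_on {0..1} X" and "0 < \<kappa>" "0 \<le> C"
    and ex: "(\<forall>N R r. near_average L \<kappa> Nb X N \<longrightarrow> continuous_on ({0..1} \<times> UNIV) (\<lambda>(s, h). R s h) \<longrightarrow>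
      (\<forall>s\<in>{0..1}. \<forall>h k. norm (R s h - R s k) \<le> \<kappa> * norm (h - k)) \<longrightarrow> continuous_on {0..1} r \<longrightarrow>
      (\<exists>h. bvp_solution (\<lambda>s h. r s + N s h + R s h) h))"
    and est: "(\<forall>N S \<rho> \<omega> d. near_average L \<kappa> Nb X N \<longrightarrow> continuous_on {0..1} d \<longrightarrow> continuous_on {0..1} S \<longrightarrow>
      (\<forall>x\<in>{0..1}. norm (S x) \<le> \<kappa> * norm (d x)) \<longrightarrow> (\<forall>x\<in>{0..1}. norm (\<rho> x) \<le> \<omega>) \<longrightarrow>
      fst (d 0) = 0 \<longrightarrow> snd (d 1) = 0 \<longrightarrow>
      (\<forall>x\<in>{0..1}. d x = d 0 + \<rho> x + integral {0..x} (\<lambda>s. N s (d s) + S s)) \<longrightarrow>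
      (\<forall>x\<in>{0..1}. norm (d x) \<le> C * \<omega>))"
    using perturbed_bvp[of Nb L, OF Nb_cont L(1)] nondeg by blast
  have est': "norm (d x) \<le> C * \<omega>"
    if "near_average L \<kappa> Nb X N" "continuous_on {0..1} d" "continuous_on {0..1} S"
      "\<And>x. x \<in> {0..1} \<Longrightarrow> norm (S x) \<le> \<kappa> * norm (d x)" "\<And>x. x \<in> {0..1} \<Longrightarrow> norm (\<rho> x) \<le> \<omega>"
      "fst (d 0) = 0" "snd (d 1) = 0"
      "\<And>x. x \<in> {0..1} \<Longrightarrow> d x = d 0 + \<rho> x + integral {0..x} (\<lambda>s. N s (d s) + S s)"
      "x \<in> {0..1}" for N d S \<rho> \<omega> x
    using est[THEN spec, of N, THEN spec, of S, THEN spec, of \<rho>, THEN spec, of \<omega>, THEN spec, of d] that by blast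
  obtain \<delta> where "\<delta> > 0" and ball_U: "\<And>s. s \<in> {0..1} \<Longrightarrow> cball (z\<^sub>0 s) \<delta> \<subseteq> U"
    and lin: "\<And>s y h k. s \<in> {0..1} \<Longrightarrow> h \<in> cball 0 \<delta> \<Longrightarrow> k \<in> cball 0 \<delta> \<Longrightarrow>
      norm ((F s y (z\<^sub>0 s + h) - DF s y (z\<^sub>0 s) h) - (F s y (z\<^sub>0 s + k) - DF s y (z\<^sub>0 s) k)) \<le> \<kappa> * norm (h - k)"
    using uniform_linearization[OF \<open>open U\<close> DF_per DF_cont deriv z0_cont z0_U \<open>0 < \<kappa>\<close>] by blast
  define pr where "pr = closest_point (cball (0 :: 'a \<times> 'b) \<delta>)"
  have pr_in: "pr h \<in> cball 0 \<delta>" for h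
    unfolding pr_def using \<open>\<delta> > 0\<close> by (intro closest_point_in_set) auto
  have pr_id: "pr h = h" if "norm h \<le> \<delta>" for h
    unfolding pr_def using that by (intro closest_point_self) auto
  have pr_lip: "norm (pr h - pr k) \<le> norm (h - k)" for h k
    unfolding pr_def using closest_point_lipschitz[OF convex_cball closed_cball, of "0 :: 'a \<times> 'b" \<delta> h k] \<open>\<delta> > 0\<close>
    by (simp add: dist_norm)
  have pr_cont: "continuous_on S pr" for S
    unfolding pr_def using \<open>\<delta> > 0\<close> by (intro continuous_on_closest_point) auto
  define \<rho> where "\<rho> s y h = F s y (z\<^sub>0 s + pr h) - q s y - N s y (pr h)" for s y h
  have \<rho>_lip: "norm (\<rho> s y h - \<rho> s y k) \<le> \<kappa> * norm (h - k)" if "s \<in> {0..1}" for s y h k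
  proof -
    have "norm (\<rho> s y h - \<rho> s y k) \<le> \<kappa> * norm (pr h - pr k)"
      using lin[OF that pr_in pr_in, of y h k] by (simp add: \<rho>_def N_def algebra_simps)
    also have "\<dots> \<le> \<kappa> * norm (h - k)" using pr_lip \<open>0 < \<kappa>\<close> by (intro mult_left_mono) auto
    finally show ?thesis .
  qed
  have \<rho>_0: "\<rho> s y 0 = 0" for s y
    using pr_id[of 0] \<open>\<delta> > 0\<close> by (simp add: \<rho>_def q_def)
  have expand: "q s y - qb s + N s y h + \<rho> s y h = F s y (z\<^sub>0 s + h) - qb s" if "norm h \<le> \<delta>" for s y h
    using pr_id[OF that] by (simp add: \<rho>_def)
  obtain \<epsilon>\<^sub>1 where e1: "\<epsilon>\<^sub>1 > 0" "\<And>\<epsilon>. \<epsilon> \<in> {0<..\<epsilon>\<^sub>1} \<Longrightarrow> near_average L \<kappa> Nb X (\<lambda>s. N s (s / \<epsilon>))"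
    using near_average_eventually[OF N_cont N_per L(2) X_cont \<open>0 < \<kappa>\<close>] unfolding Nb_def by blast
  define \<eta> where "\<eta> = \<delta> / (2 * (C + 1))"
  have "\<eta> > 0" using \<open>\<delta> > 0\<close> \<open>0 \<le> C\<close> by (simp add: \<eta>_def)
  have C\<eta>: "C * \<eta> \<le> \<delta> / 2" using \<open>\<delta> > 0\<close> \<open>0 \<le> C\<close> by (simp add: \<eta>_def field_simps)
  obtain \<epsilon>\<^sub>2 where e2: "\<epsilon>\<^sub>2 > 0" "\<And>\<epsilon> x. \<epsilon> \<in> {0<..\<epsilon>\<^sub>2} \<Longrightarrow> x \<in> {0..1} \<Longrightarrow> norm (integral {0..x} (\<lambda>s. q s (s / \<epsilon>) - qb s)) \<le> \<eta>"
    using averaging_limit[OF q_cont q_per \<open>0 < \<eta>\<close>] unfolding qb_def by blast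
  show ?thesis
  proof (rule exI[of _ \<delta>], intro conjI \<open>\<delta> > 0\<close>,
      rule exI[of _ "min \<epsilon>\<^sub>1 \<epsilon>\<^sub>2"], intro conjI, simp add: e1 e2, rule exI[of _ C],
      intro conjI \<open>0 \<le> C\<close> ballI ball_U)
    fix \<epsilon> assume "\<epsilon> \<in> {0<..min \<epsilon>\<^sub>1 \<epsilon>\<^sub>2}"
    then have "0 < \<epsilon>" and near: "near_average L \<kappa> Nb X (\<lambda>s. N s (s / \<epsilon>))"
      and small: "\<And>x. x \<in> {0..1} \<Longrightarrow> norm (integral {0..x} (\<lambda>s. q s (s / \<epsilon>) - qb s)) \<le> \<eta>"
      using e1 e2 by auto
    let ?G = "\<lambda>s. F s (s / \<epsilon>)"
    let ?H = "\<lambda>s h. (q s (s / \<epsilon>) - qb s) + N s (s / \<epsilon>) h + \<rho> s (s / \<epsilon>) h"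
    have Ne_cont: "continuous_on {0..1} (\<lambda>s. N s (s / \<epsilon>))"
      by (rule continuous_on_superposition[OF N_cont]) (use \<open>0 < \<epsilon>\<close> in \<open>auto intro!: continuous_intros\<close>)
    have qe_cont: "continuous_on {0..1} (\<lambda>s. q s (s / \<epsilon>))"
      by (rule continuous_on_superposition[OF q_cont]) (use \<open>0 < \<epsilon>\<close> in \<open>auto intro!: continuous_intros\<close>)
    have \<rho>_cont: "continuous_on ({0..1} \<times> UNIV) (\<lambda>(s, h). \<rho> s (s / \<epsilon>) h)"
    proof -
      have "z\<^sub>0 s + pr h \<in> U" if "s \<in> {0..1}" for s h
        using ball_U[OF that] pr_in[of h] by (force simp: dist_norm)
      then have "continuous_on ({0..1} \<times> UNIV) (\<lambda>p. (\<lambda>(x, y, z). F x y z) (fst p, fst p / \<epsilon>, z\<^sub>0 (fst p) + pr (snd p)))"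
        by (intro continuous_on_compose2[OF F_cont])
          (use \<open>0 < \<epsilon>\<close> in \<open>auto intro!: continuous_intros continuous_on_compose2[OF z0_cont] continuous_on_compose2[OF pr_cont[of UNIV]]\<close>)
      then show ?thesis
        unfolding \<rho>_def split_beta
        by (intro continuous_intros continuous_on_compose2[OF qe_cont] continuous_on_compose2[OF Ne_cont]
            continuous_on_compose2[OF pr_cont[of UNIV]]) auto
    qed
    have \<rho>h_cont: "continuous_on {0..1} (\<lambda>s. \<rho> s (s / \<epsilon>) (h s))" if "continuous_on {0..1} h" for h
      by (rule continuous_on_superposition[OF \<rho>_cont that]) auto
    have int: "(\<lambda>s. g s) integrable_on {0..x}" if "continuous_on {0..1} g" "x \<in> {0..1}" for g :: "real \<Rightarrow> 'a \<times> 'b" and x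
      using that by (intro integrable_continuous_real continuous_on_subset[OF that(1)]) auto
    have dev: "bvp_solution ?H h \<longleftrightarrow> bvp_solution ?G (\<lambda>x. z\<^sub>0 x + h x)"
      if h: "\<And>x. x \<in> {0..1} \<Longrightarrow> norm (h x) \<le> \<delta>" and h_cont: "continuous_on {0..1} h" for h
    proof -
      have G_cont: "continuous_on {0..1} (\<lambda>s. ?G s (z\<^sub>0 s + h s))"
      proof -
        have "z\<^sub>0 s + h s \<in> U" if "s \<in> {0..1}" for s
          using ball_U[OF that] h[OF that] by (force simp: dist_norm)
        then have "continuous_on {0..1} (\<lambda>s. (\<lambda>(x, y, z). F x y z) (s, s / \<epsilon>, z\<^sub>0 s + h s))"
          by (intro continuous_on_compose2[OF F_cont])
            (use \<open>0 < \<epsilon>\<close> in \<open>auto intro!: continuous_intros z0_cont h_cont\<close>)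
        then show ?thesis by simp
      qed
      have "(h x = h 0 + integral {0..x} (\<lambda>s. ?H s (h s))) \<longleftrightarrow>
          (z\<^sub>0 x + h x = z\<^sub>0 0 + h 0 + integral {0..x} (\<lambda>s. ?G s (z\<^sub>0 s + h s)))" if x: "x \<in> {0..1}" for x
      proof -
        have "integral {0..x} (\<lambda>s. ?H s (h s)) = integral {0..x} (\<lambda>s. ?G s (z\<^sub>0 s + h s) - qb s)"
          using x h by (intro integral_cong expand) auto
        also have "\<dots> = integral {0..x} (\<lambda>s. ?G s (z\<^sub>0 s + h s)) - integral {0..x} qb"
          by (intro integral_diff int G_cont qb_cont x)
        finally have "integral {0..x} (\<lambda>s. ?H s (h s)) = integral {0..x} (\<lambda>s. ?G s (z\<^sub>0 s + h s)) - (z\<^sub>0 x - z\<^sub>0 0)"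
          using z0_eq[OF x] by (simp add: qb_def[abs_def] q_def[abs_def])
        then show ?thesis by (simp only:) (auto simp: algebra_simps)
      qed
      moreover have "continuous_on {0..1} (\<lambda>x. z\<^sub>0 x + h x)" by (intro continuous_intros z0_cont h_cont)
      moreover have "fst (z\<^sub>0 0 + h 0) = 0 \<longleftrightarrow> fst (h 0) = 0" "snd (z\<^sub>0 1 + h 1) = 0 \<longleftrightarrow> snd (h 1) = 0"
        using z0_bc by simp_all
      ultimately show ?thesis unfolding bvp_solution_def using h_cont by blast
    qed
    have bound: "norm (h x) \<le> C * \<omega>"
      if h: "bvp_solution ?H h" and \<omega>: "\<And>x. x \<in> {0..1} \<Longrightarrow> norm (integral {0..x} (\<lambda>s. q s (s / \<epsilon>) - qb s)) \<le> \<omega>"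
        and x: "x \<in> {0..1}" for h \<omega> x
    proof (rule est'[OF near _ _ _ \<omega> _ _ _ x, where S = "\<lambda>s. \<rho> s (s / \<epsilon>) (h s)"])
      show h_cont: "continuous_on {0..1} h" and "fst (h 0) = 0" "snd (h 1) = 0"
        by (fact bvp_solutionD[OF h])+
      show "continuous_on {0..1} (\<lambda>s. \<rho> s (s / \<epsilon>) (h s))" by (rule \<rho>h_cont[OF h_cont])
      show "norm (\<rho> x (x / \<epsilon>) (h x)) \<le> \<kappa> * norm (h x)" if "x \<in> {0..1}" for x
        using \<rho>_lip[OF that, of "x / \<epsilon>" "h x" 0] by (simp add: \<rho>_0)
      fix x :: real assume x: "x \<in> {0..1}"
      have "h x = h 0 + integral {0..x} (\<lambda>s. ?H s (h s))" by (rule bvp_solutionD(4)[OF h x])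
      also have "(\<lambda>s. ?H s (h s)) = (\<lambda>s. (q s (s / \<epsilon>) - qb s) + (N s (s / \<epsilon>) (h s) + \<rho> s (s / \<epsilon>) (h s)))"
        by (simp add: add.assoc)
      also have "integral {0..x} \<dots> = integral {0..x} (\<lambda>s. q s (s / \<epsilon>) - qb s) + integral {0..x} (\<lambda>s. N s (s / \<epsilon>) (h s) + \<rho> s (s / \<epsilon>) (h s))"
        by (intro integral_add int continuous_intros qe_cont qb_cont Ne_cont h_cont \<rho>h_cont x)
      finally show "h x = h 0 + integral {0..x} (\<lambda>s. q s (s / \<epsilon>) - qb s) + integral {0..x} (\<lambda>s. N s (s / \<epsilon>) (h s) + \<rho> s (s / \<epsilon>) (h s))"
        by (simp add: add.assoc)
    qed
    have unique: "h x = k x" if h: "bvp_solution ?H h" and k: "bvp_solution ?H k" and x: "x \<in> {0..1}" for h k x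
    proof -
      have h_cont: "continuous_on {0..1} h" and k_cont: "continuous_on {0..1} k"
        by (rule bvp_solutionD(1)[OF h], rule bvp_solutionD(1)[OF k])
      have "norm (h x - k x) \<le> C * 0"
      proof (rule est'[OF near, where S = "\<lambda>s. \<rho> s (s / \<epsilon>) (h s) - \<rho> s (s / \<epsilon>) (k s)" and \<rho> = "\<lambda>_. 0"])
        fix x :: real assume x: "x \<in> {0..1}"
        have "h x - k x = (h 0 - k 0) + (integral {0..x} (\<lambda>s. ?H s (h s)) - integral {0..x} (\<lambda>s. ?H s (k s)))"
          using bvp_solutionD(4)[OF h x] bvp_solutionD(4)[OF k x] by (simp only: algebra_simps)
        also have "integral {0..x} (\<lambda>s. ?H s (h s)) - integral {0..x} (\<lambda>s. ?H s (k s)) = integral {0..x} (\<lambda>s. ?H s (h s) - ?H s (k s))"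
          by (intro integral_diff[symmetric] int continuous_intros qe_cont qb_cont Ne_cont h_cont k_cont \<rho>h_cont x)
        also have "(\<lambda>s. ?H s (h s) - ?H s (k s)) = (\<lambda>s. N s (s / \<epsilon>) (h s - k s) + (\<rho> s (s / \<epsilon>) (h s) - \<rho> s (s / \<epsilon>) (k s)))"
          by (auto simp: blinfun.diff_right)
        finally show "h x - k x = h 0 - k 0 + 0 + integral {0..x} (\<lambda>s. N s (s / \<epsilon>) (h s - k s) + (\<rho> s (s / \<epsilon>) (h s) - \<rho> s (s / \<epsilon>) (k s)))"
          by simp
      qed (use bvp_solutionD(2,3)[OF h] bvp_solutionD(2,3)[OF k] x \<rho>_lip in
          \<open>auto intro!: continuous_intros h_cont k_cont \<rho>h_cont\<close>)
      then show ?thesis by simp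
    qed
    have deviation: "bvp_solution ?H (\<lambda>x. z x - z\<^sub>0 x)"
      if "bvp_solution ?G z" "\<forall>x\<in>{0..1}. norm (z x - z\<^sub>0 x) \<le> \<delta>" for z
      using dev[of "\<lambda>x. z x - z\<^sub>0 x"] that bvp_solutionD(1)[OF that(1)]
      by (simp add: continuous_on_diff z0_cont)
    show "\<exists>z. bvp_solution ?G z \<and> (\<forall>x\<in>{0..1}. norm (z x - z\<^sub>0 x) \<le> \<delta> / 2)"
    proof -
      have "continuous_on {0..1} (\<lambda>s. q s (s / \<epsilon>) - qb s)" by (intro continuous_intros qe_cont qb_cont)
      from ex[rule_format, OF near \<rho>_cont \<rho>_lip this] obtain h where h: "bvp_solution ?H h" by blast
      have le: "norm (h x) \<le> \<delta> / 2" if "x \<in> {0..1}" for x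
        using bound[OF h small that] C\<eta> by simp
      have "bvp_solution ?G (\<lambda>x. z\<^sub>0 x + h x)"
        using dev[of h] h le bvp_solutionD(1)[OF h] \<open>\<delta> > 0\<close> by fastforce
      then show ?thesis using le by (intro exI[of _ "\<lambda>x. z\<^sub>0 x + h x"]) auto
    qed
    show "\<forall>z w. bvp_solution ?G z \<longrightarrow> bvp_solution ?G w \<longrightarrow>
      (\<forall>x\<in>{0..1}. norm (z x - z\<^sub>0 x) \<le> \<delta> \<and> norm (w x - z\<^sub>0 x) \<le> \<delta>) \<longrightarrow> (\<forall>x\<in>{0..1}. z x = w x)"
      using unique[OF deviation deviation] by fastforce
    show "\<forall>z \<omega>. bvp_solution ?G z \<longrightarrow> (\<forall>x\<in>{0..1}. norm (z x - z\<^sub>0 x) \<le> \<delta>) \<longrightarrow>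
      (\<forall>x\<in>{0..1}. norm (integral {0..x} (\<lambda>s. F s (s / \<epsilon>) (z\<^sub>0 s) - integral {0..1} (\<lambda>y. F s y (z\<^sub>0 s)))) \<le> \<omega>) \<longrightarrow>
      (\<forall>x\<in>{0..1}. norm (z x - z\<^sub>0 x) \<le> C * \<omega>)"
      using bound[OF deviation] by (simp add: q_def[abs_def] qb_def)
  qed
qed

section \<open>Strongly monotone maps\<close>

definition strongly_monotone :: "real \<Rightarrow> ('a::real_inner \<Rightarrow> 'a) \<Rightarrow> bool"
  where "strongly_monotone m h \<longleftrightarrow> (\<forall>p q. m * (norm (p - q))\<^sup>2 \<le> (h p - h q) \<bullet> (p - q))"

lemma strongly_monotone_expansive:
  assumes "strongly_monotone m h"
  shows "m * norm (p - q) \<le> norm (h p - h q)"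
proof (cases "p = q")
  case False
  have "m * norm (p - q) * norm (p - q) \<le> norm (h p - h q) * norm (p - q)"
    using assms norm_cauchy_schwarz[of "h p - h q" "p - q"]
    by (force simp: strongly_monotone_def power2_eq_square mult.assoc intro: order_trans)
  then show ?thesis using False by simp
qed simp

lemma strongly_monotone_inj:
  assumes "strongly_monotone m h" "0 < m"
  shows "inj h"
proof (rule injI)
  fix p q assume "h p = h q"
  then have "m * norm (p - q) \<le> 0" using strongly_monotone_expansive[OF assms(1), of p q] by simp
  then show "p = q" using \<open>0 < m\<close> by (simp add: mult_le_0_iff)
qed

text \<open>
  The map \<open>p \<mapsto> p - \<tau> (h p - v)\<close> is a contraction: its squared Lipschitz constant is at most
  \<open>1 - 2 \<tau> m + \<tau>\<^sup>2 M\<^sup>2\<close>, which is smallest, namely \<open>1 - (m / M)\<^sup>2\<close>, for \<open>\<tau> = m / M\<^sup>2\<close>. Its fixed point is a preimage of \<open>v\<close>.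
\<close>

lemma strongly_monotone_bij:
  fixes h :: "'a::{real_inner, complete_space} \<Rightarrow> 'a"
  assumes mono: "strongly_monotone m h" and "0 < m" "m \<le> M"
    and lip: "\<And>p q. norm (h p - h q) \<le> M * norm (p - q)"
  shows "bij h"
proof (rule bijI)
  show "inj h" by (rule strongly_monotone_inj[OF mono \<open>0 < m\<close>])
  show "surj h"
  proof (rule surjI)
    fix v
    define \<tau> where "\<tau> = m / M\<^sup>2"
    have "M > 0" using assms(2,3) by simp
    define T where "T p = p - \<tau> *\<^sub>R (h p - v)" for p
    define c where "c = sqrt (1 - (m / M)\<^sup>2)"
    have mM: "0 < m / M" "m / M \<le> 1" using assms(2,3) by auto
    have sq: "(m / M)\<^sup>2 \<le> 1" "0 < (m / M)\<^sup>2" using mM by (auto simp: power_le_one)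
    have contr: "dist (T p) (T q) \<le> c * dist p q" for p q
    proof -
      have "(norm (T p - T q))\<^sup>2 = (norm ((p - q) - \<tau> *\<^sub>R (h p - h q)))\<^sup>2"
        by (simp add: T_def algebra_simps)
      also have "\<dots> = (norm (p - q))\<^sup>2 - 2 * \<tau> * ((h p - h q) \<bullet> (p - q)) + \<tau>\<^sup>2 * (norm (h p - h q))\<^sup>2"
        unfolding power2_norm_eq_inner
        by (simp add: inner_diff_left inner_diff_right inner_commute power2_eq_square algebra_simps)
      also have "\<dots> \<le> (norm (p - q))\<^sup>2 - 2 * \<tau> * (m * (norm (p - q))\<^sup>2) + \<tau>\<^sup>2 * (M * norm (p - q))\<^sup>2"
        using mono lip[of p q] \<open>0 < m\<close> \<open>M > 0\<close>
        by (intro add_mono diff_mono mult_left_mono power_mono) (auto simp: strongly_monotone_def \<tau>_def)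
      also have "\<dots> = (1 - (m / M)\<^sup>2) * (norm (p - q))\<^sup>2"
        using \<open>M > 0\<close> by (simp add: \<tau>_def field_simps power2_eq_square)
      also have "\<dots> = (c * norm (p - q))\<^sup>2" using sq by (simp add: c_def power_mult_distrib)
      finally show ?thesis
        using sq by (simp add: dist_norm power2_le_iff_abs_le c_def abs_mult)
    qed
    have "0 \<le> c" "c < 1" using sq by (auto simp: c_def)
    with contr obtain p where "T p = p" using banach_fix_type[of c T] by auto
    then have "h p = v" using \<open>0 < m\<close> \<open>M > 0\<close> by (simp add: T_def \<tau>_def)
    then show "h (inv h v) = v" by (rule f_inv_into_f[OF image_eqI[OF sym]]) simp
  qed
qed

lemma strongly_monotone_inv:
  fixes h :: "'a::real_inner \<Rightarrow> 'a"
  assumes mono: "strongly_monotone m h" and "0 < m" "m \<le> M" and bij: "bij h"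
    and lip: "\<And>p q. norm (h p - h q) \<le> M * norm (p - q)"
  shows "strongly_monotone (m / M\<^sup>2) (inv h)" "norm (inv h p - inv h q) \<le> (1 / m) * norm (p - q)"
proof -
  have h: "h (inv h v) = v" for v by (rule surj_f_inv_f[OF bij_is_surj[OF bij]])
  have "M > 0" using assms(2,3) by simp
  show "strongly_monotone (m / M\<^sup>2) (inv h)"
    unfolding strongly_monotone_def
  proof (intro allI)
    fix p q
    have "norm (p - q) \<le> M * norm (inv h p - inv h q)" using lip[of "inv h p" "inv h q"] by (simp add: h)
    then have "(norm (p - q))\<^sup>2 \<le> (M * norm (inv h p - inv h q))\<^sup>2" by (intro power_mono) auto
    then have "m / M\<^sup>2 * (norm (p - q))\<^sup>2 \<le> m / M\<^sup>2 * (M * norm (inv h p - inv h q))\<^sup>2"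
      using \<open>0 < m\<close> by (intro mult_left_mono) auto
    also have "\<dots> = m * (norm (inv h p - inv h q))\<^sup>2" using \<open>M > 0\<close> by (simp add: power_mult_distrib)
    also have "\<dots> \<le> (p - q) \<bullet> (inv h p - inv h q)"
      using mono[unfolded strongly_monotone_def, rule_format, of "inv h p" "inv h q"] by (simp add: h)
    finally show "m / M\<^sup>2 * (norm (p - q))\<^sup>2 \<le> (inv h p - inv h q) \<bullet> (p - q)" by (simp add: inner_commute)
  qed
  show "norm (inv h p - inv h q) \<le> (1 / m) * norm (p - q)"
    using strongly_monotone_expansive[OF mono, of "inv h p" "inv h q"] \<open>0 < m\<close> by (simp add: h field_simps)
qed

lemma strongly_monotone_average:
  fixes B :: "real \<Rightarrow> 'a::euclidean_space \<Rightarrow> 'a"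
  assumes mono: "\<And>y. y \<in> {0..1} \<Longrightarrow> strongly_monotone m (B y)"
    and lip: "\<And>y p q. y \<in> {0..1} \<Longrightarrow> norm (B y p - B y q) \<le> K * norm (p - q)"
    and cont: "\<And>p. continuous_on {0..1} (\<lambda>y. B y p)"
  shows "strongly_monotone m (\<lambda>p. integral {0..1} (\<lambda>y. B y p))"
    and "norm (integral {0..1} (\<lambda>y. B y p) - integral {0..1} (\<lambda>y. B y q)) \<le> K * norm (p - q)"
proof -
  have int: "(\<lambda>y. B y p) integrable_on {0..1}" for p by (rule integrable_continuous_real[OF cont])
  have diff: "integral {0..1} (\<lambda>y. B y p) - integral {0..1} (\<lambda>y. B y q) = integral {0..1} (\<lambda>y. B y p - B y q)" for p q
    by (rule integral_diff[OF int int, symmetric])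
  show "strongly_monotone m (\<lambda>p. integral {0..1} (\<lambda>y. B y p))"
    unfolding strongly_monotone_def
  proof (intro allI)
    fix p q :: 'a
    have "m * (norm (p - q))\<^sup>2 = integral {0..1} (\<lambda>y::real. m * (norm (p - q))\<^sup>2)" by simp
    also have "\<dots> \<le> integral {0..1} (\<lambda>y. (B y p - B y q) \<bullet> (p - q))"
      using mono by (intro integral_le integrable_continuous_real continuous_intros cont)
        (auto simp: strongly_monotone_def)
    also have "\<dots> = integral {0..1} (\<lambda>y. B y p - B y q) \<bullet> (p - q)"
      using integral_linear[OF integrable_diff[OF int[of p] int[of q]] bounded_linear_inner_left[of "p - q"]] by (simp add: comp_def)
    finally show "m * (norm (p - q))\<^sup>2 \<le> (integral {0..1} (\<lambda>y. B y p) - integral {0..1} (\<lambda>y. B y q)) \<bullet> (p - q)"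
      by (simp add: diff)
  qed
  have "norm (integral {0..1} (\<lambda>y. B y p - B y q)) \<le> K * norm (p - q) * (1 - 0)"
    by (rule integral_bound) (auto intro!: continuous_intros cont lip)
  then show "norm (integral {0..1} (\<lambda>y. B y p) - integral {0..1} (\<lambda>y. B y q)) \<le> K * norm (p - q)"
    by (simp add: diff)
qed

text \<open>
  If \<open>q\<close> is the preimage at the parameter \<open>t0\<close>, then the preimage at \<open>t\<close> differs from it by at most
  \<open>norm (v t - A t q) / m\<close>. So continuity in the parameter for fixed arguments suffices.
\<close>

lemma continuous_on_inv_strongly_monotone:
  fixes A :: "'t::topological_space \<Rightarrow> 'a::real_inner \<Rightarrow> 'a"
  assumes "0 < m" and mono: "\<And>t. t \<in> S \<Longrightarrow> strongly_monotone m (A t)" and bij: "\<And>t. t \<in> S \<Longrightarrow> bij (A t)"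
    and cont: "\<And>q. continuous_on S (\<lambda>t. A t q)" and v: "continuous_on S v"
  shows "continuous_on S (\<lambda>t. inv (A t) (v t))"
  unfolding continuous_on_def
proof
  fix t0 assume t0: "t0 \<in> S"
  define q where "q = inv (A t0) (v t0)"
  have q: "A t0 q = v t0" unfolding q_def by (rule surj_f_inv_f[OF bij_is_surj[OF bij[OF t0]]])
  have "((\<lambda>t. norm (v t - A t q) / m) \<longlongrightarrow> norm (v t0 - A t0 q) / m) (at t0 within S)"
    using v cont t0 \<open>0 < m\<close> by (intro tendsto_intros) (auto simp: continuous_on_def)
  then have lim: "((\<lambda>t. norm (v t - A t q) / m) \<longlongrightarrow> 0) (at t0 within S)" by (simp add: q)
  have "norm (inv (A t) (v t) - q) \<le> norm (v t - A t q) / m" if "t \<in> S" for t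
    using strongly_monotone_expansive[OF mono[OF that], of "inv (A t) (v t)" q] \<open>0 < m\<close>
      surj_f_inv_f[OF bij_is_surj[OF bij[OF that]]] by (simp add: field_simps)
  then have "\<forall>\<^sub>F t in at t0 within S. norm (inv (A t) (v t) - q) \<le> norm (v t - A t q) / m"
    by (auto simp: eventually_at_filter)
  from Lim_null_comparison[OF this lim]
  show "((\<lambda>t. inv (A t) (v t)) \<longlongrightarrow> inv (A t0) (v t0)) (at t0 within S)"
    unfolding q_def[symmetric] by (simp add: LIM_zero_iff)
qed

text \<open>
  Difference quotients of \<open>s \<mapsto> h (p + s q) \<bullet> q\<close> at \<open>0\<close> are bounded below by \<open>m (norm q)\<^sup>2\<close>.
\<close>

lemma strongly_monotone_derivative:
  assumes mono: "strongly_monotone m h" and h': "(h has_derivative h') (at p)"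
  shows "strongly_monotone m h'"
proof -
  interpret h': bounded_linear h' by (rule has_derivative_bounded_linear[OF h'])
  have "m * (norm q)\<^sup>2 \<le> h' q \<bullet> q" for q
  proof -
    have "((\<lambda>s. h (p + s *\<^sub>R q)) has_derivative (\<lambda>s. h' (s *\<^sub>R q))) (at 0)"
      by (rule has_derivative_compose[where g = h and f = "\<lambda>s. p + s *\<^sub>R q"])
        (auto intro!: derivative_eq_intros h')
    then have "((\<lambda>s. h (p + s *\<^sub>R q) \<bullet> q) has_derivative (\<lambda>s. h' (s *\<^sub>R q) \<bullet> q)) (at 0)"
      by (rule has_derivative_inner_left)
    then have "((\<lambda>s. h (p + s *\<^sub>R q) \<bullet> q) has_field_derivative h' q \<bullet> q) (at 0)"
      by (simp add: has_field_derivative_def h'.scaleR mult_commute_abs)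
    then have "((\<lambda>s. (h (p + s *\<^sub>R q) \<bullet> q - h p \<bullet> q) / s) \<longlongrightarrow> h' q \<bullet> q) (at 0)"
      by (simp add: DERIV_def)
    moreover have "\<forall>\<^sub>F s in at (0::real). m * (norm q)\<^sup>2 \<le> (h (p + s *\<^sub>R q) \<bullet> q - h p \<bullet> q) / s"
      unfolding eventually_at_filter
    proof (rule always_eventually, intro allI impI)
      fix s :: real assume s: "s \<noteq> 0"
      have "s\<^sup>2 * (m * (norm q)\<^sup>2) \<le> s * (h (p + s *\<^sub>R q) \<bullet> q - h p \<bullet> q)"
        using mono[unfolded strongly_monotone_def, rule_format, of "p + s *\<^sub>R q" p]
        by (simp add: power_mult_distrib inner_diff_left mult_ac)
      also have "\<dots> = s\<^sup>2 * ((h (p + s *\<^sub>R q) \<bullet> q - h p \<bullet> q) / s)" using s by (simp add: power2_eq_square)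
      finally show "m * (norm q)\<^sup>2 \<le> (h (p + s *\<^sub>R q) \<bullet> q - h p \<bullet> q) / s"
        by (rule mult_left_le_imp_le) (use s in simp)
    qed
    ultimately show ?thesis by (rule tendsto_lowerbound) simp
  qed
  then show ?thesis by (simp add: strongly_monotone_def flip: h'.diff)
qed

lemma linear_strongly_monotone_bij:
  fixes h :: "'a::euclidean_space \<Rightarrow> 'a"
  assumes "linear h" "strongly_monotone m h" "0 < m"
  shows "bij h" "linear (inv h)"
proof -
  have inj: "inj h" by (rule strongly_monotone_inj[OF assms(2,3)])
  show bij: "bij h" using linear_injective_imp_surjective[OF assms(1) inj] inj by (simp add: bij_def)
  have h: "h (inv h v) = v" for v by (rule surj_f_inv_f[OF bij_is_surj[OF bij]])
  show "linear (inv h)"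
    by (rule linearI; rule inv_f_eq[OF inj]) (simp_all add: linear_add[OF assms(1)] linear_scale[OF assms(1)] h)
qed

text \<open>
  The map \<open>(w, p) \<mapsto> (w, A (w, p))\<close> has the inverse \<open>(w, v) \<mapsto> (w, inv (A (w, \<cdot>)) v)\<close>, which is continuous by
  strong monotonicity, and its derivative is invertible because the partial derivative in \<open>p\<close> is strongly monotone.
  So the inverse is differentiable; solving \<open>A' (dw, q) = dv\<close> for \<open>q\<close> gives the formula.
\<close>

lemma has_derivative_parametrized_inverse:
  fixes A :: "'a::euclidean_space \<times> 'b::euclidean_space \<Rightarrow> 'b"
  assumes "open W" "w \<in> W" "0 < m"
    and mono: "\<And>w. w \<in> W \<Longrightarrow> strongly_monotone m (\<lambda>p. A (w, p))"
    and bij: "\<And>w. w \<in> W \<Longrightarrow> bij (\<lambda>p. A (w, p))"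
    and cont: "\<And>p. continuous_on W (\<lambda>w. A (w, p))"
    and A': "(A has_derivative A') (at (w, inv (\<lambda>p. A (w, p)) v))"
  shows "((\<lambda>z. inv (\<lambda>p. A (fst z, p)) (snd z)) has_derivative
      (\<lambda>d. inv (\<lambda>q. A' (0, q)) (snd d - A' (fst d, 0)))) (at (w, v))"
    and "strongly_monotone m (\<lambda>q. A' (0, q))" "linear (\<lambda>q. A' (0, q))"
proof -
  define p where "p = inv (\<lambda>p. A (w, p)) v"
  interpret A': bounded_linear A' by (rule has_derivative_bounded_linear[OF A'])
  have "((\<lambda>p. A (w, p)) has_derivative (\<lambda>q. A' (0, q))) (at p)"
    by (rule has_derivative_compose[where g = A and f = "\<lambda>p. (w, p)"])
      (use A' in \<open>auto intro!: derivative_eq_intros simp: p_def\<close>)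
  then show mono': "strongly_monotone m (\<lambda>q. A' (0, q))"
    by (rule strongly_monotone_derivative[OF mono[OF \<open>w \<in> W\<close>]])
  show lin: "linear (\<lambda>q. A' (0, q))"
    by (rule linearI) (simp_all flip: A'.add A'.scaleR)
  note lb = linear_strongly_monotone_bij[OF lin mono' \<open>0 < m\<close>]
  define g where "g z = (fst z, inv (\<lambda>p. A (fst z, p)) (snd z))" for z
  define g' where "g' d = (fst d, inv (\<lambda>q. A' (0, q)) (snd d - A' (fst d, 0)))" for d
  have g_cont: "continuous_on (W \<times> UNIV) (\<lambda>z. inv (\<lambda>p. A (fst z, p)) (snd z))"
    by (rule continuous_on_inv_strongly_monotone[OF \<open>0 < m\<close>])
      (auto intro!: mono bij continuous_intros continuous_on_compose2[OF cont])
  have "(g has_derivative g') (at (w, v))"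
  proof (rule has_derivative_inverse_basic[where f = "\<lambda>z. (fst z, A z)" and T = "W \<times> UNIV" and f' = "\<lambda>d. (fst d, A' d)"])
    show "((\<lambda>z. (fst z, A z)) has_derivative (\<lambda>d. (fst d, A' d))) (at (g (w, v)))"
      using A' by (auto intro!: derivative_eq_intros simp: g_def)
    have "linear (\<lambda>d. snd d - A' (fst d, 0))"
      by (rule linearI) (simp_all add: algebra_simps flip: A'.add A'.scaleR)
    from linear_compose[OF this lb(2)] have "linear (\<lambda>d. inv (\<lambda>q. A' (0, q)) (snd d - A' (fst d, 0)))"
      by (simp add: comp_def)
    then show "bounded_linear g'"
      unfolding g'_def by (intro bounded_linear_Pair bounded_linear_fst linear_conv_bounded_linear[THEN iffD1])
    show "g' \<circ> (\<lambda>d. (fst d, A' d)) = id"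
    proof
      fix d :: "'a \<times> 'b"
      have "A' d - A' (fst d, 0) = A' (0, snd d)" by (simp flip: A'.diff add: prod_eq_iff minus_prod_def)
      then show "(g' \<circ> (\<lambda>d. (fst d, A' d))) d = id d"
        using inv_f_f[OF bij_is_inj[OF lb(1)], of "snd d"] by (simp add: g'_def)
    qed
    show "continuous (at (w, v)) g"
      unfolding g_def using g_cont \<open>open W\<close> \<open>w \<in> W\<close>
      by (intro continuous_intros) (auto simp: continuous_on_eq_continuous_at open_Times)
    show "open (W \<times> (UNIV :: 'b set))" by (intro open_Times \<open>open W\<close> open_UNIV)
    show "(\<lambda>z. (fst z, A z)) (g z) = z" if "z \<in> W \<times> UNIV" for z
      using surj_f_inv_f[OF bij_is_surj[OF bij[of "fst z"]]] that by (auto simp: g_def)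
  qed (use \<open>w \<in> W\<close> in auto)
  from has_derivative_snd[OF this] show "((\<lambda>z. inv (\<lambda>p. A (fst z, p)) (snd z)) has_derivative
      (\<lambda>d. inv (\<lambda>q. A' (0, q)) (snd d - A' (fst d, 0)))) (at (w, v))"
    by (simp add: g_def g'_def)
qed

section \<open>Continuously differentiable maps with a parameter\<close>

text \<open>
  Smoothness in \<open>z\<close> only, with everything jointly continuous in \<open>(t, z)\<close>. Below, \<open>t\<close> is the pair of
  the slow and the fast variable.
\<close>

definition C1_family ::
  "'t::topological_space set \<Rightarrow> 'a::real_normed_vector set \<Rightarrow> ('t \<Rightarrow> 'a \<Rightarrow> 'b::real_normed_vector) \<Rightarrow> bool"
  where "C1_family T U g \<longleftrightarrow> continuous_on (T \<times> U) (\<lambda>(t, z). g t z) \<and>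
    (\<exists>Dg. continuous_on (T \<times> U) (\<lambda>(t, z). Dg t z) \<and>
      (\<forall>t\<in>T. \<forall>z\<in>U. (g t has_derivative blinfun_apply (Dg t z)) (at z)))"

lemma continuous_on_families:
  assumes g: "continuous_on (T \<times> U) (\<lambda>(t, z). g t z)" and "continuous_on S \<tau>" "continuous_on S \<zeta>"
    and "\<And>s. s \<in> S \<Longrightarrow> \<tau> s \<in> T" "\<And>s. s \<in> S \<Longrightarrow> \<zeta> s \<in> U"
  shows "continuous_on S (\<lambda>s. g (\<tau> s) (\<zeta> s))"
proof -
  have "continuous_on S (\<lambda>s. (\<lambda>(t, z). g t z) (\<tau> s, \<zeta> s))"
    by (rule continuous_on_compose2[OF g]) (use assms in \<open>auto intro!: continuous_intros\<close>)
  then show ?thesis by simp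
qed

lemma C1_familyI:
  fixes g :: "'t::t2_space \<Rightarrow> 'a::euclidean_space \<Rightarrow> 'b::real_normed_vector"
  assumes "continuous_on (T \<times> U) (\<lambda>(t, z). g t z)"
    and deriv: "\<And>t z. t \<in> T \<Longrightarrow> z \<in> U \<Longrightarrow> (g t has_derivative g' t z) (at z)"
    and cont: "\<And>d. continuous_on (T \<times> U) (\<lambda>(t, z). g' t z d)"
  shows "C1_family T U g"
proof -
  define Dg where "Dg t z = Blinfun (g' t z)" for t z
  have Dg: "blinfun_apply (Dg t z) = g' t z" if "t \<in> T" "z \<in> U" for t z
    unfolding Dg_def using deriv[OF that] by (intro bounded_linear_Blinfun_apply has_derivative_bounded_linear)
  have "continuous_on (T \<times> U) (\<lambda>p. blinfun_apply (case p of (t, z) \<Rightarrow> Dg t z) d)" for d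
    using cont[of d] by (rule continuous_on_eq) (auto simp: Dg)
  then have "continuous_on (T \<times> U) (\<lambda>(t, z). Dg t z)"
    by (intro continuous_on_blinfun_componentwise)
  then show ?thesis unfolding C1_family_def using assms(1) deriv Dg by auto
qed

lemma C1_family_Pair:
  fixes g :: "'t::t2_space \<Rightarrow> 'a::euclidean_space \<Rightarrow> 'b::real_normed_vector"
    and h :: "'t::t2_space \<Rightarrow> 'a::euclidean_space \<Rightarrow> 'c::real_normed_vector"
  assumes "C1_family T U g" "C1_family T U h"
  shows "C1_family T U (\<lambda>t z. (g t z, h t z))"
proof -
  obtain Dg where g: "continuous_on (T \<times> U) (\<lambda>(t, z). g t z)" "continuous_on (T \<times> U) (\<lambda>(t, z). Dg t z)"
    "\<And>t z. t \<in> T \<Longrightarrow> z \<in> U \<Longrightarrow> (g t has_derivative blinfun_apply (Dg t z)) (at z)"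
    using assms(1) unfolding C1_family_def by blast
  obtain Dh where h: "continuous_on (T \<times> U) (\<lambda>(t, z). h t z)" "continuous_on (T \<times> U) (\<lambda>(t, z). Dh t z)"
    "\<And>t z. t \<in> T \<Longrightarrow> z \<in> U \<Longrightarrow> (h t has_derivative blinfun_apply (Dh t z)) (at z)"
    using assms(2) unfolding C1_family_def by blast
  show ?thesis
  proof (rule C1_familyI[where g' = "\<lambda>t z d. (Dg t z d, Dh t z d)"])
    show "continuous_on (T \<times> U) (\<lambda>(t, z). (g t z, h t z))"
      using g(1) h(1) by (auto simp: split_beta intro!: continuous_intros)
    show "continuous_on (T \<times> U) (\<lambda>(t, z). (Dg t z d, Dh t z d))" for d
      using g(2) h(2) by (auto simp: split_beta intro!: continuous_intros)
  qed (auto intro!: has_derivative_Pair g h)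
qed

lemma C1_family_compose:
  fixes g :: "'t::t2_space \<Rightarrow> 'a::euclidean_space \<Rightarrow> 'b::real_normed_vector"
    and h :: "'t::t2_space \<Rightarrow> 'b \<Rightarrow> 'c::real_normed_vector"
  assumes "C1_family T U g" "C1_family T V h" and V: "\<And>t z. t \<in> T \<Longrightarrow> z \<in> U \<Longrightarrow> g t z \<in> V"
  shows "C1_family T U (\<lambda>t z. h t (g t z))"
proof -
  obtain Dg where g: "continuous_on (T \<times> U) (\<lambda>(t, z). g t z)" "continuous_on (T \<times> U) (\<lambda>(t, z). Dg t z)"
    "\<And>t z. t \<in> T \<Longrightarrow> z \<in> U \<Longrightarrow> (g t has_derivative blinfun_apply (Dg t z)) (at z)"
    using assms(1) unfolding C1_family_def by blast
  obtain Dh where h: "continuous_on (T \<times> V) (\<lambda>(t, z). h t z)" "continuous_on (T \<times> V) (\<lambda>(t, z). Dh t z)"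
    "\<And>t z. t \<in> T \<Longrightarrow> z \<in> V \<Longrightarrow> (h t has_derivative blinfun_apply (Dh t z)) (at z)"
    using assms(2) unfolding C1_family_def by blast
  have fst: "continuous_on (T \<times> U) fst" by (intro continuous_intros)
  have g': "continuous_on (T \<times> U) (\<lambda>p. g (fst p) (snd p))" using g(1) by (simp add: split_beta)
  show ?thesis
  proof (rule C1_familyI[where g' = "\<lambda>t z d. Dh t (g t z) (Dg t z d)"])
    show "continuous_on (T \<times> U) (\<lambda>(t, z). h t (g t z))"
      using continuous_on_families[OF h(1) fst g'] V by (auto simp: split_beta)
    show "continuous_on (T \<times> U) (\<lambda>(t, z). Dh t (g t z) (Dg t z d))" for d
      using continuous_on_families[OF h(2) fst g'] g(2) V
      by (auto simp: split_beta intro!: continuous_intros)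
    show "((\<lambda>z. h t (g t z)) has_derivative (\<lambda>d. Dh t (g t z) (Dg t z d))) (at z)" if "t \<in> T" "z \<in> U" for t z
      by (rule has_derivative_compose[OF g(3)[OF that] h(3)]) (use that V in auto)
  qed
qed

lemma C1_family_mono:
  assumes "C1_family T U g" "S \<subseteq> T" "V \<subseteq> U"
  shows "C1_family S V g"
proof -
  have "S \<times> V \<subseteq> T \<times> U" using assms by auto
  then show ?thesis using assms unfolding C1_family_def
    by (meson continuous_on_subset subsetD)
qed

lemma C1_family_fst: "C1_family T U (\<lambda>t z. fst (z :: 'a::euclidean_space \<times> 'b::euclidean_space))"
  for T :: "'t::t2_space set"
  by (rule C1_familyI[where g' = "\<lambda>t z d. fst d"])
    (auto simp: split_beta intro!: continuous_intros derivative_eq_intros)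

text \<open>
  Inverse function theorem with a parameter. The derivative of the inverse is itself the value of the inverse of a strongly
  monotone (linear) map, so its continuity follows from the same lemma as the continuity of the inverse.
\<close>

lemma C1_family_inverse:
  fixes A :: "'t::t2_space \<Rightarrow> 'a::euclidean_space \<times> 'b::euclidean_space \<Rightarrow> 'b"
  assumes A: "C1_family T (W \<times> UNIV) A" and "open W" "0 < m"
    and mono: "\<And>t w. t \<in> T \<Longrightarrow> w \<in> W \<Longrightarrow> strongly_monotone m (\<lambda>p. A t (w, p))"
    and bij: "\<And>t w. t \<in> T \<Longrightarrow> w \<in> W \<Longrightarrow> bij (\<lambda>p. A t (w, p))"
  shows "C1_family T (W \<times> UNIV) (\<lambda>t z. inv (\<lambda>p. A t (fst z, p)) (snd z))"
proof -
  obtain DA where A_cont: "continuous_on (T \<times> (W \<times> UNIV)) (\<lambda>(t, z). A t z)"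
    and DA_cont: "continuous_on (T \<times> (W \<times> UNIV)) (\<lambda>(t, z). DA t z)"
    and DA: "\<And>t z. t \<in> T \<Longrightarrow> z \<in> W \<times> UNIV \<Longrightarrow> (A t has_derivative blinfun_apply (DA t z)) (at z)"
    using A unfolding C1_family_def by blast
  define B where "B t z = inv (\<lambda>p. A t (fst z, p)) (snd z)" for t z
  let ?S = "T \<times> (W \<times> (UNIV :: 'b set))"
  have B_cont: "continuous_on ?S (\<lambda>s. B (fst s) (snd s))"
    unfolding B_def
    by (rule continuous_on_inv_strongly_monotone[OF \<open>0 < m\<close>])
      (auto intro!: mono bij continuous_intros continuous_on_families[OF A_cont])
  have deriv: "(B t has_derivative (\<lambda>d. inv (\<lambda>q. DA t (fst z, B t z) (0, q)) (snd d - DA t (fst z, B t z) (fst d, 0)))) (at z)"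
      "strongly_monotone m (\<lambda>q. DA t (fst z, B t z) (0, q))" "linear (\<lambda>q. DA t (fst z, B t z) (0, q))"
    if t: "t \<in> T" and z: "z \<in> W \<times> UNIV" for t z
  proof -
    have "continuous_on W (\<lambda>w. A t (w, p))" for p
      by (rule continuous_on_families[OF A_cont]) (use t in \<open>auto intro!: continuous_intros\<close>)
    from has_derivative_parametrized_inverse[OF \<open>open W\<close> _ \<open>0 < m\<close> mono[OF t] bij[OF t] this DA[OF t], of "fst z" "snd z"] z
    show "(B t has_derivative (\<lambda>d. inv (\<lambda>q. DA t (fst z, B t z) (0, q)) (snd d - DA t (fst z, B t z) (fst d, 0)))) (at z)"
      "strongly_monotone m (\<lambda>q. DA t (fst z, B t z) (0, q))" "linear (\<lambda>q. DA t (fst z, B t z) (0, q))"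
      by (auto simp: B_def[abs_def])
  qed
  have DAB: "continuous_on ?S (\<lambda>s. DA (fst s) (fst (snd s), B (fst s) (snd s)))"
    by (rule continuous_on_families[OF DA_cont]) (auto intro!: continuous_intros B_cont)
  have "C1_family T (W \<times> UNIV) B"
  proof (rule C1_familyI[where g' = "\<lambda>t z d. inv (\<lambda>q. DA t (fst z, B t z) (0, q)) (snd d - DA t (fst z, B t z) (fst d, 0))"])
    show "continuous_on ?S (\<lambda>(t, z). B t z)" using B_cont by (simp add: split_beta)
    show "(B t has_derivative (\<lambda>d. inv (\<lambda>q. DA t (fst z, B t z) (0, q)) (snd d - DA t (fst z, B t z) (fst d, 0)))) (at z)"
      if "t \<in> T" "z \<in> W \<times> UNIV" for t z by (rule deriv(1)[OF that])
    show "continuous_on ?S (\<lambda>(t, z). inv (\<lambda>q. DA t (fst z, B t z) (0, q)) (snd d - DA t (fst z, B t z) (fst d, 0)))" for d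
      unfolding split_beta
    proof (rule continuous_on_inv_strongly_monotone[OF \<open>0 < m\<close>])
      fix s assume "s \<in> ?S"
      then have s: "fst s \<in> T" "snd s \<in> W \<times> UNIV" by auto
      show mono': "strongly_monotone m (\<lambda>q. DA (fst s) (fst (snd s), B (fst s) (snd s)) (0, q))" by (rule deriv(2)[OF s])
      show "bij (\<lambda>q. DA (fst s) (fst (snd s), B (fst s) (snd s)) (0, q))"
        by (rule linear_strongly_monotone_bij(1)[OF deriv(3)[OF s] mono' \<open>0 < m\<close>])
    qed (intro continuous_intros DAB)+
  qed
  then show ?thesis by (simp add: B_def[abs_def])
qed

text \<open>
  Continuous partial derivatives give a total derivative in \<open>(u, p)\<close>.
\<close>

lemma smooth_coeff_C1_family:
  fixes g :: "'n::finite coeff"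
  assumes "smooth_coeff g"
  shows "C1_family ({0..1} \<times> UNIV) UNIV (\<lambda>t z. g (fst t) (snd t) (fst z) (snd z))"
proof -
  have diff: "\<And>x y u p. x \<in> {0..1} \<Longrightarrow> (\<lambda>w. g x y w p) differentiable (at u)"
      "\<And>x y u p. x \<in> {0..1} \<Longrightarrow> g x y u differentiable (at p)"
    and cont: "continuous_on coeff_domain (\<lambda>(x, y, u, p). g x y u p)"
     "continuous_on coeff_domain (\<lambda>(x, y, u, p). partial_u (g x y) u p)"
     "continuous_on coeff_domain (\<lambda>(x, y, u, p). partial_p (g x y) u p)"
    using assms unfolding smooth_coeff_def by blast+
  let ?S = "({0..1} \<times> UNIV) \<times> UNIV :: ((real \<times> real) \<times> (real^'n) \<times> (real^'n)) set"
  have reassoc: "continuous_on ?S (\<lambda>(t, z). h (fst t) (snd t) (fst z) (snd z))"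
    if "continuous_on coeff_domain (\<lambda>(x, y, u, p). h x y u p)" for h :: "real \<Rightarrow> real \<Rightarrow> real^'n \<Rightarrow> real^'n \<Rightarrow> 'c::topological_space"
  proof -
    have "continuous_on ?S (\<lambda>s. (\<lambda>(x, y, u, p). h x y u p) (fst (fst s), snd (fst s), fst (snd s), snd (snd s)))"
      by (rule continuous_on_compose2[OF that]) (auto simp: coeff_domain_def intro!: continuous_intros)
    then show ?thesis by (simp add: split_beta)
  qed
  have du: "((\<lambda>w. g x y w p) has_derivative (\<lambda>d. partial_u (g x y) u p *v d)) (at u)" if "x \<in> {0..1}" for x y u p
    using diff(1)[OF that] by (simp add: partial_u_def jacobian_works)
  have dp: "(g x y u has_derivative (\<lambda>d. partial_p (g x y) u p *v d)) (at p)" if "x \<in> {0..1}" for x y u p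
    using diff(2)[OF that] by (simp add: partial_p_def jacobian_works)
  show ?thesis
  proof (rule C1_familyI[where g' = "\<lambda>t z d. partial_u (g (fst t) (snd t)) (fst z) (snd z) *v fst d + partial_p (g (fst t) (snd t)) (fst z) (snd z) *v snd d"])
    show "continuous_on ?S (\<lambda>(t, z). g (fst t) (snd t) (fst z) (snd z))" by (rule reassoc[OF cont(1)])
    have mv: "continuous_on ?S (\<lambda>s. A s *v d)" if "continuous_on ?S A" for A :: "_ \<Rightarrow> real^'n^'n" and d
      unfolding matrix_vector_mult_def by (intro continuous_intros that)
    show "continuous_on ?S (\<lambda>(t, z). partial_u (g (fst t) (snd t)) (fst z) (snd z) *v fst d + partial_p (g (fst t) (snd t)) (fst z) (snd z) *v snd d)" for d
      using reassoc[OF cont(2)] reassoc[OF cont(3)] unfolding split_beta by (intro continuous_intros mv)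
    fix t :: "real \<times> real" and z :: "(real^'n) \<times> (real^'n)"
    assume "t \<in> {0..1} \<times> UNIV"
    then have t: "fst t \<in> {0..1}" by auto
    define P where "P u p = Blinfun (\<lambda>d. partial_p (g (fst t) (snd t)) u p *v d)" for u p
    have P: "blinfun_apply (P u p) = (\<lambda>d. partial_p (g (fst t) (snd t)) u p *v d)" for u p
      unfolding P_def by (rule bounded_linear_Blinfun_apply) (rule matrix_vector_mul_bounded_linear)
    have "continuous_on (UNIV :: ((real^'n) \<times> (real^'n)) set) (\<lambda>z. (\<lambda>(x, y, u, p). partial_p (g x y) u p) (fst t, snd t, z))"
      by (rule continuous_on_compose2[OF cont(3)]) (use t in \<open>auto simp: coeff_domain_def intro!: continuous_intros\<close>)
    then have "continuous_on UNIV (\<lambda>z. partial_p (g (fst t) (snd t)) (fst z) (snd z))" by (simp add: split_beta)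
    then have "continuous_on UNIV (\<lambda>z. P (fst z) (snd z))"
      by (intro continuous_on_blinfun_componentwise) (simp add: P matrix_vector_mult_def continuous_intros)
    then have P_cont: "continuous (at z) (\<lambda>z. P (fst z) (snd z))"
      using continuous_on_eq_continuous_at[OF open_UNIV] by blast
    have "((\<lambda>(u, p). g (fst t) (snd t) u p) has_derivative
       (\<lambda>(tu, tp). partial_u (g (fst t) (snd t)) (fst z) (snd z) *v tu + P (fst z) (snd z) tp)) (at (fst z, snd z) within UNIV \<times> UNIV)"
      by (rule has_derivative_partialsI[where fy = P]) (use P_cont du[OF t] dp[OF t] in \<open>simp_all add: P split_beta'\<close>)
    then show "((\<lambda>z. g (fst t) (snd t) (fst z) (snd z)) has_derivative
      (\<lambda>d. partial_u (g (fst t) (snd t)) (fst z) (snd z) *v fst d + partial_p (g (fst t) (snd t)) (fst z) (snd z) *v snd d)) (at z)"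
      by (simp add: P split_beta')
  qed
qed

section \<open>Weak solutions and first-order systems\<close>

lemma C1_01_has_vector_derivative:
  assumes "C1_01 u" "x \<in> {0..1}"
  shows "(u has_vector_derivative deriv01 u x) (at x within {0..1})"
  using assms unfolding C1_01_def deriv01_def differentiable_on_def
  by (simp add: vector_derivative_works[symmetric])

lemma deriv01_eq:
  assumes "(u has_vector_derivative d) (at x within {0..1})" "x \<in> {0..1}"
  shows "deriv01 u x = d"
  unfolding deriv01_def by (rule vector_derivative_within_closed_interval) (use assms in auto)

lemma C1_01I:
  assumes "\<And>x. x \<in> {0..1} \<Longrightarrow> (u has_vector_derivative g x) (at x within {0..1})" "continuous_on {0..1} g"
  shows "C1_01 u" "\<And>x. x \<in> {0..1} \<Longrightarrow> deriv01 u x = g x"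
proof -
  show eq: "deriv01 u x = g x" if "x \<in> {0..1}" for x using deriv01_eq assms(1) that by blast
  have "continuous_on {0..1} (deriv01 u)" by (rule continuous_on_eq[OF assms(2)]) (simp add: eq)
  moreover have "u differentiable_on {0..1}"
    using assms(1) unfolding differentiable_on_def differentiable_def has_vector_derivative_def by blast
  ultimately show "C1_01 u" by (simp add: C1_01_def)
qed

lemma integral_equation_has_vector_derivative:
  fixes z g :: "real \<Rightarrow> 'a::banach"
  assumes "continuous_on {0..1} g" and z: "\<And>x. x \<in> {0..1} \<Longrightarrow> z x = c + integral {0..x} g" and x: "x \<in> {0..1}"
  shows "(z has_vector_derivative g x) (at x within {0..1})"
proof -
  have "((\<lambda>x. c + integral {0..x} g) has_vector_derivative g x) (at x within {0..1})"
    using has_vector_derivative_add[OF has_vector_derivative_const integral_has_vector_derivative[OF assms(1) x]] by simp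
  then show ?thesis
    by (rule has_vector_derivative_transform[OF x, rotated]) (simp add: z)
qed

lemma integral_of_vector_derivative:
  fixes z g :: "real \<Rightarrow> 'a::banach"
  assumes "\<And>x. x \<in> {0..1} \<Longrightarrow> (z has_vector_derivative g x) (at x within {0..1})" and x: "x \<in> {0..1}"
  shows "z x = z 0 + integral {0..x} g"
proof -
  have "(g has_integral z x - z 0) {0..x}"
    by (rule fundamental_theorem_of_calculus)
      (use x in \<open>auto intro!: has_vector_derivative_within_subset[OF assms(1)]\<close>)
  then show ?thesis by (simp add: integral_unique)
qed

lemma weak_form_if_integrated:
  fixes V W :: "real \<Rightarrow> real^'n"
  assumes W_cont: "continuous_on {0..1} W" and V: "\<And>x. x \<in> {0..1} \<Longrightarrow> V x = V 0 + integral {0..x} W"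
    and "V 1 = 0" and phi: "C1_01 \<phi>" "\<phi> 0 = 0"
  shows "((\<lambda>x. V x \<bullet> deriv01 \<phi> x + W x \<bullet> \<phi> x) has_integral 0) {0..1}"
proof -
  have "((\<lambda>x. V x \<bullet> \<phi> x) has_vector_derivative V x \<bullet> deriv01 \<phi> x + W x \<bullet> \<phi> x) (at x within {0..1})"
    if x: "x \<in> {0..1}" for x
    by (rule bounded_bilinear.has_vector_derivative[OF bounded_bilinear_inner])
      (rule integral_equation_has_vector_derivative[OF W_cont V x] C1_01_has_vector_derivative[OF phi(1) x]; assumption)+
  from fundamental_theorem_of_calculus[OF _ this]
  show ?thesis using \<open>V 1 = 0\<close> phi(2) by simp
qed

text \<open>
  Du Bois-Reymond. Let \<open>Q\<close> be the primitive of \<open>W\<close> that vanishes at \<open>1\<close>. By partial integration \<open>Q\<close> satisfies the weak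
  form as well, so \<open>V - Q\<close> is orthogonal to the derivatives of all test functions; the primitive of \<open>V - Q\<close> that
  vanishes at \<open>0\<close> is one of them. Since test functions are free at \<open>1\<close>, the natural condition \<open>V 1 = 0\<close> comes out.
\<close>

lemma weak_form_iff_integrated:
  fixes V W :: "real \<Rightarrow> real^'n"
  assumes V_cont: "continuous_on {0..1} V" and W_cont: "continuous_on {0..1} W"
  shows "(\<forall>\<phi>. C1_01 \<phi> \<and> \<phi> 0 = 0 \<longrightarrow> ((\<lambda>x. V x \<bullet> deriv01 \<phi> x + W x \<bullet> \<phi> x) has_integral 0) {0..1}) \<longleftrightarrow>
    V 1 = 0 \<and> (\<forall>x\<in>{0..1}. V x = V 0 + integral {0..x} W)" (is "?weak \<longleftrightarrow> ?int")
proof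
  assume ?int
  then have "V 1 = 0" "\<And>x. x \<in> {0..1} \<Longrightarrow> V x = V 0 + integral {0..x} W" by blast+
  then show ?weak using weak_form_if_integrated[OF W_cont, of V] by blast
next
  assume weak: ?weak
  define Q where "Q x = - integral {0..1} W + integral {0..x} W" for x
  have Q: "Q x = Q 0 + integral {0..x} W" for x by (simp add: Q_def)
  have Q_cont: "continuous_on {0..1} Q"
    unfolding Q_def by (intro continuous_intros indefinite_integral_continuous_1 integrable_continuous_real W_cont)
  define d where "d x = V x - Q x" for x
  have d_cont: "continuous_on {0..1} d" unfolding d_def by (intro continuous_intros V_cont Q_cont)
  define \<phi> where "\<phi> x = integral {0..x} d" for x
  have \<phi>: "(\<phi> has_vector_derivative d x) (at x within {0..1})" if "x \<in> {0..1}" for x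
    unfolding \<phi>_def by (rule integral_has_vector_derivative[OF d_cont that])
  have phi: "C1_01 \<phi>" "\<And>x. x \<in> {0..1} \<Longrightarrow> deriv01 \<phi> x = d x"
    using C1_01I[of \<phi> d] \<phi> d_cont by blast+
  have "\<phi> 0 = 0" by (simp add: \<phi>_def)
  have "((\<lambda>x. V x \<bullet> deriv01 \<phi> x + W x \<bullet> \<phi> x) has_integral 0) {0..1}"
    using weak phi(1) \<open>\<phi> 0 = 0\<close> by blast
  moreover have "((\<lambda>x. Q x \<bullet> deriv01 \<phi> x + W x \<bullet> \<phi> x) has_integral 0) {0..1}"
    by (rule weak_form_if_integrated[OF W_cont Q _ phi(1) \<open>\<phi> 0 = 0\<close>]) (simp add: Q_def)
  ultimately have "((\<lambda>x. (V x \<bullet> deriv01 \<phi> x + W x \<bullet> \<phi> x) - (Q x \<bullet> deriv01 \<phi> x + W x \<bullet> \<phi> x)) has_integral 0 - 0) {0..1}"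
    by (rule has_integral_diff)
  moreover have "(V x \<bullet> deriv01 \<phi> x + W x \<bullet> \<phi> x) - (Q x \<bullet> deriv01 \<phi> x + W x \<bullet> \<phi> x) = d x \<bullet> d x" if "x \<in> {0..1}" for x
    using phi(2)[OF that] by (simp add: d_def inner_diff_left)
  ultimately have "((\<lambda>x. d x \<bullet> d x) has_integral 0) {0..1}"
    using has_integral_cong[of "{0..1}"] by (metis (no_types, lifting) diff_0_right)
  then have "d x \<bullet> d x = 0" if "x \<in> {0..1}" for x
    using has_integral_0_cbox_imp_0[of 0 1 "\<lambda>x. d x \<bullet> d x" x] that d_cont
    by (auto intro!: continuous_intros)
  then have "V x = Q x" if "x \<in> {0..1}" for x using that by (simp add: d_def)
  then show ?int using Q by (simp add: Q_def)
qed

lemma weak_solution_iff_integrated: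
  assumes "continuous_on {0..1} (\<lambda>x. A x (u x) (deriv01 u x))" "continuous_on {0..1} (\<lambda>x. F x (u x) (deriv01 u x))"
  shows "weak_solution A F u \<longleftrightarrow> C1_01 u \<and> u 0 = 0 \<and> A 1 (u 1) (deriv01 u 1) = 0 \<and>
    (\<forall>x\<in>{0..1}. A x (u x) (deriv01 u x) = A 0 (u 0) (deriv01 u 0) + integral {0..x} (\<lambda>x. F x (u x) (deriv01 u x)))"
  unfolding weak_solution_def weak_form_iff_integrated[OF assms] by blast

lemma integral_prod:
  fixes f :: "real \<Rightarrow> 'a::banach" and g :: "real \<Rightarrow> 'b::banach"
  assumes "f integrable_on S" "g integrable_on S"
  shows "integral S (\<lambda>x. (f x, g x)) = (integral S f, integral S g)"
proof -
  have "((\<lambda>x. (f x, 0)) has_integral (integral S f, 0)) S" "((\<lambda>x. (0, g x)) has_integral (0, integral S g)) S"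
    using has_integral_linear[OF integrable_integral[OF assms(1)], of "\<lambda>a. (a, 0)"]
      has_integral_linear[OF integrable_integral[OF assms(2)], of "\<lambda>b. (0, b)"]
    by (simp_all add: comp_def bounded_linear_Pair bounded_linear_ident bounded_linear_zero)
  from has_integral_add[OF this] show ?thesis by (simp add: integral_unique)
qed

text \<open>
  Right-hand side of the system for \<open>z = (u, v)\<close>, where \<open>v = A x u u'\<close> is the flux: the equation for the flux is
  solved for \<open>u'\<close>.
\<close>

definition first_order ::
  "(real \<Rightarrow> real^'n \<Rightarrow> real^'n \<Rightarrow> real^'n) \<Rightarrow> (real \<Rightarrow> real^'n \<Rightarrow> real^'n \<Rightarrow> real^'n) \<Rightarrow>
   real \<Rightarrow> (real^'n) \<times> (real^'n) \<Rightarrow> (real^'n) \<times> (real^'n)"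
  where "first_order A F x z =
    (let p = inv (A x (fst z)) (snd z) in (p, F x (fst z) p))"

lemma weak_solution_imp_bvp_solution:
  fixes u :: "real \<Rightarrow> real^'n"
  assumes u: "weak_solution A F u"
    and bij: "\<And>x. x \<in> {0..1} \<Longrightarrow> bij (A x (u x))"
    and V_cont: "continuous_on {0..1} (\<lambda>x. A x (u x) (deriv01 u x))"
    and W_cont: "continuous_on {0..1} (\<lambda>x. F x (u x) (deriv01 u x))"
  shows "bvp_solution (first_order A F) (\<lambda>x. (u x, A x (u x) (deriv01 u x)))"
proof -
  define V where "V x = A x (u x) (deriv01 u x)" for x
  define W where "W x = F x (u x) (deriv01 u x)" for x
  have C1: "C1_01 u" and bc: "u 0 = 0" "V 1 = 0" and V: "\<And>x. x \<in> {0..1} \<Longrightarrow> V x = V 0 + integral {0..x} W"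
    using u unfolding weak_solution_iff_integrated[of A u F, OF V_cont W_cont] V_def W_def by blast+
  have fo: "first_order A F x (u x, V x) = (deriv01 u x, W x)" if "x \<in> {0..1}" for x
    using inv_f_f[OF bij_is_inj[OF bij[OF that]]] by (simp add: first_order_def V_def W_def Let_def)
  have du: "continuous_on {0..1} (deriv01 u)" using C1 by (simp add: C1_01_def)
  have u_eq: "u x = u 0 + integral {0..x} (deriv01 u)" if "x \<in> {0..1}" for x
    by (rule integral_of_vector_derivative[OF C1_01_has_vector_derivative[OF C1] that])
  have "continuous_on {0..1} u"
    using C1 by (simp add: C1_01_def differentiable_imp_continuous_on)
  then have "continuous_on {0..1} (\<lambda>x. (u x, V x))"
    using V_cont by (auto intro!: continuous_intros simp: V_def)
  moreover have "(u x, V x) = (u 0, V 0) + integral {0..x} (\<lambda>s. first_order A F s (u s, V s))" if x: "x \<in> {0..1}" for x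
  proof -
    have "{0..x} \<subseteq> {0..1}" using x by auto
    then have int: "deriv01 u integrable_on {0..x}" "W integrable_on {0..x}"
      using du W_cont by (auto simp: W_def[abs_def] intro!: integrable_continuous_real intro: continuous_on_subset)
    have "integral {0..x} (\<lambda>s. first_order A F s (u s, V s)) = integral {0..x} (\<lambda>s. (deriv01 u s, W s))"
      using x by (intro integral_cong fo) auto
    also have "\<dots> = (integral {0..x} (deriv01 u), integral {0..x} W)" by (rule integral_prod[OF int])
    finally show ?thesis using u_eq[OF x] V[OF x] by simp
  qed
  ultimately show ?thesis unfolding bvp_solution_def V_def[symmetric] using bc by auto
qed

lemma bvp_solution_imp_weak_solution:
  fixes z :: "real \<Rightarrow> (real^'n) \<times> (real^'n)"
  assumes z: "bvp_solution (first_order A F) z"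
    and bij: "\<And>x. x \<in> {0..1} \<Longrightarrow> bij (A x (fst (z x)))"
    and cont: "continuous_on {0..1} (\<lambda>x. first_order A F x (z x))"
  shows "weak_solution A F (\<lambda>x. fst (z x))"
    and "\<And>x. x \<in> {0..1} \<Longrightarrow> A x (fst (z x)) (deriv01 (\<lambda>x. fst (z x)) x) = snd (z x)"
proof -
  let ?u = "\<lambda>x. fst (z x)" and ?V = "\<lambda>x. snd (z x)"
  have deriv: "(z has_vector_derivative first_order A F x (z x)) (at x within {0..1})" if "x \<in> {0..1}" for x
    by (rule integral_equation_has_vector_derivative[OF cont bvp_solutionD(4)[OF z] that])
  have du: "(?u has_vector_derivative fst (first_order A F x (z x))) (at x within {0..1})" if "x \<in> {0..1}" for x
    by (rule bounded_linear.has_vector_derivative[OF bounded_linear_fst deriv[OF that]])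
  have C1: "C1_01 ?u" "\<And>x. x \<in> {0..1} \<Longrightarrow> deriv01 ?u x = fst (first_order A F x (z x))"
    using C1_01I[of ?u "\<lambda>x. fst (first_order A F x (z x))"] du continuous_on_fst[OF cont] by blast+
  have A: "A x (?u x) (deriv01 ?u x) = ?V x" and F: "F x (?u x) (deriv01 ?u x) = snd (first_order A F x (z x))"
    if "x \<in> {0..1}" for x
    using C1(2)[OF that] surj_f_inv_f[OF bij_is_surj[OF bij[OF that]]]
    by (simp_all add: first_order_def Let_def)
  then show "\<And>x. x \<in> {0..1} \<Longrightarrow> A x (?u x) (deriv01 ?u x) = ?V x" by blast
  have "continuous_on {0..1} (\<lambda>x. A x (?u x) (deriv01 ?u x))"
    by (rule continuous_on_eq[OF continuous_on_snd[OF bvp_solutionD(1)[OF z]]]) (simp add: A)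
  moreover have "continuous_on {0..1} (\<lambda>x. F x (?u x) (deriv01 ?u x))"
    by (rule continuous_on_eq[OF continuous_on_snd[OF cont]]) (simp add: F)
  ultimately have iff: "weak_solution A F ?u \<longleftrightarrow> C1_01 ?u \<and> ?u 0 = 0 \<and> A 1 (?u 1) (deriv01 ?u 1) = 0 \<and>
    (\<forall>x\<in>{0..1}. A x (?u x) (deriv01 ?u x) = A 0 (?u 0) (deriv01 ?u 0) + integral {0..x} (\<lambda>x. F x (?u x) (deriv01 ?u x)))"
    by (rule weak_solution_iff_integrated)
  have V: "?V x = ?V 0 + integral {0..x} (\<lambda>x. F x (?u x) (deriv01 ?u x))" if x: "x \<in> {0..1}" for x
  proof -
    have "?V x = ?V 0 + integral {0..x} (\<lambda>x. snd (first_order A F x (z x)))"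
      by (rule integral_of_vector_derivative[OF _ x])
        (rule bounded_linear.has_vector_derivative[OF bounded_linear_snd deriv])
    also have "integral {0..x} (\<lambda>x. snd (first_order A F x (z x))) = integral {0..x} (\<lambda>x. F x (?u x) (deriv01 ?u x))"
      by (rule integral_cong) (use x in \<open>simp add: F\<close>)
    finally show ?thesis .
  qed
  have "\<forall>x\<in>{0..1}. A x (?u x) (deriv01 ?u x) = A 0 (?u 0) (deriv01 ?u 0) + integral {0..x} (\<lambda>x. F x (?u x) (deriv01 ?u x))"
  proof
    fix x :: real assume x: "x \<in> {0..1}"
    have "A 0 (?u 0) (deriv01 ?u 0) = ?V 0" by (rule A) simp
    with V[OF x] A[OF x]
    show "A x (?u x) (deriv01 ?u x) = A 0 (?u 0) (deriv01 ?u 0) + integral {0..x} (\<lambda>x. F x (?u x) (deriv01 ?u x))"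
      by (simp only:)
  qed
  moreover have "A 1 (?u 1) (deriv01 ?u 1) = 0" using A[of 1] bvp_solutionD(3)[OF z] by simp
  ultimately show "weak_solution A F ?u"
    unfolding iff using C1(1) bvp_solutionD(2)[OF z] by blast
qed

text \<open>
  The linearized coefficients use the two partial Jacobians; together they are the total derivative.
\<close>

lemma linearize_eq:
  assumes "((\<lambda>z. H x (fst z) (snd z)) has_derivative H') (at (u\<^sub>0 x, deriv01 u\<^sub>0 x))"
  shows "linearize H u\<^sub>0 x u p = H' (u, p)"
proof -
  have jac: "jacobian h (at y) *v d = h' d" if "(h has_derivative h') (at y)" for h h' :: "real^'n \<Rightarrow> real^'n" and y d
    unfolding jacobian_def frechet_derivative_at[OF that, symmetric]
    using has_derivative_linear[OF that] by (simp add: matrix_works)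
  interpret H': bounded_linear H' by (rule has_derivative_bounded_linear[OF assms])
  have "((\<lambda>w. (\<lambda>z. H x (fst z) (snd z)) (w, deriv01 u\<^sub>0 x)) has_derivative (\<lambda>d. H' (d, 0))) (at (u\<^sub>0 x))"
  proof (rule has_derivative_compose[where f = "\<lambda>w. (w, deriv01 u\<^sub>0 x)" and f' = "\<lambda>d. (d, 0)" and g' = H'])
    show "((\<lambda>w. (w, deriv01 u\<^sub>0 x)) has_derivative (\<lambda>d. (d, 0))) (at (u\<^sub>0 x))" by (auto intro!: derivative_eq_intros)
  qed (rule assms)
  then have "partial_u (H x) (u\<^sub>0 x) (deriv01 u\<^sub>0 x) *v u = H' (u, 0)"
    unfolding partial_u_def by (intro jac) simp
  moreover have "((\<lambda>p. (\<lambda>z. H x (fst z) (snd z)) (u\<^sub>0 x, p)) has_derivative (\<lambda>d. H' (0, d))) (at (deriv01 u\<^sub>0 x))"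
  proof (rule has_derivative_compose[where f = "\<lambda>p. (u\<^sub>0 x, p)" and f' = "\<lambda>d. (0, d)" and g' = H'])
    show "((\<lambda>p. (u\<^sub>0 x, p)) has_derivative (\<lambda>d. (0, d))) (at (deriv01 u\<^sub>0 x))" by (auto intro!: derivative_eq_intros)
  qed (rule assms)
  then have "partial_p (H x) (u\<^sub>0 x) (deriv01 u\<^sub>0 x) *v p = H' (0, p)"
    unfolding partial_p_def by (intro jac) simp
  ultimately have "linearize H u\<^sub>0 x u p = H' (u, 0) + H' (0, p)"
    by (simp add: linearize_def)
  then show ?thesis by (simp flip: H'.add)
qed

section \<open>The averaged system\<close>

locale homogenization_problem =
  fixes a f :: "'n::finite coeff" and m M :: real
  assumes periodic: "periodic_coeff a" "periodic_coeff f"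
    and smooth: "smooth_coeff a" "smooth_coeff f"
    and bounds: "0 < m" "m \<le> M" "monotone_lipschitz_coeff m M a"
begin

text \<open>
  The part of the state space where the coefficients are controlled by the monotonicity assumption, made open so
  that derivatives there are unrestricted.
\<close>

definition states :: "((real^'n) \<times> (real^'n)) set"
  where "states = ball 0 1 \<times> UNIV"

lemma states_iff: "z \<in> states \<longleftrightarrow> norm (fst z) < 1"
  by (cases z) (simp add: states_def)

lemma open_states: "open states" and convex_states: "convex states"
  unfolding states_def by (simp_all add: open_Times convex_Times)

definition system :: "real \<Rightarrow> real \<Rightarrow> (real^'n) \<times> (real^'n) \<Rightarrow> (real^'n) \<times> (real^'n)"
  where "system x y = first_order (\<lambda>x. a x y) (\<lambda>x. f x y) x"

lemma system_eq: "system x y z = (hom_b a x y (fst z) (snd z), f x y (fst z) (hom_b a x y (fst z) (snd z)))"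
  by (simp add: system_def first_order_def hom_b_def Let_def)

lemma M_pos: "0 < M" using bounds by simp

lemma mono_a: "strongly_monotone m (a x y u)" if "x \<in> {0..1}" "norm u \<le> 1"
  using bounds(3) that by (simp add: strongly_monotone_def monotone_lipschitz_coeff_def)

lemma lip_a: "norm (a x y u p - a x y u q) \<le> M * norm (p - q)" if "x \<in> {0..1}" "norm u \<le> 1"
  using bounds(3) that by (simp add: monotone_lipschitz_coeff_def)

lemma bij_a: "bij (a x y u)" if "x \<in> {0..1}" "norm u \<le> 1"
  by (rule strongly_monotone_bij[OF mono_a[OF that] bounds(1,2) lip_a[OF that]])

lemma a_hom_b: "a x y u (hom_b a x y u v) = v" if "x \<in> {0..1}" "norm u \<le> 1"
  unfolding hom_b_def by (rule surj_f_inv_f[OF bij_is_surj[OF bij_a[OF that]]])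

lemma system_periodic: "system x (y + 1) z = system x y z" if "x \<in> {0..1}"
proof -
  have "a x (y + 1) u = a x y u" "f x (y + 1) u = f x y u" for u
    using periodic that by (auto simp: periodic_coeff_def)
  then show ?thesis by (simp add: system_eq hom_b_def)
qed

lemma C1_hom_b:
  "C1_family ({0..1} \<times> UNIV) states (\<lambda>t z. hom_b a (fst t) (snd t) (fst z) (snd z))"
proof -
  have "C1_family ({0..1} \<times> UNIV) (ball 0 1 \<times> UNIV) (\<lambda>t z. a (fst t) (snd t) (fst z) (snd z))"
    by (rule C1_family_mono[OF smooth_coeff_C1_family[OF smooth(1)]]) auto
  from C1_family_inverse[OF this open_ball bounds(1)]
  show ?thesis unfolding states_def hom_b_def by (auto simp: mono_a bij_a)
qed

lemma C1_system: "C1_family ({0..1} \<times> UNIV) states (\<lambda>t. system (fst t) (snd t))"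
proof -
  have "C1_family ({0..1} \<times> UNIV) states (\<lambda>t z. (fst z, hom_b a (fst t) (snd t) (fst z) (snd z)))"
    by (intro C1_family_Pair C1_family_fst C1_hom_b)
  from C1_family_compose[OF this smooth_coeff_C1_family[OF smooth(2)]]
  have "C1_family ({0..1} \<times> UNIV) states (\<lambda>t z. f (fst t) (snd t) (fst z) (hom_b a (fst t) (snd t) (fst z) (snd z)))"
    by simp
  from C1_family_Pair[OF C1_hom_b this] show ?thesis by (simp add: system_eq[abs_def])
qed

lemma system_derivative_exists:
  "\<exists>D. continuous_on (({0..1} \<times> UNIV) \<times> states) (\<lambda>(t, z). D t z) \<and>
    (\<forall>t\<in>{0..1} \<times> UNIV. \<forall>z\<in>states. (system (fst t) (snd t) has_derivative blinfun_apply (D t z)) (at z))"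
  using C1_system unfolding C1_family_def by blast

definition Dsystem where
  "Dsystem = (SOME D. continuous_on (({0..1} \<times> UNIV) \<times> states) (\<lambda>(t, z). D t z) \<and>
    (\<forall>t\<in>{0..1} \<times> UNIV. \<forall>z\<in>states. (system (fst t) (snd t) has_derivative blinfun_apply (D t z)) (at z)))"

lemma Dsystem_cont: "continuous_on (({0..1} \<times> UNIV) \<times> states) (\<lambda>(t, z). Dsystem t z)"
  and Dsystem_deriv: "x \<in> {0..1} \<Longrightarrow> z \<in> states \<Longrightarrow> (system x y has_derivative Dsystem (x, y) z) (at z)"
  using someI_ex[OF system_derivative_exists] unfolding Dsystem_def[symmetric] by auto

lemma system_cont: "continuous_on (({0..1} \<times> UNIV) \<times> states) (\<lambda>(t, z). system (fst t) (snd t) z)"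
  using C1_system unfolding C1_family_def by blast

lemma Dsystem_periodic: "Dsystem (x, y + 1) z = Dsystem (x, y) z" if "x \<in> {0..1}" "z \<in> states"
proof -
  have "system x (y + 1) = system x y" using system_periodic[OF that(1)] by auto
  then have "blinfun_apply (Dsystem (x, y + 1) z) = blinfun_apply (Dsystem (x, y) z)"
    using has_derivative_unique Dsystem_deriv[OF that, of y] Dsystem_deriv[OF that, of "y + 1"] by metis
  then show ?thesis by (simp add: blinfun_apply_inject)
qed

definition averaged :: "real \<Rightarrow> (real^'n) \<times> (real^'n) \<Rightarrow> (real^'n) \<times> (real^'n)"
  where "averaged x z = integral {0..1} (\<lambda>y. system x y z)"

lemma system_cont_y: "continuous_on S (\<lambda>y. system x y z)" if "x \<in> {0..1}" "z \<in> states"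
proof -
  have "continuous_on S (\<lambda>y. system (fst (x, y)) (snd (x, y)) z)"
    by (rule continuous_on_families[OF system_cont])
      (use that in \<open>auto intro: continuous_on_Pair continuous_on_const continuous_on_id\<close>)
  then show ?thesis by simp
qed

lemma hom_b_cont_y: "continuous_on S (\<lambda>y. hom_b a x y u v)" if "x \<in> {0..1}" "norm u < 1"
  using continuous_on_fst[OF system_cont_y[of x "(u, v)" S]] that by (simp add: states_iff system_eq)

lemma averaged_eq:
  assumes "x \<in> {0..1}" "norm u < 1"
  shows "averaged x (u, v) = (hom_b0 a x u v, integral {0..1} (\<lambda>y. f x y u (hom_b a x y u v)))"
proof -
  have c: "continuous_on {0..1} (\<lambda>y. system x y (u, v))"
    by (rule system_cont_y) (use assms in \<open>simp_all add: states_iff\<close>)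
  from continuous_on_fst[OF c] continuous_on_snd[OF c] show ?thesis
    unfolding averaged_def hom_b0_def system_eq
    by (simp add: integral_prod integrable_continuous_real)
qed

lemma mono_hom_b0: "strongly_monotone (m / M\<^sup>2) (hom_b0 a x u)"
  and lip_hom_b0: "norm (hom_b0 a x u p - hom_b0 a x u q) \<le> (1 / m) * norm (p - q)"
  if "x \<in> {0..1}" "norm u < 1"
proof -
  have u: "norm u \<le> 1" using that by simp
  note inv = strongly_monotone_inv[OF mono_a[OF that(1) u] bounds(1,2) bij_a[OF that(1) u] lip_a[OF that(1) u], folded hom_b_def]
  note avg = strongly_monotone_average[where B = "\<lambda>y. hom_b a x y u", OF inv hom_b_cont_y[OF that], folded hom_b0_def]
  show "strongly_monotone (m / M\<^sup>2) (hom_b0 a x u)"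
    by (rule avg(1))
  show "norm (hom_b0 a x u p - hom_b0 a x u q) \<le> (1 / m) * norm (p - q)"
    by (rule avg(2))
qed

lemma hom_b0_const_pos: "0 < m / M\<^sup>2" "m / M\<^sup>2 \<le> 1 / m"
proof -
  have "m * m \<le> M * M" using bounds by (intro mult_mono) auto
  then show "0 < m / M\<^sup>2" "m / M\<^sup>2 \<le> 1 / m"
    using bounds M_pos by (auto simp: field_simps power2_eq_square)
qed

lemma bij_hom_b0: "bij (hom_b0 a x u)" if "x \<in> {0..1}" "norm u < 1"
  by (rule strongly_monotone_bij[OF mono_hom_b0[OF that] hom_b0_const_pos lip_hom_b0[OF that]])

lemma hom_b0_hom_a0: "hom_b0 a x u (hom_a0 a x u p) = p" if "x \<in> {0..1}" "norm u < 1"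
  unfolding hom_a0_def by (rule surj_f_inv_f[OF bij_is_surj[OF bij_hom_b0[OF that]]])

lemma hom_a0_hom_b0: "hom_a0 a x u (hom_b0 a x u v) = v" if "x \<in> {0..1}" "norm u < 1"
  unfolding hom_a0_def by (rule inv_f_f[OF bij_is_inj[OF bij_hom_b0[OF that]]])

lemma bij_hom_a0: "bij (hom_a0 a x u)" if "x \<in> {0..1}" "norm u < 1"
  unfolding hom_a0_def by (rule bij_imp_bij_inv[OF bij_hom_b0[OF that]])

lemma hom_f0_eq: "hom_f0 a f x u p = snd (averaged x (u, hom_a0 a x u p))" if "x \<in> {0..1}" "norm u < 1"
  using that by (simp add: averaged_eq hom_f0_def)

text \<open>
  Homogenization is averaging: in the variables state and flux, the first-order system of the homogenized
  problem is the mean of the first-order systems of the oscillating problem. The reason is that \<open>a\<^sub>0\<close> is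
  defined as the inverse of the mean \<open>b\<^sub>0\<close>.
\<close>

lemma first_order_hom: "first_order (hom_a0 a) (hom_f0 a f) x z = averaged x z"
  if "x \<in> {0..1}" "z \<in> states"
proof -
  have z: "norm (fst z) < 1" using that by (simp add: states_iff)
  have "inv (hom_a0 a x (fst z)) = hom_b0 a x (fst z)"
    unfolding hom_a0_def by (rule inv_inv_eq[OF bij_hom_b0[OF that(1) z]])
  then have "first_order (hom_a0 a) (hom_f0 a f) x (fst z, snd z) = averaged x (fst z, snd z)"
    using z that(1) averaged_eq[OF that(1) z, of "snd z"]
    by (simp add: first_order_def Let_def hom_f0_eq hom_a0_hom_b0)
  then show ?thesis by simp
qed

lemma averaged_cont: "continuous_on ({0..1} \<times> states) (\<lambda>(x, z). averaged x z)"
proof -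
  have "continuous_on (({0..1} \<times> states) \<times> cbox 0 1) (\<lambda>s. system (fst (fst (fst s), snd s)) (snd (fst (fst s), snd s)) (snd (fst s)))"
    by (rule continuous_on_families[OF system_cont]) (auto intro!: continuous_intros)
  then have "continuous_on (({0..1} \<times> states) \<times> cbox 0 1) (\<lambda>(s, y). system (fst s) y (snd s))"
    by (simp add: split_beta)
  from integral_continuous_on_param[OF this] show ?thesis
    by (simp add: averaged_def split_beta)
qed

lemma averaged_curve_cont:
  "continuous_on {0..1} z \<Longrightarrow> (\<And>x. x \<in> {0..1} \<Longrightarrow> z x \<in> states) \<Longrightarrow> continuous_on {0..1} (\<lambda>x. averaged x (z x))"
  by (rule continuous_on_families[OF averaged_cont]) (auto intro!: continuous_intros)

lemma hom_a0_curve_cont: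
  assumes u: "continuous_on {0..1} u" "\<And>x. x \<in> {0..1} \<Longrightarrow> norm (u x) < 1" and p: "continuous_on {0..1} p"
  shows "continuous_on {0..1} (\<lambda>x. hom_a0 a x (u x) (p x))"
  unfolding hom_a0_def
proof (rule continuous_on_inv_strongly_monotone[OF hom_b0_const_pos(1) mono_hom_b0 bij_hom_b0 _ p])
  fix v
  have "continuous_on {0..1} (\<lambda>x. averaged x (u x, v))"
    by (rule averaged_curve_cont) (use u in \<open>auto intro!: continuous_intros simp: states_iff\<close>)
  from continuous_on_fst[OF this]
  show "continuous_on {0..1} (\<lambda>x. hom_b0 a x (u x) v)"
    by (rule continuous_on_eq) (use u in \<open>simp add: averaged_eq\<close>)
qed (use u in auto)

lemma hom_f0_curve_cont:
  assumes u: "continuous_on {0..1} u" "\<And>x. x \<in> {0..1} \<Longrightarrow> norm (u x) < 1" and p: "continuous_on {0..1} p"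
  shows "continuous_on {0..1} (\<lambda>x. hom_f0 a f x (u x) (p x))"
proof -
  have "continuous_on {0..1} (\<lambda>x. snd (averaged x (u x, hom_a0 a x (u x) (p x))))"
    by (intro continuous_on_snd averaged_curve_cont)
      (use u in \<open>auto intro!: continuous_intros hom_a0_curve_cont p simp: states_iff\<close>)
  then show ?thesis by (rule continuous_on_eq) (use u in \<open>simp add: hom_f0_eq\<close>)
qed

lemma averaged_deriv:
  assumes x: "x \<in> {0..1}" and z: "z \<in> states"
  shows "(averaged x has_derivative integral {0..1} (\<lambda>y. Dsystem (x, y) z)) (at z)"
proof -
  have "((\<lambda>z. integral (cbox 0 1) (\<lambda>y. system x y z)) has_derivative integral (cbox 0 1) (\<lambda>y. Dsystem (x, y) z)) (at z within states)"
  proof (rule leibniz_rule[OF _ _ _ z convex_states, where f = "\<lambda>z y. system x y z" and fx = "\<lambda>z y. Dsystem (x, y) z"])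
    show "((\<lambda>z. system x y z) has_derivative Dsystem (x, y) z) (at z within states)" if "z \<in> states" for z y
      by (rule has_derivative_at_withinI[OF Dsystem_deriv[OF x that]])
    show "(\<lambda>y. system x y z) integrable_on cbox 0 1" if "z \<in> states" for z
      by (rule integrable_continuous[OF system_cont_y[OF x that]])
    have "continuous_on (states \<times> cbox 0 1) (\<lambda>s. Dsystem (x, snd s) (fst s))"
      by (rule continuous_on_families[OF Dsystem_cont]) (use x in \<open>auto intro!: continuous_intros\<close>)
    then show "continuous_on (states \<times> cbox 0 1) (\<lambda>(z, y). Dsystem (x, y) z)" by (simp add: split_beta)
  qed
  then show ?thesis
    by (simp add: averaged_def[abs_def] at_within_open[OF z open_states])
qed

end

section \<open>The linearized homogenized problem and Lipschitz dependence\<close>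

lemma bvp_solution_cong:
  assumes "\<And>s. s \<in> {0..1} \<Longrightarrow> G s (z s) = H s (z s)"
  shows "bvp_solution G z \<longleftrightarrow> bvp_solution H z"
proof -
  have eq: "integral {0..x} (\<lambda>s. G s (z s)) = integral {0..x} (\<lambda>s. H s (z s))" if "x \<in> {0..1}" for x
    by (rule integral_cong) (use that assms in auto)
  have "(\<forall>x\<in>{0..1}. z x = z 0 + integral {0..x} (\<lambda>s. G s (z s))) \<longleftrightarrow>
      (\<forall>x\<in>{0..1}. z x = z 0 + integral {0..x} (\<lambda>s. H s (z s)))"
    by (intro ball_cong refl) (simp only: eq)
  then show ?thesis unfolding bvp_solution_def by (simp only:)
qed

lemma onorm_scaleR_const_le:
  assumes "norm v \<le> L"
  shows "onorm (\<lambda>h :: real. h *\<^sub>R v) \<le> L"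
proof (rule onorm_le)
  show "norm (h *\<^sub>R v) \<le> L * norm h" for h :: real
    using mult_right_mono[OF assms, of "\<bar>h\<bar>"] by (simp add: mult.commute)
qed

lemma bvp_solution_lipschitz:
  assumes z: "bvp_solution G z" and cont: "continuous_on {0..1} (\<lambda>s. G s (z s))"
  shows "\<exists>L\<ge>0. \<forall>s\<in>{0..1}. \<forall>t\<in>{0..1}. norm (z s - z t) \<le> L * \<bar>s - t\<bar>"
proof -
  have "bounded ((\<lambda>s. G s (z s)) ` {0..1})" by (intro compact_imp_bounded compact_continuous_image cont) auto
  then obtain L where L: "0 < L" "\<And>s. s \<in> {0..1} \<Longrightarrow> norm (G s (z s)) \<le> L"
    unfolding bounded_pos by auto
  have "norm (z s - z t) \<le> L * norm (s - t)" if "s \<in> {0..1}" "t \<in> {0..1}" for s t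
  proof (rule differentiable_bound[where f = z and f' = "\<lambda>x h. h *\<^sub>R G x (z x)"])
    show "(z has_derivative (\<lambda>h. h *\<^sub>R G x (z x))) (at x within {0..1})" if "x \<in> {0..1}" for x
      using integral_equation_has_vector_derivative[OF cont bvp_solutionD(4)[OF z] that]
      by (simp add: has_vector_derivative_def)
    show "onorm (\<lambda>h. h *\<^sub>R G x (z x)) \<le> L" if "x \<in> {0..1}" for x
      by (rule onorm_scaleR_const_le[OF L(2)[OF that]])
  qed (use that in auto)
  then show ?thesis using L(1) by (intro exI[of _ L]) auto
qed

text \<open>
  Mean value estimates in \<open>x\<close> and in \<open>(u, p)\<close> with derivatives bounded on compact sets; periodicity makes the set of
  fast variables compact.
\<close>

lemma smooth_coeff_lipschitz:
  fixes g :: "'n::finite coeff"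
  assumes per: "periodic_coeff g" and smooth: "smooth_coeff g" and smooth_x: "smooth_coeff_x g"
  shows "\<exists>\<Lambda>\<ge>0. \<forall>s\<in>{0..1}. \<forall>t\<in>{0..1}. \<forall>y u u' p p'.
    norm u \<le> R \<longrightarrow> norm u' \<le> R \<longrightarrow> norm p \<le> R \<longrightarrow> norm p' \<le> R \<longrightarrow>
    norm (g s y u p - g t y u' p') \<le> \<Lambda> * (\<bar>s - t\<bar> + norm (u - u') + norm (p - p'))"
proof -
  have dx: "((\<lambda>s. g s y u p) has_vector_derivative deriv01 (\<lambda>s. g s y u p) x) (at x within {0..1})"
    if "x \<in> {0..1}" for x y u p
    using smooth_x that unfolding smooth_coeff_x_def deriv01_def by (simp add: vector_derivative_works[symmetric])
  let ?K = "{0..1} \<times> {0..1} \<times> cball 0 R \<times> cball 0 R :: (real \<times> real \<times> (real^'n) \<times> (real^'n)) set"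
  have "continuous_on ?K (\<lambda>(x, y, u, p). deriv01 (\<lambda>s. g s y u p) x)"
    using smooth_x unfolding smooth_coeff_x_def
    by (auto elim!: continuous_on_subset simp: coeff_domain_def)
  then have "bounded ((\<lambda>(x, y, u, p). deriv01 (\<lambda>s. g s y u p) x) ` ?K)"
    by (intro compact_imp_bounded compact_continuous_image compact_Times) auto
  then obtain L1 where L1: "0 < L1" "\<And>q. q \<in> ?K \<Longrightarrow> norm (case q of (x, y, u, p) \<Rightarrow> deriv01 (\<lambda>s. g s y u p) x) \<le> L1"
    unfolding bounded_pos by blast
  obtain D where D_cont: "continuous_on (({0..1} \<times> UNIV) \<times> UNIV) (\<lambda>(t, z). D t z)"
    and D: "\<And>t z. t \<in> {0..1} \<times> UNIV \<Longrightarrow> ((\<lambda>z. g (fst t) (snd t) (fst z) (snd z)) has_derivative blinfun_apply (D t z)) (at z)"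
    using smooth_coeff_C1_family[OF smooth] unfolding C1_family_def by blast
  let ?B = "cball 0 R \<times> cball 0 R :: ((real^'n) \<times> (real^'n)) set"
  let ?K' = "({0..1} \<times> {0..1}) \<times> ?B :: ((real \<times> real) \<times> (real^'n) \<times> (real^'n)) set"
  have "continuous_on ?K' (\<lambda>(t, z). D t z)" by (rule continuous_on_subset[OF D_cont]) auto
  then have "bounded ((\<lambda>(t, z). D t z) ` ?K')"
    by (intro compact_imp_bounded compact_continuous_image compact_Times) auto
  then obtain L2 where L2: "0 < L2" "\<And>q. q \<in> ?K' \<Longrightarrow> norm (case q of (t, z) \<Rightarrow> D t z) \<le> L2"
    unfolding bounded_pos by blast
  have x_lip: "norm (g s y u p - g t y u p) \<le> L1 * norm (s - t)"
    if "s \<in> {0..1}" "t \<in> {0..1}" "y \<in> {0..1}" "norm u \<le> R" "norm p \<le> R" for s t y u p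
  proof (rule differentiable_bound[where f = "\<lambda>s. g s y u p" and f' = "\<lambda>x h. h *\<^sub>R deriv01 (\<lambda>s. g s y u p) x"])
    show "((\<lambda>s. g s y u p) has_derivative (\<lambda>h. h *\<^sub>R deriv01 (\<lambda>s. g s y u p) x)) (at x within {0..1})" if "x \<in> {0..1}" for x
      using dx[OF that] by (simp add: has_vector_derivative_def)
    show "onorm (\<lambda>h. h *\<^sub>R deriv01 (\<lambda>s. g s y u p) x) \<le> L1" if "x \<in> {0..1}" for x
      by (rule onorm_scaleR_const_le) (use L1(2)[of "(x, y, u, p)"] \<open>norm u \<le> R\<close> \<open>norm p \<le> R\<close> \<open>y \<in> {0..1}\<close> that in simp)
  qed (use that in auto)
  have z_lip: "norm (g t y u p - g t y u' p') \<le> L2 * (norm (u - u') + norm (p - p'))"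
    if "t \<in> {0..1}" "y \<in> {0..1}" "norm u \<le> R" "norm p \<le> R" "norm u' \<le> R" "norm p' \<le> R" for t y u p u' p'
  proof -
    let ?g = "\<lambda>z. g (fst (t, y)) (snd (t, y)) (fst z) (snd z)"
    have "norm (?g (u, p) - ?g (u', p')) \<le> L2 * norm ((u, p) - (u', p'))"
    proof (rule differentiable_bound[where f = ?g and f' = "\<lambda>z. blinfun_apply (D (t, y) z)" and S = ?B])
      show "convex ?B" by (intro convex_Times convex_cball)
      show "(?g has_derivative blinfun_apply (D (t, y) z)) (at z within ?B)" for z
        by (rule has_derivative_at_withinI[OF D]) (use that in auto)
      show "onorm (blinfun_apply (D (t, y) z)) \<le> L2" if "z \<in> ?B" for z
        using L2(2)[of "((t, y), z)"] that \<open>t \<in> {0..1}\<close> \<open>y \<in> {0..1}\<close> by (simp add: norm_blinfun.rep_eq)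
    qed (use that in auto)
    also have "\<dots> \<le> L2 * (norm (u - u') + norm (p - p'))"
      using L2(1) norm_Pair_le[of "u - u'" "p - p'"] by (intro mult_left_mono) auto
    finally show ?thesis by simp
  qed
  show ?thesis
  proof (intro exI[of _ "L1 + L2"] conjI ballI allI impI)
    fix s t y :: real and u u' p p' :: "real^'n"
    assume *: "s \<in> {0..1}" "t \<in> {0..1}"
      "norm u \<le> R" "norm u' \<le> R" "norm p \<le> R" "norm p' \<le> R"
    have frac: "g x y w q = g x (frac y) w q" if "x \<in> {0..1}" for x w q
      by (rule periodic_frac[of "\<lambda>y. g x y w q"]) (use per that in \<open>auto simp: periodic_coeff_def\<close>)
    have "norm (g s y u p - g t y u' p') \<le>
        norm (g s (frac y) u p - g t (frac y) u p) + norm (g t (frac y) u p - g t (frac y) u' p')"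
      using frac[OF *(1)] frac[OF *(2)] norm_triangle_ineq[of "g s (frac y) u p - g t (frac y) u p" "g t (frac y) u p - g t (frac y) u' p'"]
      by simp
    also have "\<dots> \<le> L1 * norm (s - t) + L2 * (norm (u - u') + norm (p - p'))"
      by (intro add_mono x_lip z_lip * frac_in_unit)
    also have "\<dots> \<le> (L1 + L2) * norm (s - t) + (L1 + L2) * (norm (u - u') + norm (p - p'))"
      using L1(1) L2(1) by (intro add_mono mult_right_mono) auto
    also have "\<dots> = (L1 + L2) * (\<bar>s - t\<bar> + norm (u - u') + norm (p - p'))" by (simp add: algebra_simps)
    finally show "norm (g s y u p - g t y u' p') \<le> (L1 + L2) * (\<bar>s - t\<bar> + norm (u - u') + norm (p - p'))" .
  qed (use L1 L2 in auto)
qed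

context homogenization_problem begin

text \<open>
  Write \<open>D = (D\<^sub>1, D\<^sub>2)\<close> for the derivative of the averaged system at \<open>(u\<^sub>0 x, v)\<close>, \<open>v\<close> being the flux. The
  derivative \<open>\<alpha>\<close> of \<open>a\<^sub>0\<close> is obtained by solving \<open>D\<^sub>1 (d, q) = p\<close> for \<open>q\<close>; hence \<open>\<alpha> (k\<^sub>1, D\<^sub>1 k) = k\<^sub>2\<close>. As \<open>f\<^sub>0\<close> is the second component of the
  averaged system composed with \<open>a\<^sub>0\<close>, its derivative takes \<open>(k\<^sub>1, D\<^sub>1 k)\<close> to \<open>D\<^sub>2 k\<close>. So for a solution of \<open>k' = D k\<close>
  the linearized flux is \<open>k\<^sub>2\<close> and the linearized right-hand side is \<open>k\<^sub>2'\<close>.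
\<close>

lemma linearize_homogenized:
  assumes x: "x \<in> {0..1}" and u0: "norm (u\<^sub>0 x) < 1"
  defines "D \<equiv> integral {0..1} (\<lambda>y. Dsystem (x, y) (u\<^sub>0 x, hom_a0 a x (u\<^sub>0 x) (deriv01 u\<^sub>0 x)))"
  shows "linearize (hom_a0 a) u\<^sub>0 x (fst k) (fst (D k)) = snd k"
    and "linearize (hom_f0 a f) u\<^sub>0 x (fst k) (fst (D k)) = snd (D k)"
proof -
  define w where "w = u\<^sub>0 x"
  define p where "p = deriv01 u\<^sub>0 x"
  define v where "v = hom_a0 a x w p"
  have w: "norm w < 1" using u0 by (simp add: w_def)
  have wv: "(w, v) \<in> states" using w by (simp add: states_iff)
  have D: "(averaged x has_derivative blinfun_apply D) (at (w, v))"
    using averaged_deriv[OF x wv] by (simp add: D_def w_def v_def p_def)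
  define A where "A z = hom_b0 a x (fst z) (snd z)" for z
  have A_fst: "fst (averaged x z) = A z" if "z \<in> states" for z
    using averaged_eq[OF x, of "fst z" "snd z"] that by (simp add: states_iff A_def)
  have A': "(A has_derivative (\<lambda>d. fst (D d))) (at (w, inv (\<lambda>q. A (w, q)) p))"
  proof -
    have "((\<lambda>z. fst (averaged x z)) has_derivative (\<lambda>d. fst (D d))) (at (w, v))"
      by (rule has_derivative_fst[OF D])
    then have "(A has_derivative (\<lambda>d. fst (D d))) (at (w, v))"
      by (rule has_derivative_transform_within_open[OF _ open_states wv A_fst])
    then show ?thesis by (simp add: A_def v_def hom_a0_def)
  qed
  define \<alpha> where "\<alpha> d = inv (\<lambda>q. fst (D (0, q))) (snd d - fst (D (fst d, 0)))" for d
  have cont: "continuous_on (ball 0 1) (\<lambda>w. A (w, q))" for q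
  proof -
    have "continuous_on (ball 0 1) (\<lambda>w. averaged x (w, q))"
      by (rule continuous_on_families[OF averaged_cont]) (use x in \<open>auto intro!: continuous_intros simp: states_iff\<close>)
    from continuous_on_fst[OF this] show ?thesis
      by (rule continuous_on_eq) (simp add: A_fst states_iff)
  qed
  have ball: "w \<in> ball 0 1" using w by simp
  have "strongly_monotone (m / M\<^sup>2) (\<lambda>p. A (w, p))" "bij (\<lambda>p. A (w, p))" if "w \<in> ball 0 1" for w
    using mono_hom_b0[OF x] bij_hom_b0[OF x] that by (simp_all add: A_def)
  note inverse = has_derivative_parametrized_inverse[OF open_ball ball hom_b0_const_pos(1) this cont A']
  have bijD: "bij (\<lambda>q. fst (D (0, q)))"
    by (rule linear_strongly_monotone_bij(1)[OF inverse(3,2) hom_b0_const_pos(1)])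
  have \<alpha>: "((\<lambda>z. hom_a0 a x (fst z) (snd z)) has_derivative \<alpha>) (at (w, p))"
    using inverse(1) by (simp add: A_def \<alpha>_def[abs_def] hom_a0_def)
  have \<alpha>_k: "\<alpha> (fst k, fst (D k)) = snd k"
  proof -
    have "k - (fst k, 0) = (0, snd k)" by (simp add: prod_eq_iff)
    then have "fst (D k) - fst (D (fst k, 0)) = fst (D (0, snd k))"
      by (metis blinfun.diff_right fst_diff)
    then show ?thesis using inv_f_f[OF bij_is_inj[OF bijD]] by (simp add: \<alpha>_def)
  qed
  show "linearize (hom_a0 a) u\<^sub>0 x (fst k) (fst (D k)) = snd k"
    using linearize_eq[of "hom_a0 a" x \<alpha> u\<^sub>0] \<alpha> \<alpha>_k by (simp add: w_def p_def)
  have "((\<lambda>z. averaged x (fst z, hom_a0 a x (fst z) (snd z))) has_derivative (\<lambda>d. D (fst d, \<alpha> d))) (at (w, p))"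
  proof (rule has_derivative_compose[where f = "\<lambda>z. (fst z, hom_a0 a x (fst z) (snd z))" and f' = "\<lambda>d. (fst d, \<alpha> d)" and g' = "blinfun_apply D"])
    show "((\<lambda>z. (fst z, hom_a0 a x (fst z) (snd z))) has_derivative (\<lambda>d. (fst d, \<alpha> d))) (at (w, p))"
      by (intro has_derivative_Pair has_derivative_fst has_derivative_ident \<alpha>)
  qed (use D in \<open>simp add: v_def\<close>)
  then have "((\<lambda>z. snd (averaged x (fst z, hom_a0 a x (fst z) (snd z)))) has_derivative (\<lambda>d. snd (D (fst d, \<alpha> d)))) (at (w, p))"
    by (rule has_derivative_snd)
  then have "((\<lambda>z. hom_f0 a f x (fst z) (snd z)) has_derivative (\<lambda>d. snd (D (fst d, \<alpha> d)))) (at (w, p))"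
    by (rule has_derivative_transform_within_open[OF _ open_states])
      (use w x in \<open>auto simp: states_iff hom_f0_eq\<close>)
  from linearize_eq[of "hom_f0 a f" x _ u\<^sub>0, OF this[unfolded w_def p_def]]
  show "linearize (hom_f0 a f) u\<^sub>0 x (fst k) (fst (D k)) = snd (D k)"
    by (simp add: \<alpha>_k)
qed

text \<open>
  The first component of a solution of the linear system is a weak solution of the linearized homogenized problem, hence
  zero; its derivative is then zero too, and so is the linearized flux, which is the second component.
\<close>

lemma linear_bvp_trivial:
  assumes C1: "C1_01 u\<^sub>0" and u0: "\<And>x. x \<in> {0..1} \<Longrightarrow> norm (u\<^sub>0 x) < 1"
    and nondegenerate: "\<And>u. weak_solution_lin a f u\<^sub>0 u \<Longrightarrow> \<forall>x\<in>{0..1}. u x = 0"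
    and k: "bvp_solution (\<lambda>x. blinfun_apply (integral {0..1}
      (\<lambda>y. Dsystem (x, y) (u\<^sub>0 x, hom_a0 a x (u\<^sub>0 x) (deriv01 u\<^sub>0 x))))) k"
  shows "k 0 = 0"
proof -
  define z\<^sub>0 where "z\<^sub>0 x = (u\<^sub>0 x, hom_a0 a x (u\<^sub>0 x) (deriv01 u\<^sub>0 x))" for x
  define D where "D x = integral {0..1} (\<lambda>y. Dsystem (x, y) (z\<^sub>0 x))" for x
  have u0_cont: "continuous_on {0..1} u\<^sub>0" and du0_cont: "continuous_on {0..1} (deriv01 u\<^sub>0)"
    using C1 by (auto simp: C1_01_def intro: differentiable_imp_continuous_on)
  have z0_cont: "continuous_on {0..1} z\<^sub>0"
    unfolding z\<^sub>0_def by (intro continuous_intros u0_cont hom_a0_curve_cont u0 du0_cont)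
  have z0: "z\<^sub>0 x \<in> states" if "x \<in> {0..1}" for x using u0[OF that] by (simp add: states_iff z\<^sub>0_def)
  have D_cont: "continuous_on {0..1} D"
  proof -
    have "continuous_on ({0..1} \<times> cbox 0 1) (\<lambda>s. Dsystem (fst s, snd s) (z\<^sub>0 (fst s)))"
      by (rule continuous_on_families[OF Dsystem_cont])
        (use z0 in \<open>auto intro!: continuous_intros continuous_on_compose2[OF z0_cont]\<close>)
    then have "continuous_on ({0..1} \<times> cbox 0 1) (\<lambda>(x, y). Dsystem (x, y) (z\<^sub>0 x))" by (simp add: split_beta)
    from integral_continuous_on_param[OF this] show ?thesis by (simp add: D_def[abs_def])
  qed
  have k: "bvp_solution (\<lambda>x. blinfun_apply (D x)) k" using k by (simp add: D_def z\<^sub>0_def)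
  have k_cont: "continuous_on {0..1} k" by (rule bvp_solutionD(1)[OF k])
  have Dk_cont: "continuous_on {0..1} (\<lambda>x. D x (k x))" by (intro continuous_intros D_cont k_cont)
  have k': "(k has_vector_derivative D x (k x)) (at x within {0..1})" if "x \<in> {0..1}" for x
    by (rule integral_equation_has_vector_derivative[OF Dk_cont bvp_solutionD(4)[OF k] that])
  let ?u = "\<lambda>x. fst (k x)" and ?v = "\<lambda>x. snd (k x)"
  have du: "(?u has_vector_derivative fst (D x (k x))) (at x within {0..1})" if "x \<in> {0..1}" for x
    by (rule bounded_linear.has_vector_derivative[OF bounded_linear_fst k'[OF that]])
  have C1_u: "C1_01 ?u" and deriv_u: "\<And>x. x \<in> {0..1} \<Longrightarrow> deriv01 ?u x = fst (D x (k x))"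
    using C1_01I[of ?u "\<lambda>x. fst (D x (k x))"] du continuous_on_fst[OF Dk_cont] by blast+
  have lin: "linearize (hom_a0 a) u\<^sub>0 x (?u x) (deriv01 ?u x) = ?v x"
      "linearize (hom_f0 a f) u\<^sub>0 x (?u x) (deriv01 ?u x) = snd (D x (k x))" if "x \<in> {0..1}" for x
    using linearize_homogenized[OF that, of u\<^sub>0 "k x", OF u0[OF that]] deriv_u[OF that]
    by (simp_all add: D_def z\<^sub>0_def)
  have "(?v has_vector_derivative snd (D x (k x))) (at x within {0..1})" if "x \<in> {0..1}" for x
    by (rule bounded_linear.has_vector_derivative[OF bounded_linear_snd k'[OF that]])
  then have v_eq: "?v x = ?v 0 + integral {0..x} (\<lambda>x. snd (D x (k x)))" if "x \<in> {0..1}" for x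
    by (rule integral_of_vector_derivative[OF _ that])
  have "weak_solution_lin a f u\<^sub>0 ?u"
    unfolding weak_solution_lin_def weak_solution_def
  proof (intro conjI allI impI C1_u)
    show "?u 0 = 0" by (rule bvp_solutionD(2)[OF k])
    fix \<phi> :: "real \<Rightarrow> real^'n" assume "C1_01 \<phi> \<and> \<phi> 0 = 0"
    then have "((\<lambda>x. ?v x \<bullet> deriv01 \<phi> x + snd (D x (k x)) \<bullet> \<phi> x) has_integral 0) {0..1}"
      by (intro weak_form_if_integrated continuous_on_snd Dk_cont v_eq bvp_solutionD(3)[OF k]) auto
    then show "((\<lambda>x. linearize (hom_a0 a) u\<^sub>0 x (?u x) (deriv01 ?u x) \<bullet> deriv01 \<phi> x +
        linearize (hom_f0 a f) u\<^sub>0 x (?u x) (deriv01 ?u x) \<bullet> \<phi> x) has_integral 0) {0..1}"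
      by (rule has_integral_eq[rotated]) (simp add: lin)
  qed
  then have u_0: "?u x = 0" if "x \<in> {0..1}" for x using nondegenerate that by blast
  have "(?u has_vector_derivative 0) (at 0 within {0..1})"
    by (rule has_vector_derivative_transform[where f = "\<lambda>_. 0"]) (auto simp: u_0)
  then have "deriv01 ?u 0 = 0" by (rule deriv01_eq) simp
  with lin(1)[of 0] u_0[of 0] have "?v 0 = 0" by (simp add: linearize_def)
  then show "k 0 = 0" using u_0[of 0] by (intro prod_eqI) simp_all
qed


text \<open>
  With \<open>P s y\<close> the first component of the system, \<open>a s y u P = v\<close> holds along the curve. Comparing this identity at \<open>s\<close>
  and \<open>t\<close> and using strong monotonicity at \<open>t\<close> bounds \<open>P s y - P t y\<close>, so the inverse \<open>b\<close> need not be
  differentiated in \<open>x\<close>.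
\<close>

lemma system_lipschitz_along_curve:
  assumes smooth_x: "smooth_coeff_x a" "smooth_coeff_x f"
    and z: "continuous_on {0..1} z" "\<And>x. x \<in> {0..1} \<Longrightarrow> z x \<in> states"
    and z_lip: "\<exists>L\<ge>0. \<forall>s\<in>{0..1}. \<forall>t\<in>{0..1}. norm (z s - z t) \<le> L * \<bar>s - t\<bar>"
  shows "\<exists>\<Lambda>\<ge>0. \<forall>s\<in>{0..1}. \<forall>t\<in>{0..1}. \<forall>y. norm (system s y (z s) - system t y (z t)) \<le> \<Lambda> * \<bar>s - t\<bar>"
proof -
  obtain L where L: "0 \<le> L" "\<And>s t. s \<in> {0..1} \<Longrightarrow> t \<in> {0..1} \<Longrightarrow> norm (z s - z t) \<le> L * \<bar>s - t\<bar>"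
    using z_lip by blast
  define P where "P s y = fst (system s y (z s))" for s y
  have P: "system s y (z s) = (P s y, f s y (fst (z s)) (P s y))" for s y by (simp add: P_def system_eq)
  have P_eq: "P s y = hom_b a s y (fst (z s)) (snd (z s))" for s y by (simp add: P_def system_eq)
  have aP: "a s y (fst (z s)) (P s y) = snd (z s)" if "s \<in> {0..1}" for s y
    unfolding P_eq by (rule a_hom_b) (use z(2)[OF that] that in \<open>auto simp: states_iff\<close>)
  have "continuous_on ({0..1} \<times> UNIV) (\<lambda>s. system (fst (fst s, snd s)) (snd (fst s, snd s)) (z (fst s)))"
    by (rule continuous_on_families[OF system_cont])
      (use z in \<open>auto intro!: continuous_intros continuous_on_compose2[OF z(1)]\<close>)
  from continuous_on_fst[OF this] have P_cont: "continuous_on ({0..1} \<times> UNIV) (\<lambda>(s, y). P s y)"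
    by (simp add: P_def split_beta)
  have P_per: "P s (y + 1) = P s y" if "s \<in> {0..1}" for s y
    by (simp add: P_def system_periodic[OF that])
  obtain R where R: "0 \<le> R" "\<And>s y. s \<in> {0..1} \<Longrightarrow> norm (P s y) \<le> R"
    using periodic_continuous_bounded[of P, OF P_cont P_per] by blast
  let ?R = "max 1 R"
  obtain La where La: "0 \<le> La" "\<And>s t y u u' p p'. s \<in> {0..1} \<Longrightarrow> t \<in> {0..1} \<Longrightarrow>
    norm u \<le> ?R \<Longrightarrow> norm u' \<le> ?R \<Longrightarrow> norm p \<le> ?R \<Longrightarrow> norm p' \<le> ?R \<Longrightarrow>
    norm (a s y u p - a t y u' p') \<le> La * (\<bar>s - t\<bar> + norm (u - u') + norm (p - p'))"
    using smooth_coeff_lipschitz[OF periodic(1) smooth(1) smooth_x(1), of ?R] by blast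
  obtain Lf where Lf: "0 \<le> Lf" "\<And>s t y u u' p p'. s \<in> {0..1} \<Longrightarrow> t \<in> {0..1} \<Longrightarrow>
    norm u \<le> ?R \<Longrightarrow> norm u' \<le> ?R \<Longrightarrow> norm p \<le> ?R \<Longrightarrow> norm p' \<le> ?R \<Longrightarrow>
    norm (f s y u p - f t y u' p') \<le> Lf * (\<bar>s - t\<bar> + norm (u - u') + norm (p - p'))"
    using smooth_coeff_lipschitz[OF periodic(2) smooth(2) smooth_x(2), of ?R] by blast
  define K where "K = (La * (1 + L) + L) / m"
  have "0 \<le> K" using L La bounds(1) by (simp add: K_def)
  have fst_le: "norm (fst w) \<le> norm w" and snd_le: "norm (snd w) \<le> norm w" for w :: "(real^'n) \<times> (real^'n)"
    using norm_fst_le[of "fst w" "snd w"] norm_snd_le[of "snd w" "fst w"] by simp_all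
  have u_lip: "norm (fst (z s) - fst (z t)) \<le> L * \<bar>s - t\<bar>" and v_lip: "norm (snd (z s) - snd (z t)) \<le> L * \<bar>s - t\<bar>"
    if "s \<in> {0..1}" "t \<in> {0..1}" for s t
    using order_trans[OF fst_le L(2)[OF that]] order_trans[OF snd_le L(2)[OF that]] by simp_all
  have uR: "norm (fst (z s)) \<le> ?R" if "s \<in> {0..1}" for s using z(2)[OF that] by (simp add: states_iff)
  have PR: "norm (P s y) \<le> ?R" if "s \<in> {0..1}" for s y using R(2)[OF that, of y] by simp
  have P_lip: "norm (P s y - P t y) \<le> K * \<bar>s - t\<bar>" if s: "s \<in> {0..1}" and t: "t \<in> {0..1}" for s t y
  proof -
    have "m * norm (P s y - P t y) \<le> norm (a t y (fst (z t)) (P s y) - a t y (fst (z t)) (P t y))"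
      by (rule strongly_monotone_expansive[OF mono_a[OF t]]) (use z(2)[OF t] in \<open>simp add: states_iff\<close>)
    also have "\<dots> = norm ((a t y (fst (z t)) (P s y) - a s y (fst (z s)) (P s y)) + (snd (z s) - snd (z t)))"
      by (simp add: aP[OF s] aP[OF t])
    also have "\<dots> \<le> La * (\<bar>t - s\<bar> + norm (fst (z t) - fst (z s)) + norm (P s y - P s y)) + L * \<bar>s - t\<bar>"
      by (intro norm_triangle_mono La(2) v_lip uR PR s t)
    also have "\<dots> \<le> La * (\<bar>s - t\<bar> + L * \<bar>s - t\<bar>) + L * \<bar>s - t\<bar>"
      using u_lip[OF t s] La(1) by (intro add_right_mono mult_left_mono) (auto simp: abs_minus_commute)
    also have "\<dots> = m * (K * \<bar>s - t\<bar>)" using bounds(1) by (simp add: K_def field_simps)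
    finally show ?thesis using bounds(1) by simp
  qed
  have "norm (system s y (z s) - system t y (z t)) \<le> (K + Lf * (1 + L + K)) * \<bar>s - t\<bar>"
    if s: "s \<in> {0..1}" and t: "t \<in> {0..1}" for s t y
  proof -
    have "norm (system s y (z s) - system t y (z t))
      \<le> norm (P s y - P t y) + norm (f s y (fst (z s)) (P s y) - f t y (fst (z t)) (P t y))"
      by (simp add: P norm_Pair_le)
    also have "\<dots> \<le> K * \<bar>s - t\<bar> + Lf * (\<bar>s - t\<bar> + norm (fst (z s) - fst (z t)) + norm (P s y - P t y))"
      by (intro add_mono P_lip Lf(2) uR PR s t)
    also have "\<dots> \<le> K * \<bar>s - t\<bar> + Lf * (\<bar>s - t\<bar> + L * \<bar>s - t\<bar> + K * \<bar>s - t\<bar>)"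
      using Lf(1) \<open>0 \<le> K\<close> by (intro add_mono mult_left_mono u_lip P_lip s t) auto
    also have "\<dots> = (K + Lf * (1 + L + K)) * \<bar>s - t\<bar>" by (simp add: algebra_simps)
    finally show ?thesis .
  qed
  moreover have "0 \<le> K + Lf * (1 + L + K)" using \<open>0 \<le> K\<close> L Lf by simp
  ultimately show ?thesis by blast
qed

end

section \<open>Homogenization\<close>

lemma norm_inf_le:
  assumes "\<And>x. x \<in> {0..1} \<Longrightarrow> norm (u x) \<le> B"
  shows "0 \<le> norm_inf u" "norm_inf u \<le> B"
proof -
  have bdd: "bdd_above ((\<lambda>x. norm (u x)) ` {0..1})" by (rule bdd_aboveI2[OF assms])
  have "norm (u 0) \<le> norm_inf u" unfolding norm_inf_def by (rule cSUP_upper[OF _ bdd]) simp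
  then show "0 \<le> norm_inf u" by (rule order_trans[OF norm_ge_zero])
  show "norm_inf u \<le> B" unfolding norm_inf_def by (rule cSUP_least) (use assms in auto)
qed

lemma norm_le_norm_inf:
  assumes "continuous_on {0..1} u" "x \<in> {0..1}"
  shows "norm (u x) \<le> norm_inf u"
proof -
  have "bounded ((\<lambda>x. norm (u x)) ` {0..1})"
    by (intro compact_imp_bounded compact_continuous_image continuous_intros assms) auto
  then have "bdd_above ((\<lambda>x. norm (u x)) ` {0..1})" by (rule bounded_imp_bdd_above)
  then show ?thesis unfolding norm_inf_def by (rule cSUP_upper[OF assms(2)])
qed

context homogenization_problem begin

lemma smooth_curve_cont:
  fixes g :: "'n coeff"
  assumes "smooth_coeff g" and y: "continuous_on {0..1} y"
    and u: "continuous_on {0..1} u" and p: "continuous_on {0..1} p"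
  shows "continuous_on {0..1} (\<lambda>x. g x (y x) (u x) (p x))"
proof -
  have g: "continuous_on coeff_domain (\<lambda>(x, y, u, p). g x y u p)"
    using assms(1) by (simp add: smooth_coeff_def)
  have "continuous_on {0..1} (\<lambda>x. (\<lambda>(x, y, u, p). g x y u p) (x, y x, u x, p x))"
    by (rule continuous_on_compose2[OF g]) (auto simp: coeff_domain_def intro!: continuous_intros y u p)
  then show ?thesis by simp
qed

lemma system_curve_cont:
  assumes "continuous_on {0..1} y" "continuous_on {0..1} z" "\<And>x. x \<in> {0..1} \<Longrightarrow> z x \<in> states"
  shows "continuous_on {0..1} (\<lambda>x. system x (y x) (z x))"
proof -
  have "continuous_on {0..1} (\<lambda>x. system (fst (x, y x)) (snd (x, y x)) (z x))"
    by (rule continuous_on_families[OF system_cont]) (use assms in \<open>auto intro!: continuous_intros\<close>)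
  then show ?thesis by simp
qed

lemma first_order_eps: "first_order (\<lambda>x. a x (x / \<epsilon>)) (\<lambda>x. f x (x / \<epsilon>)) = (\<lambda>s. system s (s / \<epsilon>))"
  by (intro ext) (simp add: system_def first_order_def)

lemma weak_solution_eps_imp_bvp_solution:
  assumes "0 < \<epsilon>" and u: "weak_solution_eps a f \<epsilon> u" and small: "\<And>x. x \<in> {0..1} \<Longrightarrow> norm (u x) \<le> 1"
  shows "bvp_solution (\<lambda>s. system s (s / \<epsilon>)) (\<lambda>x. (u x, flux_eps a \<epsilon> u x))"
proof -
  have C1: "C1_01 u" using u by (simp add: weak_solution_eps_def weak_solution_def)
  then have c: "continuous_on {0..1} u" "continuous_on {0..1} (deriv01 u)"
    by (auto simp: C1_01_def intro: differentiable_imp_continuous_on)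
  have y: "continuous_on {0..1} (\<lambda>x. x / \<epsilon>)" using \<open>0 < \<epsilon>\<close> by (intro continuous_intros) auto
  show ?thesis
    unfolding flux_eps_def first_order_eps[symmetric]
    by (rule weak_solution_imp_bvp_solution[OF u[unfolded weak_solution_eps_def] bij_a[OF _ small]
        smooth_curve_cont[OF smooth(1) y c] smooth_curve_cont[OF smooth(2) y c]])
qed

lemma bvp_solution_imp_weak_solution_eps:
  assumes "0 < \<epsilon>" and z: "bvp_solution (\<lambda>s. system s (s / \<epsilon>)) z" and st: "\<And>x. x \<in> {0..1} \<Longrightarrow> z x \<in> states"
  shows "weak_solution_eps a f \<epsilon> (\<lambda>x. fst (z x))"
    and "\<And>x. x \<in> {0..1} \<Longrightarrow> flux_eps a \<epsilon> (\<lambda>x. fst (z x)) x = snd (z x)"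
proof -
  have y: "continuous_on {0..1} (\<lambda>x. x / \<epsilon>)" using \<open>0 < \<epsilon>\<close> by (intro continuous_intros) auto
  have cont: "continuous_on {0..1} (\<lambda>x. first_order (\<lambda>x. a x (x / \<epsilon>)) (\<lambda>x. f x (x / \<epsilon>)) x (z x))"
    unfolding first_order_eps by (rule system_curve_cont[OF y bvp_solutionD(1)[OF z] st])
  have bij: "bij (a x (x / \<epsilon>) (fst (z x)))" if "x \<in> {0..1}" for x
    using bij_a[OF that] st[OF that] by (simp add: states_iff)
  note weak = bvp_solution_imp_weak_solution[of "\<lambda>x. a x (x / \<epsilon>)" "\<lambda>x. f x (x / \<epsilon>)", OF _ bij cont, unfolded first_order_eps, OF z]
  show "weak_solution_eps a f \<epsilon> (\<lambda>x. fst (z x))"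
    unfolding weak_solution_eps_def by (rule weak(1))
  show "flux_eps a \<epsilon> (\<lambda>x. fst (z x)) x = snd (z x)" if "x \<in> {0..1}" for x
    unfolding flux_eps_def by (rule weak(2)[OF _ that])
qed

lemma homogenized_bvp_solution:
  assumes u: "weak_solution_hom a f u" and small: "\<And>x. x \<in> {0..1} \<Longrightarrow> norm (u x) < 1"
  shows "bvp_solution averaged (\<lambda>x. (u x, flux_hom a u x))"
proof -
  have C1: "C1_01 u" using u by (simp add: weak_solution_hom_def weak_solution_def)
  then have c: "continuous_on {0..1} u" "continuous_on {0..1} (deriv01 u)"
    by (auto simp: C1_01_def intro: differentiable_imp_continuous_on)
  have "bvp_solution (first_order (hom_a0 a) (hom_f0 a f)) (\<lambda>x. (u x, flux_hom a u x))"
    unfolding flux_hom_def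
    by (rule weak_solution_imp_bvp_solution[OF u[unfolded weak_solution_hom_def] bij_hom_a0[OF _ small]
        hom_a0_curve_cont[OF c(1) small c(2)] hom_f0_curve_cont[OF c(1) small c(2)]])
  then show ?thesis
    by (subst (asm) bvp_solution_cong[where H = averaged])
      (use small in \<open>auto simp: first_order_hom states_iff\<close>)
qed

text \<open>
  Translation of \<open>periodic_averaging_bvp\<close> back to weak solutions. Proximity is measured by the sum of the norms of the two
  components in a local solution and by the Euclidean norm of the pair in the first-order system; the sum dominates the Euclidean
  norm, and the solution found within \<open>\<delta> / 2\<close> in the latter is within \<open>\<delta>\<close> in the former.
\<close>

lemma homogenization_estimate:
  assumes sol: "weak_solution_hom a f u\<^sub>0" and small: "\<And>x. x \<in> {0..1} \<Longrightarrow> norm (u\<^sub>0 x) < 1"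
    and nondegenerate: "\<And>u. weak_solution_lin a f u\<^sub>0 u \<Longrightarrow> \<forall>x\<in>{0..1}. u x = 0"
  defines "z\<^sub>0 \<equiv> \<lambda>x. (u\<^sub>0 x, flux_hom a u\<^sub>0 x)"
  shows "\<exists>\<delta>>0. \<exists>\<epsilon>\<^sub>0>0. \<exists>C\<ge>0. \<forall>\<epsilon>\<in>{0<..\<epsilon>\<^sub>0}.
    (\<exists>u. local_solution a f u\<^sub>0 \<delta> \<epsilon> u) \<and>
    (\<forall>u w. local_solution a f u\<^sub>0 \<delta> \<epsilon> u \<longrightarrow> local_solution a f u\<^sub>0 \<delta> \<epsilon> w \<longrightarrow> (\<forall>x\<in>{0..1}. w x = u x)) \<and>
    (\<forall>u \<omega>. local_solution a f u\<^sub>0 \<delta> \<epsilon> u \<longrightarrow>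
      (\<forall>x\<in>{0..1}. norm (integral {0..x} (\<lambda>s. system s (s / \<epsilon>) (z\<^sub>0 s) - averaged s (z\<^sub>0 s))) \<le> \<omega>) \<longrightarrow>
      (\<forall>x\<in>{0..1}. norm (u x - u\<^sub>0 x) \<le> C * \<omega> \<and> norm (flux_eps a \<epsilon> u x - flux_hom a u\<^sub>0 x) \<le> C * \<omega>))"
proof -
  have C1: "C1_01 u\<^sub>0" using sol by (simp add: weak_solution_hom_def weak_solution_def)
  have F_cont: "continuous_on ({0..1} \<times> UNIV \<times> states) (\<lambda>(x, y, z). system x y z)"
  proof -
    have "continuous_on ({0..1} \<times> UNIV \<times> states) (\<lambda>s. system (fst (fst s, fst (snd s))) (snd (fst s, fst (snd s))) (snd (snd s)))"
      by (rule continuous_on_families[OF system_cont]) (auto intro!: continuous_intros)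
    then show ?thesis by (simp add: split_beta)
  qed
  have DF_cont: "continuous_on ({0..1} \<times> UNIV \<times> states) (\<lambda>(x, y, z). Dsystem (x, y) z)"
  proof -
    have "continuous_on ({0..1} \<times> UNIV \<times> states) (\<lambda>s. Dsystem (fst s, fst (snd s)) (snd (snd s)))"
      by (rule continuous_on_families[OF Dsystem_cont]) (auto intro!: continuous_intros)
    then show ?thesis by (simp add: split_beta)
  qed
  have z0: "bvp_solution averaged z\<^sub>0" unfolding z\<^sub>0_def by (rule homogenized_bvp_solution[OF sol small])
  have z0_st: "z\<^sub>0 x \<in> states" if "x \<in> {0..1}" for x using small[OF that] by (simp add: z\<^sub>0_def states_iff)
  have nondeg: "k 0 = 0" if "bvp_solution (\<lambda>s. blinfun_apply (integral {0..1} (\<lambda>y. Dsystem (s, y) (z\<^sub>0 s)))) k" for k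
    by (rule linear_bvp_trivial[OF C1 small nondegenerate]) (use that in \<open>simp_all add: z\<^sub>0_def flux_hom_def\<close>)
  let ?main = "\<lambda>\<delta> \<epsilon>\<^sub>0 C. \<forall>\<epsilon>\<in>{0<..\<epsilon>\<^sub>0}.
    (\<exists>z. bvp_solution (\<lambda>s. system s (s / \<epsilon>)) z \<and> (\<forall>x\<in>{0..1}. norm (z x - z\<^sub>0 x) \<le> \<delta> / 2)) \<and>
    (\<forall>z w. bvp_solution (\<lambda>s. system s (s / \<epsilon>)) z \<longrightarrow> bvp_solution (\<lambda>s. system s (s / \<epsilon>)) w \<longrightarrow>
      (\<forall>x\<in>{0..1}. norm (z x - z\<^sub>0 x) \<le> \<delta> \<and> norm (w x - z\<^sub>0 x) \<le> \<delta>) \<longrightarrow> (\<forall>x\<in>{0..1}. z x = w x)) \<and>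
    (\<forall>z \<omega>. bvp_solution (\<lambda>s. system s (s / \<epsilon>)) z \<longrightarrow> (\<forall>x\<in>{0..1}. norm (z x - z\<^sub>0 x) \<le> \<delta>) \<longrightarrow>
      (\<forall>x\<in>{0..1}. norm (integral {0..x} (\<lambda>s. system s (s / \<epsilon>) (z\<^sub>0 s) - averaged s (z\<^sub>0 s))) \<le> \<omega>) \<longrightarrow>
      (\<forall>x\<in>{0..1}. norm (z x - z\<^sub>0 x) \<le> C * \<omega>))"
  have "\<exists>\<delta>>0. \<exists>\<epsilon>\<^sub>0>0. \<exists>C\<ge>0. (\<forall>x\<in>{0..1}. cball (z\<^sub>0 x) \<delta> \<subseteq> states) \<and> ?main \<delta> \<epsilon>\<^sub>0 C"
    unfolding averaged_def
    by (rule periodic_averaging_bvp[where DF = "\<lambda>x y z. Dsystem (x, y) z"],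
        rule open_states, erule system_periodic, erule (1) Dsystem_periodic, rule F_cont, rule DF_cont,
        erule (1) Dsystem_deriv, rule z0[unfolded averaged_def[abs_def]], erule z0_st, erule nondeg)
  then obtain \<delta> \<epsilon>\<^sub>0 C where "\<delta> > 0" "\<epsilon>\<^sub>0 > 0" "C \<ge> 0" and balls: "\<forall>x\<in>{0..1}. cball (z\<^sub>0 x) \<delta> \<subseteq> states"
    and main: "?main \<delta> \<epsilon>\<^sub>0 C"
    by blast
  have ball: "\<And>x. x \<in> {0..1} \<Longrightarrow> cball (z\<^sub>0 x) \<delta> \<subseteq> states" using balls by blast
  have ex: "\<And>\<epsilon>. \<epsilon> \<in> {0<..\<epsilon>\<^sub>0} \<Longrightarrow> \<exists>z. bvp_solution (\<lambda>s. system s (s / \<epsilon>)) z \<and> (\<forall>x\<in>{0..1}. norm (z x - z\<^sub>0 x) \<le> \<delta> / 2)"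
    using main by blast
  have unique: "\<And>\<epsilon> z w. \<epsilon> \<in> {0<..\<epsilon>\<^sub>0} \<Longrightarrow> bvp_solution (\<lambda>s. system s (s / \<epsilon>)) z \<Longrightarrow> bvp_solution (\<lambda>s. system s (s / \<epsilon>)) w \<Longrightarrow>
      \<forall>x\<in>{0..1}. norm (z x - z\<^sub>0 x) \<le> \<delta> \<and> norm (w x - z\<^sub>0 x) \<le> \<delta> \<Longrightarrow> \<forall>x\<in>{0..1}. z x = w x"
    by (drule bspec[OF main], elim conjE, blast)
  have bound: "\<And>\<epsilon> z \<omega>. \<epsilon> \<in> {0<..\<epsilon>\<^sub>0} \<Longrightarrow> bvp_solution (\<lambda>s. system s (s / \<epsilon>)) z \<Longrightarrow>
      \<forall>x\<in>{0..1}. norm (z x - z\<^sub>0 x) \<le> \<delta> \<Longrightarrow>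
      \<forall>x\<in>{0..1}. norm (integral {0..x} (\<lambda>s. system s (s / \<epsilon>) (z\<^sub>0 s) - averaged s (z\<^sub>0 s))) \<le> \<omega> \<Longrightarrow>
      \<forall>x\<in>{0..1}. norm (z x - z\<^sub>0 x) \<le> C * \<omega>"
    by (drule bspec[OF main], elim conjE, blast)
  have norm_prod: "norm (fst w) \<le> norm w" "norm (snd w) \<le> norm w" "norm w \<le> norm (fst w) + norm (snd w)"
    for w :: "(real^'n) \<times> (real^'n)"
    using norm_fst_le[of "fst w" "snd w"] norm_snd_le[of "snd w" "fst w"] norm_Pair_le[of "fst w" "snd w"] by simp_all
  have to_bvp: "bvp_solution (\<lambda>s. system s (s / \<epsilon>)) (\<lambda>x. (u x, flux_eps a \<epsilon> u x))"
      "\<And>x. x \<in> {0..1} \<Longrightarrow> norm ((u x, flux_eps a \<epsilon> u x) - z\<^sub>0 x) \<le> \<delta>"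
    if e: "\<epsilon> \<in> {0<..\<epsilon>\<^sub>0}" and u: "local_solution a f u\<^sub>0 \<delta> \<epsilon> u" for \<epsilon> u
  proof -
    show le: "norm ((u x, flux_eps a \<epsilon> u x) - z\<^sub>0 x) \<le> \<delta>" if "x \<in> {0..1}" for x
      using norm_prod(3)[of "(u x, flux_eps a \<epsilon> u x) - z\<^sub>0 x"] u that by (force simp: local_solution_def z\<^sub>0_def)
    have "norm (u x) \<le> 1" if x: "x \<in> {0..1}" for x
    proof -
      have "(u x, flux_eps a \<epsilon> u x) \<in> cball (z\<^sub>0 x) \<delta>" using le[OF x] by (simp add: dist_norm norm_minus_commute)
      then show ?thesis using ball[OF x] by (auto simp: states_iff dest!: subsetD)
    qed
    then show "bvp_solution (\<lambda>s. system s (s / \<epsilon>)) (\<lambda>x. (u x, flux_eps a \<epsilon> u x))"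
      using e u by (intro weak_solution_eps_imp_bvp_solution) (auto simp: local_solution_def)
  qed
  show ?thesis
  proof (rule exI[of _ \<delta>], intro conjI \<open>\<delta> > 0\<close>, rule exI[of _ \<epsilon>\<^sub>0], intro conjI \<open>\<epsilon>\<^sub>0 > 0\<close>,
      rule exI[of _ C], intro conjI \<open>C \<ge> 0\<close> ballI allI impI)
    fix \<epsilon> assume e: "\<epsilon> \<in> {0<..\<epsilon>\<^sub>0}"
    obtain z where z: "bvp_solution (\<lambda>s. system s (s / \<epsilon>)) z" and near: "\<And>x. x \<in> {0..1} \<Longrightarrow> norm (z x - z\<^sub>0 x) \<le> \<delta> / 2"
      using ex[OF e] by blast
    have z_st: "z x \<in> states" if x: "x \<in> {0..1}" for x
    proof -
      have "z x \<in> cball (z\<^sub>0 x) \<delta>" using near[OF x] \<open>\<delta> > 0\<close> by (simp add: dist_norm norm_minus_commute)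
      then show ?thesis using ball[OF x] by blast
    qed
    have "0 < \<epsilon>" using e by simp
    have weak: "weak_solution_eps a f \<epsilon> (\<lambda>x. fst (z x))"
      "\<And>x. x \<in> {0..1} \<Longrightarrow> flux_eps a \<epsilon> (\<lambda>x. fst (z x)) x = snd (z x)"
      using bvp_solution_imp_weak_solution_eps[OF \<open>0 < \<epsilon>\<close> z] z_st by blast+
    show "\<exists>u. local_solution a f u\<^sub>0 \<delta> \<epsilon> u"
    proof (intro exI[of _ "\<lambda>x. fst (z x)"], unfold local_solution_def, intro conjI ballI)
      show "weak_solution_eps a f \<epsilon> (\<lambda>x. fst (z x))" by (rule weak(1))
      fix x :: real assume x: "x \<in> {0..1}"
      have "norm (fst (z x) - u\<^sub>0 x) \<le> \<delta> / 2" "norm (snd (z x) - flux_hom a u\<^sub>0 x) \<le> \<delta> / 2"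
        using norm_prod(1,2)[of "z x - z\<^sub>0 x"] near[OF x] by (simp_all add: z\<^sub>0_def)
      then show "norm (fst (z x) - u\<^sub>0 x) + norm (flux_eps a \<epsilon> (\<lambda>x. fst (z x)) x - flux_hom a u\<^sub>0 x) \<le> \<delta>"
        unfolding weak(2)[OF x] by linarith
    qed
  next
    fix \<epsilon> u w and x :: real
    assume e: "\<epsilon> \<in> {0<..\<epsilon>\<^sub>0}" and u: "local_solution a f u\<^sub>0 \<delta> \<epsilon> u" and w: "local_solution a f u\<^sub>0 \<delta> \<epsilon> w" and x: "x \<in> {0..1}"
    have "\<forall>x\<in>{0..1}. (u x, flux_eps a \<epsilon> u x) = (w x, flux_eps a \<epsilon> w x)"
      by (rule unique[OF e to_bvp(1)[OF e u] to_bvp(1)[OF e w]]) (use to_bvp(2)[OF e u] to_bvp(2)[OF e w] in blast)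
    then show "w x = u x" using x by auto
  next
    fix \<epsilon> u and \<omega> x :: real
    assume e: "\<epsilon> \<in> {0<..\<epsilon>\<^sub>0}" and u: "local_solution a f u\<^sub>0 \<delta> \<epsilon> u" and x: "x \<in> {0..1}"
      and \<omega>: "\<forall>x\<in>{0..1}. norm (integral {0..x} (\<lambda>s. system s (s / \<epsilon>) (z\<^sub>0 s) - averaged s (z\<^sub>0 s))) \<le> \<omega>"
    have "\<forall>x\<in>{0..1}. norm ((u x, flux_eps a \<epsilon> u x) - z\<^sub>0 x) \<le> C * \<omega>"
      by (rule bound[OF e to_bvp(1)[OF e u] _ \<omega>]) (use to_bvp(2)[OF e u] in blast)
    then have "norm ((u x, flux_eps a \<epsilon> u x) - z\<^sub>0 x) \<le> C * \<omega>" using x by blast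
    then show "norm (u x - u\<^sub>0 x) \<le> C * \<omega>" "norm (flux_eps a \<epsilon> u x - flux_hom a u\<^sub>0 x) \<le> C * \<omega>"
      using norm_prod(1,2)[of "(u x, flux_eps a \<epsilon> u x) - z\<^sub>0 x"] by (simp_all add: z\<^sub>0_def)
  qed
qed

lemma system_averaging_limit:
  assumes z: "continuous_on {0..1} z" "\<And>x. x \<in> {0..1} \<Longrightarrow> z x \<in> states" and "0 < \<eta>"
  shows "\<exists>\<epsilon>\<^sub>0>0. \<forall>\<epsilon>\<in>{0<..\<epsilon>\<^sub>0}. \<forall>x\<in>{0..1}.
    norm (integral {0..x} (\<lambda>s. system s (s / \<epsilon>) (z s) - averaged s (z s))) \<le> \<eta>"
proof -
  have "continuous_on ({0..1} \<times> UNIV) (\<lambda>s. system (fst (fst s, snd s)) (snd (fst s, snd s)) (z (fst s)))"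
    by (rule continuous_on_families[OF system_cont])
      (use z in \<open>auto intro!: continuous_intros continuous_on_compose2[OF z(1)]\<close>)
  then have "continuous_on ({0..1} \<times> UNIV) (\<lambda>(s, y). system s y (z s))" by (simp add: split_beta)
  from averaging_limit[OF this system_periodic \<open>0 < \<eta>\<close>] show ?thesis by (simp add: averaged_def)
qed

text \<open>
  Along a Lipschitz curve the system varies by \<open>O(\<epsilon>)\<close> within a cell, so freezing the slow variable costs \<open>O(\<epsilon>)\<close> in total.
\<close>

lemma system_averaging_rate:
  assumes smooth_x: "smooth_coeff_x a" "smooth_coeff_x f"
    and z: "bvp_solution averaged z" "\<And>x. x \<in> {0..1} \<Longrightarrow> z x \<in> states"
  shows "\<exists>K\<ge>0. \<forall>\<epsilon>>0. \<forall>x\<in>{0..1}.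
    norm (integral {0..x} (\<lambda>s. system s (s / \<epsilon>) (z s) - averaged s (z s))) \<le> K * \<epsilon>"
proof -
  note z_cont = bvp_solutionD(1)[OF z(1)]
  have "continuous_on ({0..1} \<times> UNIV) (\<lambda>s. system (fst (fst s, snd s)) (snd (fst s, snd s)) (z (fst s)))"
    by (rule continuous_on_families[OF system_cont])
      (use z(2) in \<open>auto intro!: continuous_intros continuous_on_compose2[OF z_cont]\<close>)
  then have cont: "continuous_on ({0..1} \<times> UNIV) (\<lambda>(s, y). system s y (z s))" by (simp add: split_beta)
  have per: "system s (y + 1) (z s) = system s y (z s)" if "s \<in> {0..1}" for s y by (rule system_periodic[OF that])
  obtain B where B: "0 \<le> B" "\<And>s y. s \<in> {0..1} \<Longrightarrow> norm (system s y (z s)) \<le> B"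
    using periodic_continuous_bounded[of "\<lambda>s y. system s y (z s)", OF cont per] by blast
  have "\<exists>L\<ge>0. \<forall>s\<in>{0..1}. \<forall>t\<in>{0..1}. norm (z s - z t) \<le> L * \<bar>s - t\<bar>"
    by (rule bvp_solution_lipschitz[OF z(1) averaged_curve_cont[OF z_cont z(2)]])
  from system_lipschitz_along_curve[OF smooth_x z_cont z(2) this]
  obtain \<Lambda> where \<Lambda>: "0 \<le> \<Lambda>" "\<And>s t y. s \<in> {0..1} \<Longrightarrow> t \<in> {0..1} \<Longrightarrow> norm (system s y (z s) - system t y (z t)) \<le> \<Lambda> * \<bar>s - t\<bar>"
    by blast
  have "norm (integral {0..x} (\<lambda>s. system s (s / \<epsilon>) (z s) - averaged s (z s))) \<le> 2 * (\<Lambda> * \<epsilon>) + 2 * B * \<epsilon>"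
    if "\<epsilon> > 0" "x \<in> {0..1}" for \<epsilon> x
    unfolding averaged_def
  proof (rule averaging_estimate[OF cont per B(2)])
    fix s t y :: real assume st: "s \<in> {0..1}" "t \<in> {0..1}" "\<bar>s - t\<bar> \<le> \<epsilon>"
    show "norm (system s y (z s) - system t y (z t)) \<le> \<Lambda> * \<epsilon>"
      by (rule order_trans[OF \<Lambda>(2)[OF st(1,2)] mult_left_mono[OF st(3) \<Lambda>(1)]])
  qed (use that in auto)
  then show ?thesis
    using \<Lambda>(1) B(1) by (intro exI[of _ "2 * \<Lambda> + 2 * B"]) (simp add: algebra_simps)
qed

end

theorem theorem1p1:
  fixes a f :: "real \<Rightarrow> real \<Rightarrow> real^'n::finite \<Rightarrow> real^'n \<Rightarrow> real^'n"
    and u\<^sub>0 :: "real \<Rightarrow> real^'n"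
    and m M :: real
  assumes A1: "periodic_coeff a" "periodic_coeff f"
    and A2: "smooth_coeff a" "smooth_coeff f"
    and A3: "0 < m" "m \<le> M" "monotone_lipschitz_coeff m M a"
    and sol: "weak_solution_hom a f u\<^sub>0"
    and small: "norm_inf u\<^sub>0 < 1"
    and nondegenerate: "\<And>u. weak_solution_lin a f u\<^sub>0 u \<Longrightarrow> \<forall>x\<in>{0..1}. u x = 0"
  shows "\<exists>\<epsilon>\<^sub>0>0. \<exists>\<delta>>0.
     (\<forall>\<epsilon>\<in>{0<..\<epsilon>\<^sub>0}. \<exists>u. local_solution a f u\<^sub>0 \<delta> \<epsilon> u \<and>
        (\<forall>w. local_solution a f u\<^sub>0 \<delta> \<epsilon> w \<longrightarrow> (\<forall>x\<in>{0..1}. w x = u x))) \<and>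
     (\<forall>U :: real \<Rightarrow> real \<Rightarrow> real^'n.
        (\<forall>\<epsilon>\<in>{0<..\<epsilon>\<^sub>0}. local_solution a f u\<^sub>0 \<delta> \<epsilon> (U \<epsilon>)) \<longrightarrow>
        uniform_limit {0..1}
          (\<lambda>\<epsilon> x. norm (U \<epsilon> x - u\<^sub>0 x) + norm (flux_eps a \<epsilon> (U \<epsilon>) x - flux_hom a u\<^sub>0 x))
          (\<lambda>_. 0) (at_right 0) \<and>
        (smooth_coeff_x a \<and> smooth_coeff_x f \<longrightarrow>
          (\<lambda>\<epsilon>. norm_inf (\<lambda>x. U \<epsilon> x - u\<^sub>0 x) +
                norm_inf (\<lambda>x. flux_eps a \<epsilon> (U \<epsilon>) x - flux_hom a u\<^sub>0 x))
            \<in> O[at_right 0](\<lambda>\<epsilon>. \<epsilon>)))"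
proof -
  interpret homogenization_problem a f m M
    by unfold_locales (fact A1 A2 A3)+
  have "C1_01 u\<^sub>0" using sol by (simp add: weak_solution_hom_def weak_solution_def)
  then have "continuous_on {0..1} u\<^sub>0" by (auto simp: C1_01_def intro: differentiable_imp_continuous_on)
  then have u0: "norm (u\<^sub>0 x) < 1" if "x \<in> {0..1}" for x
    using norm_le_norm_inf[of u\<^sub>0 x] that small by simp
  define z\<^sub>0 where "z\<^sub>0 x = (u\<^sub>0 x, flux_hom a u\<^sub>0 x)" for x
  have z0: "bvp_solution averaged z\<^sub>0" unfolding z\<^sub>0_def by (rule homogenized_bvp_solution[OF sol u0])
  have z0_st: "z\<^sub>0 x \<in> states" if "x \<in> {0..1}" for x using u0[OF that] by (simp add: z\<^sub>0_def states_iff)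
  let ?main = "\<lambda>\<delta> \<epsilon>\<^sub>0 C. \<forall>\<epsilon>\<in>{0<..\<epsilon>\<^sub>0}.
    (\<exists>u. local_solution a f u\<^sub>0 \<delta> \<epsilon> u) \<and>
    (\<forall>u w. local_solution a f u\<^sub>0 \<delta> \<epsilon> u \<longrightarrow> local_solution a f u\<^sub>0 \<delta> \<epsilon> w \<longrightarrow> (\<forall>x\<in>{0..1}. w x = u x)) \<and>
    (\<forall>u \<omega>. local_solution a f u\<^sub>0 \<delta> \<epsilon> u \<longrightarrow>
      (\<forall>x\<in>{0..1}. norm (integral {0..x} (\<lambda>s. system s (s / \<epsilon>) (z\<^sub>0 s) - averaged s (z\<^sub>0 s))) \<le> \<omega>) \<longrightarrow>
      (\<forall>x\<in>{0..1}. norm (u x - u\<^sub>0 x) \<le> C * \<omega> \<and> norm (flux_eps a \<epsilon> u x - flux_hom a u\<^sub>0 x) \<le> C * \<omega>))"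
  have "\<exists>\<delta>>0. \<exists>\<epsilon>\<^sub>0>0. \<exists>C\<ge>0. ?main \<delta> \<epsilon>\<^sub>0 C"
    unfolding z\<^sub>0_def by (rule homogenization_estimate[OF sol u0 nondegenerate])
  then obtain \<delta> \<epsilon>\<^sub>0 C where pos: "\<delta> > 0" "\<epsilon>\<^sub>0 > 0" "C \<ge> 0" and main: "?main \<delta> \<epsilon>\<^sub>0 C"
    by blast
  have ex: "\<And>\<epsilon>. \<epsilon> \<in> {0<..\<epsilon>\<^sub>0} \<Longrightarrow> \<exists>u. local_solution a f u\<^sub>0 \<delta> \<epsilon> u"
    using main by blast
  have unique: "\<And>\<epsilon> u w. \<epsilon> \<in> {0<..\<epsilon>\<^sub>0} \<Longrightarrow> local_solution a f u\<^sub>0 \<delta> \<epsilon> u \<Longrightarrow> local_solution a f u\<^sub>0 \<delta> \<epsilon> w \<Longrightarrow>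
      \<forall>x\<in>{0..1}. w x = u x"
    by (drule bspec[OF main], elim conjE, blast)
  have bound: "\<And>\<epsilon> u \<omega>. \<epsilon> \<in> {0<..\<epsilon>\<^sub>0} \<Longrightarrow> local_solution a f u\<^sub>0 \<delta> \<epsilon> u \<Longrightarrow>
      \<forall>x\<in>{0..1}. norm (integral {0..x} (\<lambda>s. system s (s / \<epsilon>) (z\<^sub>0 s) - averaged s (z\<^sub>0 s))) \<le> \<omega> \<Longrightarrow>
      \<forall>x\<in>{0..1}. norm (u x - u\<^sub>0 x) \<le> C * \<omega> \<and> norm (flux_eps a \<epsilon> u x - flux_hom a u\<^sub>0 x) \<le> C * \<omega>"
    by (drule bspec[OF main], elim conjE, blast)
  show ?thesis
  proof (rule exI[of _ \<epsilon>\<^sub>0], intro conjI \<open>\<epsilon>\<^sub>0 > 0\<close>, rule exI[of _ \<delta>], intro conjI \<open>\<delta> > 0\<close> ballI allI impI)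
    fix \<epsilon> assume "\<epsilon> \<in> {0<..\<epsilon>\<^sub>0}"
    then show "\<exists>u. local_solution a f u\<^sub>0 \<delta> \<epsilon> u \<and>
        (\<forall>w. local_solution a f u\<^sub>0 \<delta> \<epsilon> w \<longrightarrow> (\<forall>x\<in>{0..1}. w x = u x))"
      using ex unique by blast
  next
    fix U :: "real \<Rightarrow> real \<Rightarrow> real^'n"
    assume U: "\<forall>\<epsilon>\<in>{0<..\<epsilon>\<^sub>0}. local_solution a f u\<^sub>0 \<delta> \<epsilon> (U \<epsilon>)"
    show "uniform_limit {0..1}
          (\<lambda>\<epsilon> x. norm (U \<epsilon> x - u\<^sub>0 x) + norm (flux_eps a \<epsilon> (U \<epsilon>) x - flux_hom a u\<^sub>0 x))
          (\<lambda>_. 0) (at_right 0)"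
      unfolding uniform_limit_iff
    proof (intro allI impI)
      fix e :: real assume "0 < e"
      define \<eta> where "\<eta> = e / (4 * (C + 1))"
      have "\<eta> > 0" using \<open>0 < e\<close> pos by (simp add: \<eta>_def)
      have "e = \<eta> * (4 * (C + 1))" using pos by (simp add: \<eta>_def)
      then have "e = 4 * (C * \<eta>) + 4 * \<eta>" by (simp add: algebra_simps)
      moreover have "0 \<le> C * \<eta>" using pos \<open>\<eta> > 0\<close> by simp
      ultimately have C\<eta>: "2 * (C * \<eta>) < e" using \<open>\<eta> > 0\<close> by linarith
      obtain \<epsilon>\<^sub>1 where e1: "\<epsilon>\<^sub>1 > 0" "\<And>\<epsilon>. \<epsilon> \<in> {0<..\<epsilon>\<^sub>1} \<Longrightarrow>
          \<forall>x\<in>{0..1}. norm (integral {0..x} (\<lambda>s. system s (s / \<epsilon>) (z\<^sub>0 s) - averaged s (z\<^sub>0 s))) \<le> \<eta>"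
        using system_averaging_limit[OF bvp_solutionD(1)[OF z0] z0_st \<open>\<eta> > 0\<close>] by blast
      have "\<forall>\<^sub>F \<epsilon> in at_right 0. \<epsilon> \<in> {0<..<min \<epsilon>\<^sub>0 \<epsilon>\<^sub>1}"
        by (rule eventually_at_right_real) (use pos e1 in simp)
      then show "\<forall>\<^sub>F \<epsilon> in at_right 0. \<forall>x\<in>{0..1}.
          dist (norm (U \<epsilon> x - u\<^sub>0 x) + norm (flux_eps a \<epsilon> (U \<epsilon>) x - flux_hom a u\<^sub>0 x)) 0 < e"
      proof (rule eventually_mono, intro ballI)
        fix \<epsilon> x :: real assume \<epsilon>: "\<epsilon> \<in> {0<..<min \<epsilon>\<^sub>0 \<epsilon>\<^sub>1}" and x: "x \<in> {0..1}"
        have "norm (U \<epsilon> x - u\<^sub>0 x) \<le> C * \<eta> \<and> norm (flux_eps a \<epsilon> (U \<epsilon>) x - flux_hom a u\<^sub>0 x) \<le> C * \<eta>"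
          using bound[of \<epsilon> "U \<epsilon>" \<eta>] e1(2)[of \<epsilon>] U \<epsilon> x by auto
        then show "dist (norm (U \<epsilon> x - u\<^sub>0 x) + norm (flux_eps a \<epsilon> (U \<epsilon>) x - flux_hom a u\<^sub>0 x)) 0 < e"
          using C\<eta> by (simp add: dist_real_def)
      qed
    qed
    assume "smooth_coeff_x a \<and> smooth_coeff_x f"
    then obtain K where K: "K \<ge> 0" "\<And>\<epsilon>. \<epsilon> > 0 \<Longrightarrow>
        \<forall>x\<in>{0..1}. norm (integral {0..x} (\<lambda>s. system s (s / \<epsilon>) (z\<^sub>0 s) - averaged s (z\<^sub>0 s))) \<le> K * \<epsilon>"
      using system_averaging_rate[OF _ _ z0 z0_st] by blast
    have "\<forall>\<^sub>F \<epsilon> in at_right 0. \<epsilon> \<in> {0<..<\<epsilon>\<^sub>0}" by (rule eventually_at_right_real[OF \<open>\<epsilon>\<^sub>0 > 0\<close>])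
    then have "\<forall>\<^sub>F \<epsilon> in at_right 0. norm (norm_inf (\<lambda>x. U \<epsilon> x - u\<^sub>0 x) +
        norm_inf (\<lambda>x. flux_eps a \<epsilon> (U \<epsilon>) x - flux_hom a u\<^sub>0 x)) \<le> 2 * C * K * norm \<epsilon>"
    proof (rule eventually_mono)
      fix \<epsilon> assume \<epsilon>: "\<epsilon> \<in> {0<..<\<epsilon>\<^sub>0}"
      have le: "\<forall>x\<in>{0..1}. norm (U \<epsilon> x - u\<^sub>0 x) \<le> C * (K * \<epsilon>) \<and> norm (flux_eps a \<epsilon> (U \<epsilon>) x - flux_hom a u\<^sub>0 x) \<le> C * (K * \<epsilon>)"
        by (rule bound) (use U \<epsilon> K in auto)
      have "0 \<le> norm_inf (\<lambda>x. U \<epsilon> x - u\<^sub>0 x)" "norm_inf (\<lambda>x. U \<epsilon> x - u\<^sub>0 x) \<le> C * (K * \<epsilon>)"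
        "0 \<le> norm_inf (\<lambda>x. flux_eps a \<epsilon> (U \<epsilon>) x - flux_hom a u\<^sub>0 x)"
        "norm_inf (\<lambda>x. flux_eps a \<epsilon> (U \<epsilon>) x - flux_hom a u\<^sub>0 x) \<le> C * (K * \<epsilon>)"
        using le by (intro norm_inf_le[where B = "C * (K * \<epsilon>)"]; blast)+
      then show "norm (norm_inf (\<lambda>x. U \<epsilon> x - u\<^sub>0 x) +
          norm_inf (\<lambda>x. flux_eps a \<epsilon> (U \<epsilon>) x - flux_hom a u\<^sub>0 x)) \<le> 2 * C * K * norm \<epsilon>"
        using \<epsilon> by simp
    qed
    then show "(\<lambda>\<epsilon>. norm_inf (\<lambda>x. U \<epsilon> x - u\<^sub>0 x) +
        norm_inf (\<lambda>x. flux_eps a \<epsilon> (U \<epsilon>) x - flux_hom a u\<^sub>0 x)) \<in> O[at_right 0](\<lambda>\<epsilon>. \<epsilon>)"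
      by (rule bigoI)
  qed
qed

end
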